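(* Let $d\ge2$ and let $f:\mathbb{R}^d\to\mathbb{C}$ belong to $C_0(\mathbb{R}^d)$. Let $f$ and its partial derivatives $D^\eta f$, $\mathbf 0\le\eta<\mathbf 1$, be locally absolutely continuous on $(\mathbb{R}\setminus\{0\})^d$ in each variable. Let also the partial derivatives $D^\eta f$, $\mathbf 0<\eta\le\mathbf 1$, be almost everywhere bounded outside any neighborhood of the coordinate hyperplanes. If, for all $\chi,\eta,\zeta\in\{0,1\}^d$ such that $\chi+\eta+\zeta=\mathbf 1$, $$A_{\chi,\eta,\zeta}=\int_0^1\!\cdots\!\int_0^1\ \prod_{k:\zeta_k=1}\ln\frac{2}{x_k}\,dx_k\ \int_1^\infty\!\cdots\!\int_1^\infty\left(\ \int_{\prod_{j:\eta_j=1}[u_j,\infty)} f_{\chi+\eta,\zeta}(x)\,f_{\chi,\eta+\zeta}(x)\,dx_\eta\right)^{1/2}\prod_{i:\ \chi_i=1\ \text{or}\ \eta_i=1}\frac{du_i}{u_i}<\infty,$$ then $f\in A(\mathbb{R}^d)$.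
   Context: $C_0(\mathbb{R}^d)$ is the space of continuous functions on $\mathbb{R}^d$ tending to $0$ at infinity. One writes $f\in A(\mathbb{R}^d)$ if there is $g\in L_1(\mathbb{R}^d)$ with $f(y)=\int_{\mathbb{R}^d}g(x)e^{i(x,y)}\,dx$ for all $y$. The vectors $\chi,\eta,\zeta$ are $d$-dimensional with entries $0$ or $1$ (any of them may be the zero vector); $\mathbf 0=(0,\dots,0)$, $\mathbf 1=(1,\dots,1)$. Inequalities $\le$ between vectors are understood componentwise; $\eta<\mathbf 1$ means $\eta\le\mathbf 1$, $\eta\ne\mathbf 1$, and $\mathbf 0<\eta$ means $\eta\ge\mathbf 0$, $\eta\ne\mathbf 0$. Further, $D^\chi f(x)=\Big(\prod_{j:\chi_j=1}\frac{\partial}{\partial x_j}\Big)f(x)$. For $\eta+\zeta=\mathbf 1$ put $$f_{\eta,\zeta}(x)=\sup_{|u_i|\ge|x_i|,\ i:\eta_i=1}\ \ \operatorname{ess\,sup}_{|u_j|\ge|x_j|>0,\ j:\zeta_j=1}|D^\zeta f(u)|.$$ "Almost everywhere bounded outside any neighborhood of the coordinate hyperplanes" means essentially bounded on $\{x:|x_j|\ge\varepsilon,\ j=1,\dots,d\}$ for every $\varepsilon>0$. In $A_{\chi,\eta,\zeta}$: the outer integrals over $(0,1)$ are in the variables $x_k$ with $\zeta_k=1$; the integrals over $(1,\infty)$ are in the variables $u_i$ with $\chi_i=1$ or $\eta_i=1$; $x_\eta$ denotes the group of variables $x_j$ with $\eta_j=1$, over which the inner integral is taken ($x_j\in[u_j,\infty)$);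 and in the inner integrand the coordinates $x_i$ with $\chi_i=1$ are set equal to $u_i$. The whole expression under all integral signs is integrated iteratively (the logarithmic factor multiplies the rest). Integrations over empty groups of variables are omitted; in particular, if $\eta=\mathbf 0$ the inner expression is $(f_{\chi,\zeta}^2)^{1/2}=f_{\chi,\zeta}$. *)

theory Defs
  imports "HOL-Analysis.Analysis" "HOL-Probability.Essential_Supremum"
begin

text \<open>
  \<open>\<real>\<^sup>d\<close> is \<open>real ^ 'n\<close>; the linear order on \<open>'n\<close> only serves to fix the order of
  differentiation. A vector in \<open>{0,1}\<^sup>d\<close> is identified with the set of indices of its
  entries \<open>1\<close>: \<open>\<zero>\<close> is \<open>{}\<close>, \<open>\<one>\<close> is \<open>UNIV\<close>, componentwise \<open>\<le>\<close> is inclusion, and the sum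
  of vectors whose sum is again a 0-1 vector is the union of disjoint sets.
\<close>

definition off_hyperplanes :: "(real ^ 'n) set" where
  "off_hyperplanes = {x. \<forall>j. x $ j \<noteq> 0}"

definition line_restr :: "'n \<Rightarrow> (real ^ 'n \<Rightarrow> complex) \<Rightarrow> real ^ 'n \<Rightarrow> real \<Rightarrow> complex" where
  "line_restr j g x = (\<lambda>t. g (\<chi> i. if i = j then t else x $ i))"

definition partial_deriv :: "'n \<Rightarrow> (real ^ 'n \<Rightarrow> complex) \<Rightarrow> real ^ 'n \<Rightarrow> complex" where
  "partial_deriv j g x = vector_derivative (line_restr j g x) (at (x $ j))"

text \<open>
  \<open>D \<xi> f = \<partial>\<^sub>j\<^sub>1 (\<partial>\<^sub>j\<^sub>2 (\<dots> (\<partial>\<^sub>j\<^sub>k f)))\<close> where \<open>j\<^sub>1 < \<dots> < j\<^sub>k\<close> are the elements of \<open>\<xi>\<close>. The value is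
  arbitrary where a derivative does not exist; existence is expressed by \<open>D_exists\<close>.
\<close>

definition D ::
    "'n set \<Rightarrow> (real ^ 'n::{finite,linorder} \<Rightarrow> complex) \<Rightarrow> real ^ 'n::{finite,linorder} \<Rightarrow> complex" where
  "D \<xi> f = foldr partial_deriv (sorted_list_of_set \<xi>) f"

primrec iterated_partials_exist ::
    "'n list \<Rightarrow> (real ^ 'n \<Rightarrow> complex) \<Rightarrow> (real ^ 'n) set \<Rightarrow> bool" where
  "iterated_partials_exist [] f S \<longleftrightarrow> True"
| "iterated_partials_exist (j # js) f S \<longleftrightarrow>
     iterated_partials_exist js f S \<and>
     (\<forall>x\<in>S. line_restr j (foldr partial_deriv js f) x differentiable (at (x $ j)))"

definition D_exists ::
    "'n set \<Rightarrow> (real ^ 'n::{finite,linorder} \<Rightarrow> complex) \<Rightarrow>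
      (real ^ 'n::{finite,linorder}) set \<Rightarrow> bool" where
  "D_exists \<xi> f S \<longleftrightarrow> iterated_partials_exist (sorted_list_of_set \<xi>) f S"

text \<open>
  Here \<open>\<D>\<close> ranges over the finite families of non-overlapping closed subintervals
  \<open>K = [Inf K, Sup K]\<close> of \<open>[a, b]\<close>.
\<close>

definition abs_continuous_on_interval :: "real \<Rightarrow> real \<Rightarrow> (real \<Rightarrow> complex) \<Rightarrow> bool" where
  "abs_continuous_on_interval a b g \<longleftrightarrow>
     (\<forall>\<epsilon>>0. \<exists>\<delta>>0. \<forall>\<D> T. \<D> division_of T \<and> T \<subseteq> {a..b} \<and> (\<Sum>K\<in>\<D>. Sup K - Inf K) < \<delta> \<longrightarrow>
        (\<Sum>K\<in>\<D>. norm (g (Sup K) - g (Inf K))) < \<epsilon>)"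

definition locally_abs_continuous_on :: "real set \<Rightarrow> (real \<Rightarrow> complex) \<Rightarrow> bool" where
  "locally_abs_continuous_on S g \<longleftrightarrow>
     (\<forall>a b. a \<le> b \<and> {a..b} \<subseteq> S \<longrightarrow> abs_continuous_on_interval a b g)"

definition lac_in_each_variable :: "(real ^ 'n \<Rightarrow> complex) \<Rightarrow> bool" where
  "lac_in_each_variable g \<longleftrightarrow>
     (\<forall>j. \<forall>x\<in>off_hyperplanes. locally_abs_continuous_on (- {0}) (line_restr j g x))"

definition ess_bounded_off_hyperplanes :: "(real ^ 'n::finite \<Rightarrow> complex) \<Rightarrow> bool" where
  "ess_bounded_off_hyperplanes g \<longleftrightarrow>
     (\<forall>\<epsilon>>0. \<exists>C. AE x in lborel. (\<forall>j. \<epsilon> \<le> \<bar>x $ j\<bar>) \<longrightarrow> norm (g x) \<le> C)"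

definition C0 :: "(real ^ 'n::finite \<Rightarrow> complex) set" where
  "C0 = {f. continuous_on UNIV f \<and> (f \<longlongrightarrow> 0) at_infinity}"

definition A_space :: "(real ^ 'n::finite \<Rightarrow> complex) set" where
  "A_space = {f. \<exists>g :: real ^ 'n \<Rightarrow> complex. integrable lborel g \<and>
     (\<forall>y. f y = (\<integral>x. g x * exp (\<i> * complex_of_real (x \<bullet> y)) \<partial>lborel))}"

text \<open>
  The majorant \<open>f\<^sub>\<eta>\<^sub>,\<^sub>\<zeta>\<close>, used for complementary \<open>\<eta>\<close>, \<open>\<zeta>\<close>. In the supremum only the
  coordinates of \<open>w\<close> in \<open>\<eta>\<close> matter; the essential supremum is taken over the
  \<open>\<zeta>\<close>-coordinates \<open>v\<close> with the \<open>\<eta>\<close>-coordinates fixed, with respect to Lebesgue measure on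
  \<open>\<real>\<^sup>\<zeta>\<close> (a one-point measure of mass 1 if \<open>\<zeta> = {}\<close>).
\<close>

definition majorant ::
    "(real ^ 'n::{finite,linorder} \<Rightarrow> complex) \<Rightarrow> 'n set \<Rightarrow> 'n set \<Rightarrow> real ^ 'n::{finite,linorder} \<Rightarrow> ennreal" where
  "majorant f \<eta> \<zeta> x =
     (SUP w \<in> {w. \<forall>i\<in>\<eta>. \<bar>w $ i\<bar> \<ge> \<bar>x $ i\<bar>}.
        esssup (restrict_space (PiM \<zeta> (\<lambda>_. lborel)) {v. \<forall>j\<in>\<zeta>. \<bar>v j\<bar> \<ge> \<bar>x $ j\<bar> \<and> \<bar>x $ j\<bar> > 0})
          (\<lambda>v. ennreal (norm (D \<zeta> f (\<chi> i. if i \<in> \<zeta> then v i else w $ i)))))"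

definition ennsqrt :: "ennreal \<Rightarrow> ennreal" where
  "ennsqrt y = (if y = \<infinity> then \<infinity> else ennreal (sqrt (enn2real y)))"

text \<open>
  In \<open>A_integral f \<xi> \<eta> \<zeta>\<close> the set \<open>\<xi>\<close> is the paper's \<open>\<chi>\<close> (a reserved binder here). The point at
  which the majorants are evaluated has the coordinates \<open>x\<close> on \<open>\<zeta>\<close>, the inner integration
  variables \<open>y\<close> on \<open>\<eta>\<close> and \<open>u\<close> on \<open>\<xi>\<close>.
\<close>

definition A_integral ::
    "(real ^ 'n::{finite,linorder} \<Rightarrow> complex) \<Rightarrow> 'n set \<Rightarrow> 'n set \<Rightarrow> 'n set \<Rightarrow> ennreal" where
  "A_integral f \<xi> \<eta> \<zeta> =
     (\<integral>\<^sup>+ x \<in> (\<Pi>\<^sub>E k\<in>\<zeta>. {0<..<1}).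
        ennreal (\<Prod>k\<in>\<zeta>. ln (2 / x k)) *
        (\<integral>\<^sup>+ u \<in> (\<Pi>\<^sub>E i\<in>\<xi> \<union> \<eta>. {1<..}).
           ennsqrt
             (\<integral>\<^sup>+ y \<in> (\<Pi>\<^sub>E j\<in>\<eta>. {u j..}).
                (let z = (\<chi> i. if i \<in> \<zeta> then x i else if i \<in> \<eta> then y i else u i)
                 in majorant f (\<xi> \<union> \<eta>) \<zeta> z * majorant f \<xi> (\<eta> \<union> \<zeta>) z)
              \<partial>PiM \<eta> (\<lambda>_. lborel)) *
           ennreal (\<Prod>i\<in>\<xi> \<union> \<eta>. 1 / u i)
         \<partial>PiM (\<xi> \<union> \<eta>) (\<lambda>_. lborel))
      \<partial>PiM \<zeta> (\<lambda>_. lborel))"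

end

theory Submission
  imports Defs "HOL-Probability.Sinc_Integral" "HOL-Real_Asymp.Real_Asymp" "HOL-Library.Discrete_Functions"
begin

text \<open>
  Expand \<open>f\<close> in tensor products of Faber--Schauder functions over the nested grids
  \<open>2\<^sup>s (\<int> + \<theta>\<^sub>s)\<close>, \<open>\<theta>\<^sub>s \<in> {1/3, 2/3}\<close>, which never meet \<open>0\<close>. A hat function is the Fourier transform
  of a Fejer density, so a series of disjoint hats on one level has a norm in \<open>A\<close> of at most
  twice the \<open>\<ell>\<^sup>2\<close> norm of its coefficients: on the Fourier side one applies Cauchy--Schwarz with
  respect to the Fejer density, for which the exponentials at the grid points are orthonormal. It
  remains to sum these \<open>\<ell>\<^sup>2\<close> norms over all levels.

  A coefficient is a combination of mixed differences of \<open>f\<close> over boxes away from the coordinate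
  hyperplanes. In each variable the increment is either not used, or replaced by a derivative, or
  the geometric mean of both bounds is taken; these are the roles of \<open>\<chi>\<close>, \<open>\<zeta>\<close> and \<open>\<eta>\<close>, and the
  square of a mixed difference is bounded by a product of two majorants as in the inner integrand.
  Grouping by dyadic distance to the hyperplanes and applying Minkowski's inequality turns the sum
  into a dyadic sum that is dominated by the integrals because the majorants decrease in each
  \<open>\<bar>x\<^sub>j\<bar>\<close>.
\<close>

section \<open>Absolutely continuous functions\<close>

text \<open>The integrals see the \<open>\<zeta>\<close> coordinates only on \<open>(0,1)\<close>
  and the other coordinates only beyond 1, whereas every level has cells at all distances from the
  hyperplanes. So each cell must be given a kind together with a scale \<open>m\<close> in the range
  of that kind: \<open>m \<le> 0\<close> for \<open>KZ\<close>, \<open>m \<ge> 1\<close> for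
  \<open>KX\<close> and \<open>KH\<close>. The derivative bound cannot serve a fine level
  arbitrarily far out, because infinitely many cells would share the scale 0 and the l2 norm would
  diverge; beyond the distance \<open>2 powi tau s\<close> the geometric mean takes over. The
  logarithm comes from the cell around 0: its nodes are joined to 0 by halving, so the scale
  \<open>2 powi m\<close> is met on every level from \<open>m + 3\<close> to 3. Scales are absolute,
  not relative to the level, so the levels can be summed before the majorants are touched. The top
  derivative is controlled only by an essential supremum, while the lower ones are absolutely
  continuous in each variable. Hence a mean value inequality with an almost everywhere bound is
  required; it is derived from the definition of absolute continuity by Vitali coverings and a
  gauge.\<close>

lemma sum_increments_division:
  fixes h :: "real \<Rightarrow> 'a::real_normed_vector"
  assumes "r division_of {a..b}" "a \<le> b"
  shows "(\<Sum>K\<in>r. h (Sup K) - h (Inf K)) = h b - h a"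
proof -
  let ?p = "(\<lambda>K. (Inf K, K)) ` r"
  note r = division_ofD[OF assms(1)]
  have inf: "Inf K \<in> K" if "K \<in> r" for K
    using r(3,4)[OF that] by auto
  have "?p tagged_division_of {a..b}"
    unfolding tagged_division_of
  proof (intro conjI allI impI)
    fix x K assume "(x, K) \<in> ?p"
    then show "x \<in> K" "K \<subseteq> {a..b}" "\<exists>a b. K = cbox a b" using r(2,4) inf by blast+
  next
    fix x1 K1 x2 K2 assume "(x1, K1) \<in> ?p \<and> (x2, K2) \<in> ?p \<and> (x1, K1) \<noteq> (x2, K2)"
    then have "K1 \<in> r" "K2 \<in> r" "K1 \<noteq> K2" by auto
    then show "interior K1 \<inter> interior K2 = {}" by (rule r(5))
  next
    show "\<Union>{K. \<exists>x. (x, K) \<in> ?p} = {a..b}" unfolding r(6)[symmetric] by blast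
  qed (use r(1) in auto)
  from additive_tagged_division_1[OF assms(2) this, of h]
  show ?thesis
    by (subst (asm) sum.reindex) (auto simp: inj_on_def)
qed

text \<open>The parts of \<open>D1\<close> not covered by \<open>D2\<close> form non-overlapping
  intervals of total length below \<open>\<delta>\<close>, and their increments add up to exactly
  the difference of the two sums. Absolute continuity is applied to these gaps.\<close>

lemma AC_gap:
  fixes h :: "real \<Rightarrow> real"
  assumes AC: "abs_continuous_on_interval a b (\<lambda>t. complex_of_real (h t))" and e: "\<epsilon> > 0"
  shows "\<exists>\<delta>>0. \<forall>D1 D2. D1 division_of \<Union>D1 \<longrightarrow> pairwise disjnt D1 \<longrightarrow> D2 division_of \<Union>D2 \<longrightarrow> \<Union>D1 \<subseteq> {a..b} \<longrightarrow>
      (\<forall>L\<in>D2. \<exists>K\<in>D1. L \<subseteq> interior K) \<longrightarrow>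
      (\<Sum>K\<in>D1. Sup K - Inf K) - (\<Sum>K\<in>D2. Sup K - Inf K) < \<delta> \<longrightarrow>
      (\<Sum>K\<in>D2. h (Sup K) - h (Inf K)) < (\<Sum>K\<in>D1. h (Sup K) - h (Inf K)) + \<epsilon>"
proof -
  from AC e obtain \<delta> where d: "\<delta> > 0" and AC0: "\<forall>\<D> T. \<D> division_of T \<and> T \<subseteq> {a..b} \<and>
      (\<Sum>K\<in>\<D>. Sup K - Inf K) < \<delta> \<longrightarrow>
        (\<Sum>K\<in>\<D>. norm (complex_of_real (h (Sup K)) - complex_of_real (h (Inf K)))) < \<epsilon>"
    using AC[unfolded abs_continuous_on_interval_def, THEN spec, THEN mp, OF e] by (elim exE conjE)
  note AC' = AC0[rule_format, OF conjI, OF _ conjI]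
  have "(\<Sum>K\<in>D2. h (Sup K) - h (Inf K)) < (\<Sum>K\<in>D1. h (Sup K) - h (Inf K)) + \<epsilon>"
    if D1: "D1 division_of \<Union>D1" and dj: "pairwise disjnt D1" and D2: "D2 division_of \<Union>D2" and sub: "\<Union>D1 \<subseteq> {a..b}"
     and inn: "\<And>L. L \<in> D2 \<Longrightarrow> \<exists>K\<in>D1. L \<subseteq> interior K"
     and len: "(\<Sum>K\<in>D1. Sup K - Inf K) - (\<Sum>K\<in>D2. Sup K - Inf K) < \<delta>" for D1 D2
  proof -
    note d1 = division_ofD[OF D1] and d2 = division_ofD[OF D2]
    define S where "S K = {L\<in>D2. L \<subseteq> interior K}" for K
    \<comment> \<open>The intervals of \<open>D2\<close> inside \<open>K\<close> are completed to a
      division of \<open>K\<close>; the added intervals are the gaps.\<close>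
    have "\<exists>r. S K \<subseteq> r \<and> r division_of K" if "K \<in> D1" for K
    proof -
      obtain u v where K: "K = cbox u v" using d1(4)[OF \<open>K \<in> D1\<close>] by auto
      have "S K division_of \<Union>(S K)"
        by (rule division_of_subset[OF D2]) (auto simp: S_def)
      moreover have "\<Union>(S K) \<subseteq> cbox u v" using interior_subset[of K] K by (auto simp: S_def)
      ultimately show ?thesis using partial_division_extend_interval[of "S K" u v] K by metis
    qed
    then obtain r where r: "\<And>K. K \<in> D1 \<Longrightarrow> S K \<subseteq> r K" "\<And>K. K \<in> D1 \<Longrightarrow> r K division_of K" by metis
    define G where "G = (\<Union>K\<in>D1. r K - S K)"
    have sumS: "(\<Sum>L\<in>D2. \<phi> L) = (\<Sum>K\<in>D1. \<Sum>L\<in>S K. \<phi> L)" for \<phi> :: "real set \<Rightarrow> real"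
    proof -
      have D2eq: "D2 = (\<Union>K\<in>D1. S K)" using inn by (auto simp: S_def)
      have "S K \<inter> S K' = {}" if "K \<in> D1" "K' \<in> D1" "K \<noteq> K'" for K K'
        using d1(5)[OF that] d2(3) unfolding S_def by blast
      then show ?thesis
        by (subst D2eq, subst sum.UNION_disjoint) (use d1(1) d2(1) in \<open>auto simp: S_def\<close>)
    qed
    \<comment> \<open>Full disjointness of \<open>D1\<close> enters here: neighbours sharing an
      endpoint could have a degenerate interval in common, and the families \<open>r K\<close> would
      not be disjoint.\<close>
    have disjr: "L \<inter> L' = {}"
      if "K \<in> D1" "K' \<in> D1" "K \<noteq> K'" "L \<in> r K" "L' \<in> r K'" for K K' L L'
    proof -
      have "L \<subseteq> K" "L' \<subseteq> K'" using division_ofD(2)[OF r(2)] that by auto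
      moreover have "K \<inter> K' = {}" using dj that(1-3) by (simp add: pairwise_def disjnt_def)
      ultimately show ?thesis by blast
    qed
    have Gdiv: "G division_of \<Union>G"
    proof (rule division_ofI)
      show "finite G" unfolding G_def using d1(1) division_ofD(1)[OF r(2)] by auto
      fix K assume "K \<in> G"
      then show "K \<subseteq> \<Union>G" "K \<noteq> {}" "\<exists>a b. K = cbox a b"
        unfolding G_def using division_ofD(3,4)[OF r(2)] by blast+
    next
      fix L L' assume "L \<in> G" "L' \<in> G" "L \<noteq> L'"
      then obtain K K' where K: "K \<in> D1" "K' \<in> D1" "L \<in> r K" "L' \<in> r K'" by (auto simp: G_def)
      show "interior L \<inter> interior L' = {}"
      proof (cases "K = K'")
        case True
        then show ?thesis using division_ofD(5)[OF r(2)] K \<open>L \<noteq> L'\<close> by blast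
      next
        case False
        then show ?thesis using disjr[OF K(1,2) False K(3,4)] interior_subset[of L] interior_subset[of L'] by blast
      qed
    qed auto
    have sumG: "(\<Sum>L\<in>G. k (Sup L) - k (Inf L)) = (\<Sum>K\<in>D1. k (Sup K) - k (Inf K)) - (\<Sum>L\<in>D2. k (Sup L) - k (Inf L))"
      for k :: "real \<Rightarrow> real"
    proof -
      have "(\<Sum>L\<in>G. k (Sup L) - k (Inf L)) = (\<Sum>K\<in>D1. \<Sum>L\<in>r K - S K. k (Sup L) - k (Inf L))"
        unfolding G_def
      proof (rule sum.UNION_disjoint)
        show "\<forall>K\<in>D1. finite (r K - S K)" using division_ofD(1)[OF r(2)] by auto
        show "\<forall>K\<in>D1. \<forall>K'\<in>D1. K \<noteq> K' \<longrightarrow> (r K - S K) \<inter> (r K' - S K') = {}"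
        proof (intro ballI impI equals0I)
          fix K K' L assume K: "K \<in> D1" "K' \<in> D1" "K \<noteq> K'" and "L \<in> (r K - S K) \<inter> (r K' - S K')"
          then have L: "L \<in> r K" "L \<in> r K'" by auto
          show False using disjr[OF K L] division_ofD(3)[OF r(2)[OF K(1)] L(1)] by simp
        qed
      qed (use d1 in auto)
      also have "\<dots> = (\<Sum>K\<in>D1. (k (Sup K) - k (Inf K)) - (\<Sum>L\<in>S K. k (Sup L) - k (Inf L)))"
      proof (rule sum.cong)
        fix K assume K: "K \<in> D1"
        obtain u v where uv: "K = {u..v}" "u \<le> v" using d1(3,4)[OF K] by fastforce
        have "(\<Sum>L\<in>r K. k (Sup L) - k (Inf L)) = k v - k u"
          by (rule sum_increments_division) (use r(2)[OF K] uv in auto)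
        then show "(\<Sum>L\<in>r K - S K. k (Sup L) - k (Inf L)) = (k (Sup K) - k (Inf K)) - (\<Sum>L\<in>S K. k (Sup L) - k (Inf L))"
          using division_ofD(1)[OF r(2)[OF K]] r(1)[OF K] uv by (simp add: sum_diff)
      qed auto
      finally show ?thesis by (simp add: sum_subtractf sumS)
    qed
    have "(\<Sum>K\<in>G. norm (complex_of_real (h (Sup K)) - complex_of_real (h (Inf K)))) < \<epsilon>"
    proof (rule AC'[OF Gdiv])
      have "L \<subseteq> \<Union>D1" if "L \<in> G" for L
        using that division_ofD(2)[OF r(2)] by (auto simp del: Union_iff simp: G_def intro: Sup_upper2)
      then have "\<Union>G \<subseteq> \<Union>D1" by (rule Union_least)
      then show "\<Union>G \<subseteq> {a..b}" using sub by auto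
      show "(\<Sum>K\<in>G. Sup K - Inf K) < \<delta>" using sumG[of "\<lambda>x. x"] len by simp
    qed
    also have "(\<Sum>K\<in>G. norm (complex_of_real (h (Sup K)) - complex_of_real (h (Inf K)))) = (\<Sum>K\<in>G. \<bar>h (Sup K) - h (Inf K)\<bar>)"
      by (simp flip: of_real_diff)
    finally have "\<bar>\<Sum>K\<in>G. h (Sup K) - h (Inf K)\<bar> < \<epsilon>" using sum_abs[of "\<lambda>K. h (Sup K) - h (Inf K)" G] by linarith
    then show ?thesis using sumG[of h] by linarith
  qed
  with d show ?thesis by (intro exI[of _ \<delta>] conjI allI impI) auto
qed

text \<open>Vitali's theorem for balls gives a countable disjoint family. Dropping endpoints costs a
  null set, and continuity of the measure from above allows the family to be cut to a finite one at
  the price of \<open>\<epsilon>\<close>. The remainder is measured against the interiors, so that a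
  second covering can be carried out inside the open set they form.\<close>

lemma Vitali_intervals:
  fixes S :: "real set"
  assumes S: "S \<in> lmeasurable" and \<epsilon>: "\<epsilon> > 0"
    and cov: "\<And>x d. x \<in> S \<Longrightarrow> 0 < d \<Longrightarrow> \<exists>u v. u < v \<and> x \<in> {u..v} \<and> v - u < d \<and> P u v"
  obtains D where "D division_of \<Union>D" "pairwise disjnt D"
    "\<forall>K\<in>D. \<exists>u v. u < v \<and> K = {u..v} \<and> P u v"
    "measure lebesgue (S - (\<Union>K\<in>D. interior K)) < \<epsilon>"
    "(\<Sum>K\<in>D. Sup K - Inf K) = measure lebesgue (\<Union>D)"
    "(\<Union>K\<in>D. interior K) \<in> lmeasurable"
    "measure lebesgue (\<Union>K\<in>D. interior K) = measure lebesgue (\<Union>D)"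
    "\<Union>D \<in> lmeasurable"
proof -
  define I where "I = {(u,v). u < v \<and> P u (v::real)}"
  define c where "c = (\<lambda>(u,v). (u + v) / 2 :: real)"
  define \<rho> where "\<rho> = (\<lambda>(u,v). (v - u) / 2 :: real)"
  have cb: "cball (c i) (\<rho> i) = {fst i..snd i}" for i
    by (cases i) (simp add: c_def \<rho>_def cball_eq_atLeastAtMost field_simps)
  have "\<exists>i. i \<in> I \<and> x \<in> cball (c i) (\<rho> i) \<and> \<rho> i < d" if x: "x \<in> S" and d: "0 < d" for x d
  proof -
    obtain u v where "u < v" "x \<in> {u..v}" "v - u < d" "P u v" using cov[OF x d] by blast
    then have "(u,v) \<in> I \<and> x \<in> cball (c (u,v)) (\<rho> (u,v)) \<and> \<rho> (u,v) < d"
      by (simp add: cb) (simp add: I_def \<rho>_def)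
    then show ?thesis by blast
  qed
  note cov' = this
  obtain C where C: "countable C" "C \<subseteq> I"
     "pairwise (\<lambda>i j. disjnt (cball (c i) (\<rho> i)) (cball (c j) (\<rho> j))) C"
     "negligible(S - (\<Union>i \<in> C. cball (c i) (\<rho> i)))"
  proof (rule Vitali_covering_theorem_cballs[of I \<rho> S c])
    show "0 < \<rho> i" if "i \<in> I" for i using that by (auto simp: I_def \<rho>_def)
  qed (use cov' in blast)+
  define J where "J i = {fst i<..<snd i}" for i :: "real \<times> real"
  have negJ: "negligible (S - (\<Union>i\<in>C. J i))"
  proof (rule negligible_subset)
    show "negligible ((S - (\<Union>i \<in> C. cball (c i) (\<rho> i))) \<union> (\<Union>i\<in>C. {fst i, snd i}))"
      using C(1,4) by (intro negligible_Un negligible_countable_Union) auto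
    show "S - (\<Union>i\<in>C. J i) \<subseteq> (S - (\<Union>i \<in> C. cball (c i) (\<rho> i))) \<union> (\<Union>i\<in>C. {fst i, snd i})"
      unfolding cb J_def by fastforce
  qed
  have "\<exists>F. finite F \<and> F \<subseteq> C \<and> measure lebesgue (S - (\<Union>i\<in>F. J i)) < \<epsilon>"
  proof (cases "C = {}")
    case True
    then show ?thesis using negJ \<epsilon> by (intro exI[of _ "{}"]) (auto simp: negligible_imp_measure0)
  next
    case False
    define g where "g = from_nat_into C"
    have rg: "range g = C" using False C(1) by (simp add: g_def)
    define A where "A n = S - (\<Union>k<n. J (g k))" for n :: nat
    have "(\<lambda>n. measure lebesgue (A n)) \<longlonglongrightarrow> measure lebesgue (\<Inter>n. A n)"
    proof (rule Lim_measure_decseq)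
      show "range A \<subseteq> sets lebesgue" using S unfolding A_def J_def by (auto intro!: sets.Diff)
      show "decseq A" unfolding A_def decseq_def by fastforce
      fix n
      have "A n \<in> lmeasurable" unfolding A_def J_def using S by (intro fmeasurable_Diff) auto
      then show "emeasure lebesgue (A n) \<noteq> \<infinity>" by (simp add: fmeasurableD2 del: emeasure_completion)
    qed
    moreover have "(\<Inter>n. A n) = S - (\<Union>i\<in>C. J i)"
      unfolding A_def rg[symmetric] by (auto intro: lessI)
    ultimately have "(\<lambda>n. measure lebesgue (A n)) \<longlonglongrightarrow> 0"
      using negJ by (simp add: negligible_imp_measure0)
    then obtain n where "measure lebesgue (A n) < \<epsilon>"
      using \<epsilon> by (metis (mono_tags, lifting) eventually_sequentially order_refl order_tendstoD(2))
    then show ?thesis using rg by (intro exI[of _ "g ` {..<n}"]) (auto simp: A_def)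
  qed
  then obtain F where F: "finite F" "F \<subseteq> C" "measure lebesgue (S - (\<Union>i\<in>F. J i)) < \<epsilon>" by blast
  define D where "D = (\<lambda>i. {fst i..snd i}) ` F"
  have lt: "fst i < snd i" if "i \<in> F" for i using that F C(2) by (auto simp: I_def)
  have int: "(\<Union>K\<in>D. interior K) = (\<Union>i\<in>F. J i)"
    by (auto simp: D_def J_def interior_atLeastAtMost_real)
  have pw: "pairwise disjnt D"
    unfolding D_def pairwise_image using C(3) F(2) unfolding pairwise_def cb by blast
  have fin: "finite D" using F by (simp add: D_def)
  have Dprop: "\<exists>u v. u < v \<and> K = {u..v} \<and> P u v" if "K \<in> D" for K
    using that F C(2) by (auto simp: D_def I_def)
  have div: "D division_of \<Union>D"
  proof (rule division_ofI)
    fix K assume "K \<in> D"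
    then show "K \<subseteq> \<Union>D" "K \<noteq> {}" "\<exists>a b. K = cbox a b" using Dprop[of K] by (auto simp del: Union_iff)
  next
    fix K K' assume "K \<in> D" "K' \<in> D" "K \<noteq> K'"
    then have "K \<inter> K' = {}" using pw by (simp add: pairwise_def disjnt_def)
    then show "interior K \<inter> interior K' = {}" using interior_subset[of K] interior_subset[of K'] by blast
  qed (use fin in auto)
  have meas: "K \<in> lmeasurable" if "K \<in> D" for K using Dprop[OF that] by auto
  have disj: "disjoint D" using pw by simp
  have sum: "(\<Sum>K\<in>D. Sup K - Inf K) = measure lebesgue (\<Union>D)"
  proof -
    have "measure lebesgue (\<Union>D) = (\<Sum>K\<in>D. measure lebesgue K)"
      using fin meas pw by (intro measure_negligible_finite_Union) (auto simp: pairwise_def disjnt_def)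
    also have "\<dots> = (\<Sum>K\<in>D. Sup K - Inf K)"
      using Dprop by (intro sum.cong) fastforce+
    finally show ?thesis by simp
  qed
  have lm: "(\<Union>K\<in>D. interior K) \<in> lmeasurable" unfolding int J_def using F by (intro fmeasurable.finite_UN) auto
  have "measure lebesgue (\<Union>D) = measure lebesgue (\<Union>K\<in>D. interior K)"
  proof (rule measure_negligible_symdiff)
    show "(\<Union>K\<in>D. interior K) \<in> lmeasurable" by (rule lm)
    have "sym_diff (\<Union>K\<in>D. interior K) (\<Union>D) \<subseteq> (\<Union>i\<in>F. {fst i, snd i})"
      unfolding int
    proof
      fix x assume "x \<in> sym_diff (\<Union>i\<in>F. J i) (\<Union>D)"
      then consider i where "i \<in> F" "x \<in> J i" "x \<notin> \<Union>D" | i where "i \<in> F" "x \<in> {fst i..snd i}" "x \<notin> (\<Union>i\<in>F. J i)"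
        unfolding D_def by blast
      then show "x \<in> (\<Union>i\<in>F. {fst i, snd i})"
      proof cases
        case 1
        then show ?thesis by (auto simp: D_def J_def)
      next
        case 2
        then have "x \<notin> J i" by blast
        then have "x \<in> {fst i, snd i}" using 2(2) by (auto simp: J_def)
        then show ?thesis using 2(1) by blast
      qed
    qed
    then show "negligible (sym_diff (\<Union>K\<in>D. interior K) (\<Union>D))"
      by (rule negligible_subset[rotated]) (use F in auto)
  qed
  moreover have "\<Union>D \<in> lmeasurable" using fin meas by (intro fmeasurable.finite_Union) auto
  ultimately show ?thesis using that[OF div pw] Dprop F(3) sum lm int by auto
qed

text \<open>The points inside arbitrarily short intervals of slope above \<open>q\<close>, in place
  of a superlevel set of an upper derivative. Because the intervals straddle the point, the set is a
  countable intersection of open sets and therefore measurable for every \<open>h\<close>.\<close>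

definition steep_set :: "real \<Rightarrow> real \<Rightarrow> (real \<Rightarrow> real) \<Rightarrow> real \<Rightarrow> real set" where
  "steep_set a b h q = (\<Inter>n. \<Union>{{u<..<v} | u v. a \<le> u \<and> u < v \<and> v \<le> b \<and> v - u < inverse (real (Suc n)) \<and>
      q * (v - u) < h v - h u})"

lemma steep_set_sets: "steep_set a b h q \<in> sets lebesgue"
proof -
  have "open (\<Union>{{u<..<v} | u v. a \<le> u \<and> u < v \<and> v \<le> b \<and> v - u < inverse (real (Suc n)) \<and>
      q * (v - u) < h v - h u})" for n by (rule open_Union) auto
  then show ?thesis unfolding steep_set_def by (intro sets.countable_INT) auto
qed

lemma steep_set_subset: "steep_set a b h q \<subseteq> {a<..<b}"
proof
  fix x assume "x \<in> steep_set a b h q"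
  then have "x \<in> \<Union>{{u<..<v} | u v. a \<le> u \<and> u < v \<and> v \<le> b \<and> v - u < inverse (real (Suc 0)) \<and>
      q * (v - u) < h v - h u}" unfolding steep_set_def by blast
  then show "x \<in> {a<..<b}" by auto
qed

lemma steep_set_lmeasurable: "steep_set a b h q \<in> lmeasurable"
  by (rule fmeasurableI2[of "{a<..<b}"]) (use steep_set_sets steep_set_subset in auto)

lemma steep_setD:
  assumes "x \<in> steep_set a b h q" "d > 0"
  shows "\<exists>u v. a \<le> u \<and> u < v \<and> v \<le> b \<and> x \<in> {u<..<v} \<and> v - u < d \<and> q * (v - u) < h v - h u"
proof -
  obtain n where n: "inverse (real (Suc n)) < d" using assms(2) reals_Archimedean by blast
  have "x \<in> \<Union>{{u<..<v} | u v. a \<le> u \<and> u < v \<and> v \<le> b \<and> v - u < inverse (real (Suc n)) \<and>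
      q * (v - u) < h v - h u}" using assms(1) unfolding steep_set_def by blast
  then obtain u v where "a \<le> u" "u < v" "v \<le> b" "v - u < inverse (real (Suc n))"
      "q * (v - u) < h v - h u" "x \<in> {u<..<v}" by blast
  then show ?thesis using n by (intro exI[of _ u] exI[of _ v]) auto
qed

lemma steep_setI:
  assumes "\<And>d. d > 0 \<Longrightarrow> \<exists>u v. a \<le> u \<and> u < v \<and> v \<le> b \<and> x \<in> {u<..<v} \<and> v - u < d \<and> q * (v - u) < h v - h u"
  shows "x \<in> steep_set a b h q"
  unfolding steep_set_def
proof
  fix n
  show "x \<in> \<Union>{{u<..<v} | u v. a \<le> u \<and> u < v \<and> v \<le> b \<and> v - u < inverse (real (Suc n)) \<and>
      q * (v - u) < h v - h u}" (is "x \<in> \<Union>?S")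
  proof -
    obtain u v where "a \<le> u" "u < v" "v \<le> b" "x \<in> {u<..<v}" "v - u < inverse (real (Suc n))" "q * (v - u) < h v - h u"
      using assms[of "inverse (real (Suc n))"] by auto
    then have "{u<..<v} \<in> ?S" "x \<in> {u<..<v}" by blast+
    then show ?thesis by (rule UnionI)
  qed
qed

text \<open>
  If the set had positive measure, cover it almost exactly by intervals of slope at most \<open>- r\<close> and
  then, inside those, almost exactly by intervals of slope at least \<open>r\<close>. The two families have
  nearly equal total length, so absolute continuity forces nearly equal total increments.
\<close>

lemma AC_steep_both_negligible:
  fixes h :: "real \<Rightarrow> real"
  assumes AC: "abs_continuous_on_interval a b (\<lambda>t. complex_of_real (h t))" and r: "r > 0"
  shows "negligible (steep_set a b h r \<inter> steep_set a b (\<lambda>t. - h t) r)" (is "negligible ?E")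
proof (rule ccontr)
  assume neg: "\<not> negligible ?E"
  have E: "?E \<in> lmeasurable" by (intro fmeasurable.Int steep_set_lmeasurable)
  define m where "m = measure lebesgue ?E"
  have m: "m > 0" using neg negligible_iff_measure0[OF E] measure_nonneg[of lebesgue] by (auto simp: m_def less_le)
  have rm: "r * m / 2 > 0" using r m by simp
  obtain \<delta> where d: "\<delta> > 0" and gap0:
    "\<forall>D1 D2. D1 division_of \<Union>D1 \<longrightarrow> pairwise disjnt D1 \<longrightarrow> D2 division_of \<Union>D2 \<longrightarrow> \<Union>D1 \<subseteq> {a..b} \<longrightarrow>
      (\<forall>L\<in>D2. \<exists>K\<in>D1. L \<subseteq> interior K) \<longrightarrow>
      (\<Sum>K\<in>D1. Sup K - Inf K) - (\<Sum>K\<in>D2. Sup K - Inf K) < \<delta> \<longrightarrow>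
      (\<Sum>K\<in>D2. h (Sup K) - h (Inf K)) < (\<Sum>K\<in>D1. h (Sup K) - h (Inf K)) + r * m / 2"
    using AC_gap[OF AC rm] by (elim exE conjE)
  note gap = gap0[rule_format]
  \<comment> \<open>The first family has length between \<open>m - \<eta>\<close> and
    \<open>m + \<eta>\<close>, the second more than \<open>m - 2 * \<eta>\<close>. Thus
    \<open>3 * \<eta> < \<delta>\<close> keeps the lengths within \<open>\<delta>\<close> of each
    other, and \<open>\<eta> \<le> m / 2\<close> leaves the first family at least
    \<open>m / 2\<close>.\<close>
  define \<eta> where "\<eta> = min (m / 2) (\<delta> / 4)"
  have \<eta>: "\<eta> > 0" "\<eta> \<le> m / 2" "\<eta> \<le> \<delta> / 4" using m d by (auto simp: \<eta>_def)
  obtain O0 where O0: "open O0" "?E \<subseteq> O0" "O0 - ?E \<in> lmeasurable" "emeasure lebesgue (O0 - ?E) < ennreal \<eta>"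
    using sets_lebesgue_outer_open[of ?E \<eta>] E \<eta> by (metis fmeasurableD)
  have O0m: "O0 \<in> lmeasurable"
    using fmeasurable.Un[OF O0(3) E] O0(2) by (simp add: Un_absorb2)
  have O0le: "measure lebesgue O0 < m + \<eta>"
  proof -
    have "measure lebesgue (O0 - ?E) < \<eta>"
      using O0(3,4) \<eta> by (simp add: emeasure_eq_measure2 ennreal_less_iff)
    then show ?thesis using measurable_measure_Diff[OF O0m, of ?E] E O0(2) by (simp add: m_def)
  qed
  obtain D1 where D1: "D1 division_of \<Union>D1" "pairwise disjnt D1"
    "\<forall>K\<in>D1. \<exists>u v. u < v \<and> K = {u..v} \<and> ({u..v} \<subseteq> O0 \<inter> {a..b} \<and> h v - h u \<le> - r * (v - u))"
    "measure lebesgue (?E - (\<Union>K\<in>D1. interior K)) < \<eta>"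
    "(\<Sum>K\<in>D1. Sup K - Inf K) = measure lebesgue (\<Union>D1)"
    "(\<Union>K\<in>D1. interior K) \<in> lmeasurable"
    "measure lebesgue (\<Union>K\<in>D1. interior K) = measure lebesgue (\<Union>D1)" "\<Union>D1 \<in> lmeasurable"
  proof (rule Vitali_intervals[OF E \<eta>(1), where P="\<lambda>u v. {u..v} \<subseteq> O0 \<inter> {a..b} \<and> h v - h u \<le> - r * (v - u)"])
    fix x d assume x: "x \<in> ?E" and d: "(0::real) < d"
    obtain e where e: "e > 0" "ball x e \<subseteq> O0" using O0(1,2) x openE by blast
    obtain u v where uv: "a \<le> u" "u < v" "v \<le> b" "x \<in> {u<..<v}" "v - u < min d e" "r * (v - u) < - h v - - h u"
      using steep_setD[of x a b "\<lambda>t. - h t" r "min d e"] x d e by auto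
    have "{u..v} \<subseteq> ball x e" using uv by (auto simp: dist_real_def)
    then show "\<exists>u v. u < v \<and> x \<in> {u..v} \<and> v - u < d \<and> ({u..v} \<subseteq> O0 \<inter> {a..b} \<and> h v - h u \<le> - r * (v - u))"
      using uv e by (intro exI[of _ u] exI[of _ v]) auto
  qed
  define W where "W = (\<Union>K\<in>D1. interior K)"
  have EW: "?E \<inter> W \<in> lmeasurable" using E D1(6) unfolding W_def by (rule fmeasurable.Int)
  obtain D2 where D2: "D2 division_of \<Union>D2" "pairwise disjnt D2"
    "\<forall>K\<in>D2. \<exists>u v. u < v \<and> K = {u..v} \<and> ((\<exists>K\<in>D1. {u..v} \<subseteq> interior K) \<and> h v - h u \<ge> r * (v - u))"
    "measure lebesgue (?E \<inter> W - (\<Union>K\<in>D2. interior K)) < \<eta>"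
    "(\<Sum>K\<in>D2. Sup K - Inf K) = measure lebesgue (\<Union>D2)"
    "(\<Union>K\<in>D2. interior K) \<in> lmeasurable"
    "measure lebesgue (\<Union>K\<in>D2. interior K) = measure lebesgue (\<Union>D2)" "\<Union>D2 \<in> lmeasurable"
  proof (rule Vitali_intervals[OF EW \<eta>(1), where P="\<lambda>u v. (\<exists>K\<in>D1. {u..v} \<subseteq> interior K) \<and> h v - h u \<ge> r * (v - u)"])
    fix x d assume x: "x \<in> ?E \<inter> W" and d: "(0::real) < d"
    then obtain K where K: "K \<in> D1" "x \<in> interior K" by (auto simp: W_def)
    obtain e where e: "e > 0" "ball x e \<subseteq> interior K" using K(2) openE[OF open_interior] by blast
    obtain u v where uv: "a \<le> u" "u < v" "v \<le> b" "x \<in> {u<..<v}" "v - u < min d e" "r * (v - u) < h v - h u"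
      using steep_setD[of x a b h r "min d e"] x d e by auto
    have "{u..v} \<subseteq> ball x e" using uv by (auto simp: dist_real_def)
    then show "\<exists>u v. u < v \<and> x \<in> {u..v} \<and> v - u < d \<and> ((\<exists>K\<in>D1. {u..v} \<subseteq> interior K) \<and> h v - h u \<ge> r * (v - u))"
      using uv e K by (intro exI[of _ u] exI[of _ v]) auto
  qed
  have sub1: "\<Union>D1 \<subseteq> {a..b}" using D1(3) by blast
  have le1: "measure lebesgue (\<Union>D1) < m + \<eta>"
  proof -
    have "\<Union>D1 \<subseteq> O0" using D1(3) by blast
    moreover have "\<Union>D1 \<in> sets lebesgue" using D1(8) by (rule fmeasurableD)
    ultimately have "measure lebesgue (\<Union>D1) \<le> measure lebesgue O0" using O0m by (intro measure_mono_fmeasurable)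
    then show ?thesis using O0le by simp
  qed
  have split: "measure lebesgue S \<le> measure lebesgue (S - T) + measure lebesgue T"
    if "S \<in> lmeasurable" "T \<in> lmeasurable" for S T :: "real set"
  proof -
    have "measure lebesgue S \<le> measure lebesgue ((S - T) \<union> T)"
      using that by (intro measure_mono_fmeasurable) (auto intro: fmeasurable.Un fmeasurable_Diff)
    also have "\<dots> \<le> measure lebesgue (S - T) + measure lebesgue T"
      using that by (intro measure_Un_le) auto
    finally show ?thesis .
  qed
  have ge1: "m < measure lebesgue (\<Union>D1) + \<eta>"
    using split[OF E D1(6)] D1(4,7) by (simp add: m_def)
  have ge2: "m < measure lebesgue (\<Union>D2) + 2 * \<eta>"
  proof -
    have "m \<le> measure lebesgue (?E - W) + measure lebesgue (?E \<inter> W)"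
      using measure_Un_le[of "?E - W" lebesgue "?E \<inter> W"] E EW D1(6) unfolding m_def Un_Diff_Int W_def
      by (auto intro: fmeasurableD)
    moreover have "measure lebesgue (?E - W) < \<eta>" using D1(4) by (simp add: W_def)
    ultimately show ?thesis using split[OF EW D2(6)] D2(4,7) by linarith
  qed
  have "(\<Sum>K\<in>D2. h (Sup K) - h (Inf K)) < (\<Sum>K\<in>D1. h (Sup K) - h (Inf K)) + r * m / 2"
  proof (rule gap[OF D1(1,2) D2(1) sub1])
    show "\<exists>K\<in>D1. L \<subseteq> interior K" if "L \<in> D2" for L using bspec[OF D2(3) that] by blast
    show "(\<Sum>K\<in>D1. Sup K - Inf K) - (\<Sum>K\<in>D2. Sup K - Inf K) < \<delta>"
      using le1 ge2 \<eta> unfolding D1(5) D2(5) by linarith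
  qed
  \<comment> \<open>The increments over \<open>D2\<close> add up to at least 0, those over
    \<open>D1\<close> to at most \<open>- r * m / 2\<close>; this contradicts the gap estimate with
    the allowance \<open>r * m / 2\<close>.\<close>
  moreover have "0 \<le> (\<Sum>K\<in>D2. h (Sup K) - h (Inf K))"
  proof (rule sum_nonneg)
    fix K assume "K \<in> D2"
    then obtain u v where "u < v" "K = {u..v}" "h v - h u \<ge> r * (v - u)" using D2(3) by blast
    moreover have "r * (v - u) \<ge> 0" using \<open>u < v\<close> r by simp
    ultimately show "0 \<le> h (Sup K) - h (Inf K)" by simp
  qed
  moreover have "(\<Sum>K\<in>D1. h (Sup K) - h (Inf K)) \<le> (\<Sum>K\<in>D1. - r * (Sup K - Inf K))"
  proof (rule sum_mono)
    fix K assume "K \<in> D1"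
    then obtain u v where "u < v" "K = {u..v}" "h v - h u \<le> - r * (v - u)" using D1(3) by blast
    then show "h (Sup K) - h (Inf K) \<le> - r * (Sup K - Inf K)" by simp
  qed
  moreover have "(\<Sum>K\<in>D1. - r * (Sup K - Inf K)) = - r * measure lebesgue (\<Union>D1)"
    unfolding D1(5)[symmetric] by (simp add: sum_distrib_left)
  moreover have "r * (m / 2) \<le> r * measure lebesgue (\<Union>D1)"
    using ge1 \<eta> r by (intro mult_left_mono) auto
  ultimately show False by simp
qed

text \<open>At these points the slopes over short intervals are unbounded above. If the set had
  measure \<open>m > 0\<close> in a window shorter than \<open>\<delta>\<close>, disjoint intervals
  of total length above \<open>m / 2\<close> and slope at least \<open>q > 2 / m\<close> would have
  increments adding up to at least 1, against absolute continuity with \<epsilon> = 1.\<close>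

lemma AC_steep_negligible_infinite:
  fixes h :: "real \<Rightarrow> real"
  assumes AC: "abs_continuous_on_interval a b (\<lambda>t. complex_of_real (h t))"
  shows "negligible (\<Inter>q::nat. steep_set a b h q)" (is "negligible ?E")
proof -
  have E: "?E \<in> sets lebesgue" using steep_set_sets by (intro sets.countable_INT) auto
  obtain \<delta> where d: "\<delta> > 0" and AC0: "\<forall>\<D> T. \<D> division_of T \<and> T \<subseteq> {a..b} \<and>
      (\<Sum>K\<in>\<D>. Sup K - Inf K) < \<delta> \<longrightarrow>
        (\<Sum>K\<in>\<D>. norm (complex_of_real (h (Sup K)) - complex_of_real (h (Inf K)))) < 1"
    using AC[unfolded abs_continuous_on_interval_def, THEN spec, THEN mp, OF zero_less_one] by (elim exE conjE)
  have small: "negligible (?E \<inter> {c<..<c + \<delta> / 2})" (is "negligible ?F") for c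
  proof (rule ccontr)
    assume neg: "\<not> negligible ?F"
    have F: "?F \<in> lmeasurable"
      by (rule fmeasurableI2[of "{c<..<c + \<delta> / 2}"]) (use E in auto)
    define m where "m = measure lebesgue ?F"
    have m: "m > 0" using neg negligible_iff_measure0[OF F] measure_nonneg[of lebesgue] by (auto simp: m_def less_le)
    obtain q :: nat where q: "real q > 2 / m" using reals_Archimedean2 by blast
    obtain D where D: "D division_of \<Union>D" "pairwise disjnt D"
    "\<forall>K\<in>D. \<exists>u v. u < v \<and> K = {u..v} \<and> ({u..v} \<subseteq> {a..b} \<inter> {c<..<c + \<delta> / 2} \<and> real q * (v - u) \<le> h v - h u)"
    "measure lebesgue (?F - (\<Union>K\<in>D. interior K)) < m / 2"
    "(\<Sum>K\<in>D. Sup K - Inf K) = measure lebesgue (\<Union>D)"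
    "(\<Union>K\<in>D. interior K) \<in> lmeasurable"
    "measure lebesgue (\<Union>K\<in>D. interior K) = measure lebesgue (\<Union>D)" "\<Union>D \<in> lmeasurable"
    proof (rule Vitali_intervals[OF F half_gt_zero[OF m], where P="\<lambda>u v. {u..v} \<subseteq> {a..b} \<inter> {c<..<c + \<delta> / 2} \<and> real q * (v - u) \<le> h v - h u"])
      fix x d assume x: "x \<in> ?F" and d: "(0::real) < d"
      obtain e where e: "e > 0" "ball x e \<subseteq> {c<..<c + \<delta> / 2}" using x openE[of "{c<..<c + \<delta> / 2}" x] by (metis IntD2 open_greaterThanLessThan)
      obtain u v :: real where uv: "a \<le> u" "u < v" "v \<le> b" "x \<in> {u<..<v}" "v - u < min d e" "real q * (v - u) < h v - h u"
        using steep_setD[of x a b h q "min d e"] x d e by auto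
      have "{u..v} \<subseteq> ball x e" using uv by (auto simp: dist_real_def)
      then show "\<exists>u v. u < v \<and> x \<in> {u..v} \<and> v - u < d \<and> ({u..v} \<subseteq> {a..b} \<inter> {c<..<c + \<delta> / 2} \<and> real q * (v - u) \<le> h v - h u)"
        using uv e by (intro exI[of _ u] exI[of _ v]) auto
    qed
    have sub: "\<Union>D \<subseteq> {a..b}" "\<Union>D \<subseteq> {c<..<c + \<delta> / 2}" using D(3) by blast+
    have "\<Union>D \<in> sets lebesgue" using D(8) by (rule fmeasurableD)
    then have "measure lebesgue (\<Union>D) \<le> measure lebesgue {c<..<c + \<delta> / 2}"
      using sub by (intro measure_mono_fmeasurable) auto
    then have len: "(\<Sum>K\<in>D. Sup K - Inf K) < \<delta>" using D(5) d by simp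
    have "(\<Sum>K\<in>D. norm (complex_of_real (h (Sup K)) - complex_of_real (h (Inf K)))) < 1"
      using AC0 D(1) sub(1) len by blast
    moreover have "(\<Sum>K\<in>D. q * (Sup K - Inf K)) \<le> (\<Sum>K\<in>D. norm (complex_of_real (h (Sup K)) - complex_of_real (h (Inf K))))"
    proof (rule sum_mono)
      fix K assume "K \<in> D"
      then obtain u v where "u < v" "K = {u..v}" "real q * (v - u) \<le> h v - h u" using D(3) by blast
      then show "q * (Sup K - Inf K) \<le> norm (complex_of_real (h (Sup K)) - complex_of_real (h (Inf K)))"
        by (simp flip: of_real_diff)
    qed
    moreover have "(\<Sum>K\<in>D. q * (Sup K - Inf K)) = q * measure lebesgue (\<Union>D)"
      unfolding D(5)[symmetric] by (simp add: sum_distrib_left)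
    moreover have "measure lebesgue (\<Union>D) > m / 2"
    proof -
      have "m \<le> measure lebesgue ((?F - (\<Union>K\<in>D. interior K)) \<union> (\<Union>K\<in>D. interior K))" unfolding m_def
        using F D(6) by (intro measure_mono_fmeasurable) (auto intro!: fmeasurable.Un[OF fmeasurable_Diff] fmeasurableD)
      also have "\<dots> \<le> measure lebesgue (?F - (\<Union>K\<in>D. interior K)) + measure lebesgue (\<Union>K\<in>D. interior K)"
        using F D(6) by (intro measure_Un_le) (auto intro: fmeasurableD)
      finally show ?thesis using D(4,7) by linarith
    qed
    then have "real q * measure lebesgue (\<Union>D) \<ge> (2 / m) * (m / 2)"
      using q m by (intro mult_mono) auto
    ultimately show False using m by simp
  qed
  \<comment> \<open>Windows of length \<open>\<delta> / 2\<close> at steps of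
    \<open>\<delta> / 4\<close>: the overlap puts every point inside an open window.\<close>
  have "?E \<subseteq> (\<Union>c::int. ?E \<inter> {real_of_int c * (\<delta> / 4)<..<real_of_int c * (\<delta> / 4) + \<delta> / 2})"
  proof
    fix x assume x: "x \<in> ?E"
    define c where "c = \<lceil>x / (\<delta> / 4)\<rceil> - 1"
    have "real_of_int c < x / (\<delta> / 4)" "x / (\<delta> / 4) < real_of_int c + 2" unfolding c_def by linarith+
    then have "real_of_int c * (\<delta> / 4) < x" "x < real_of_int c * (\<delta> / 4) + \<delta> / 2" using d by (auto simp: field_simps)
    then show "x \<in> (\<Union>c::int. ?E \<inter> {real_of_int c * (\<delta> / 4)<..<real_of_int c * (\<delta> / 4) + \<delta> / 2})" using x by auto
  qed
  moreover have "negligible (\<Union>c::int. ?E \<inter> {real_of_int c * (\<delta> / 4)<..<real_of_int c * (\<delta> / 4) + \<delta> / 2})"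
    using small by (intro negligible_countable_Union) auto
  ultimately show ?thesis using negligible_subset by blast
qed

section \<open>Continuity and closure properties of absolutely continuous functions\<close>

lemma AC_continuous_on:
  assumes AC: "abs_continuous_on_interval a b g"
  shows "continuous_on {a..b} g"
  unfolding continuous_on_iff
proof (intro ballI allI impI)
  fix x e assume x: "x \<in> {a..b}" and e: "(0::real) < e"
  obtain \<delta> where d: "\<delta> > 0" and AC0: "\<forall>\<D> T. \<D> division_of T \<and> T \<subseteq> {a..b} \<and>
      (\<Sum>K\<in>\<D>. Sup K - Inf K) < \<delta> \<longrightarrow> (\<Sum>K\<in>\<D>. norm (g (Sup K) - g (Inf K))) < e"
    using AC[unfolded abs_continuous_on_interval_def, THEN spec, THEN mp, OF e] by (elim exE conjE)
  have *: "dist (g v) (g u) < e" if "u \<le> v" "u \<in> {a..b}" "v \<in> {a..b}" "v - u < \<delta>" for u v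
  proof -
    have "{{u..v}} division_of {u..v}" using that(1) by (auto simp: division_of_def)
    then show ?thesis using AC0[THEN spec[of _ "{{u..v}}"], THEN spec[of _ "{u..v}"]] that by (auto simp: dist_norm)
  qed
  show "\<exists>d>0. \<forall>x'\<in>{a..b}. dist x' x < d \<longrightarrow> dist (g x') (g x) < e"
  proof (intro exI conjI ballI impI)
    fix x' assume "x' \<in> {a..b}" "dist x' x < \<delta>"
    then show "dist (g x') (g x) < e" using *[of x x'] *[of x' x] x by (cases "x \<le> x'") (auto simp: dist_real_def dist_commute)
  qed (rule d)
qed

lemma AC_add:
  assumes "abs_continuous_on_interval a b f" "abs_continuous_on_interval a b g"
  shows "abs_continuous_on_interval a b (\<lambda>t. f t + g t)"
  unfolding abs_continuous_on_interval_def
proof (intro allI impI)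
  fix e :: real assume "e > 0" then have e: "e / 2 > 0" by simp
  obtain d1 where d1: "d1 > 0" and f: "\<forall>\<D> T. \<D> division_of T \<and> T \<subseteq> {a..b} \<and>
      (\<Sum>K\<in>\<D>. Sup K - Inf K) < d1 \<longrightarrow> (\<Sum>K\<in>\<D>. norm (f (Sup K) - f (Inf K))) < e / 2"
    using assms(1)[unfolded abs_continuous_on_interval_def, THEN spec, THEN mp, OF e] by (elim exE conjE)
  obtain d2 where d2: "d2 > 0" and g: "\<forall>\<D> T. \<D> division_of T \<and> T \<subseteq> {a..b} \<and>
      (\<Sum>K\<in>\<D>. Sup K - Inf K) < d2 \<longrightarrow> (\<Sum>K\<in>\<D>. norm (g (Sup K) - g (Inf K))) < e / 2"
    using assms(2)[unfolded abs_continuous_on_interval_def, THEN spec, THEN mp, OF e] by (elim exE conjE)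
  show "\<exists>\<delta>>0. \<forall>\<D> T. \<D> division_of T \<and> T \<subseteq> {a..b} \<and> (\<Sum>K\<in>\<D>. Sup K - Inf K) < \<delta> \<longrightarrow>
        (\<Sum>K\<in>\<D>. norm (f (Sup K) + g (Sup K) - (f (Inf K) + g (Inf K)))) < e"
  proof (intro exI[of _ "min d1 d2"] conjI allI impI)
    fix \<D> T assume D: "\<D> division_of T \<and> T \<subseteq> {a..b} \<and> (\<Sum>K\<in>\<D>. Sup K - Inf K) < min d1 d2"
    have "(\<Sum>K\<in>\<D>. norm (f (Sup K) + g (Sup K) - (f (Inf K) + g (Inf K)))) \<le>
        (\<Sum>K\<in>\<D>. norm (f (Sup K) - f (Inf K)) + norm (g (Sup K) - g (Inf K)))"
      by (intro sum_mono) (metis add_diff_add norm_triangle_ineq)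
    also have "\<dots> < e" using f[rule_format, of \<D> T] g[rule_format, of \<D> T] D by (simp add: sum.distrib)
    finally show "(\<Sum>K\<in>\<D>. norm (f (Sup K) + g (Sup K) - (f (Inf K) + g (Inf K)))) < e" .
  qed (use d1 d2 in auto)
qed

lemma AC_dominated:
  assumes "abs_continuous_on_interval a b f" "C > 0"
    and "\<And>u v. norm (g v - g u) \<le> C * norm (f v - f u)"
  shows "abs_continuous_on_interval a b g"
  unfolding abs_continuous_on_interval_def
proof (intro allI impI)
  fix e :: real assume "e > 0" then have e: "e / C > 0" using assms(2) by simp
  obtain d1 where d1: "d1 > 0" and f: "\<forall>\<D> T. \<D> division_of T \<and> T \<subseteq> {a..b} \<and>
      (\<Sum>K\<in>\<D>. Sup K - Inf K) < d1 \<longrightarrow> (\<Sum>K\<in>\<D>. norm (f (Sup K) - f (Inf K))) < e / C"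
    using assms(1)[unfolded abs_continuous_on_interval_def, THEN spec, THEN mp, OF e] by (elim exE conjE)
  show "\<exists>\<delta>>0. \<forall>\<D> T. \<D> division_of T \<and> T \<subseteq> {a..b} \<and> (\<Sum>K\<in>\<D>. Sup K - Inf K) < \<delta> \<longrightarrow>
        (\<Sum>K\<in>\<D>. norm (g (Sup K) - g (Inf K))) < e"
  proof (intro exI[of _ d1] conjI allI impI)
    fix \<D> T assume D: "\<D> division_of T \<and> T \<subseteq> {a..b} \<and> (\<Sum>K\<in>\<D>. Sup K - Inf K) < d1"
    have "(\<Sum>K\<in>\<D>. norm (g (Sup K) - g (Inf K))) \<le> (\<Sum>K\<in>\<D>. C * norm (f (Sup K) - f (Inf K)))"
      by (intro sum_mono assms)
    also have "\<dots> < e" using f[rule_format, of \<D> T] D assms(2) by (simp add: field_simps flip: sum_distrib_left)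
    finally show "(\<Sum>K\<in>\<D>. norm (g (Sup K) - g (Inf K))) < e" .
  qed (rule d1)
qed

lemma AC_linear: "abs_continuous_on_interval a b (\<lambda>t. complex_of_real (c * t))"
proof -
  have *: "abs_continuous_on_interval a b complex_of_real"
    unfolding abs_continuous_on_interval_def
  proof (intro allI impI exI conjI)
    fix e \<D> T assume "\<D> division_of T \<and> T \<subseteq> {a..b} \<and> (\<Sum>K\<in>\<D>. Sup K - Inf K) < (e::real)"
    then have D: "\<D> division_of T" "(\<Sum>K\<in>\<D>. Sup K - Inf K) < e" by auto
    have "(\<Sum>K\<in>\<D>. norm (complex_of_real (Sup K) - complex_of_real (Inf K))) = (\<Sum>K\<in>\<D>. Sup K - Inf K)"
    proof (rule sum.cong)
      fix K assume "K \<in> \<D>"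
      then obtain u v where "K = cbox u v" "K \<noteq> {}" using division_ofD(3,4)[OF D(1)] by metis
      then show "norm (complex_of_real (Sup K) - complex_of_real (Inf K)) = Sup K - Inf K"
        by (auto simp flip: of_real_diff)
    qed auto
    then show "(\<Sum>K\<in>\<D>. norm (complex_of_real (Sup K) - complex_of_real (Inf K))) < e" using D by simp
  qed
  show ?thesis
  proof (rule AC_dominated[OF *, of "\<bar>c\<bar> + 1"])
    fix u v :: real
    have "complex_of_real (c * v) - complex_of_real (c * u) = of_real c * (of_real v - of_real u)" by (simp add: algebra_simps)
    then have "norm (complex_of_real (c * v) - complex_of_real (c * u)) = \<bar>c\<bar> * norm (complex_of_real v - complex_of_real u)"
      by (simp only: norm_mult norm_of_real)
    also have "\<dots> \<le> (\<bar>c\<bar> + 1) * norm (complex_of_real v - complex_of_real u)" by (intro mult_right_mono) auto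
    finally show "norm (complex_of_real (c * v) - complex_of_real (c * u)) \<le> (\<bar>c\<bar> + 1) * norm (complex_of_real v - complex_of_real u)" .
  qed auto
qed

text \<open>Subtracting the line of slope \<open>(p + q) / 2\<close> turns slopes above
  \<open>q\<close> and below \<open>p\<close> into slopes above \<open>(q - p) / 2\<close> and below
  its negative, which is the symmetric case.\<close>

lemma AC_steep_gap_negligible:
  fixes h :: "real \<Rightarrow> real"
  assumes AC: "abs_continuous_on_interval a b (\<lambda>t. complex_of_real (h t))" and pq: "p < q"
  shows "negligible (steep_set a b h q \<inter> steep_set a b (\<lambda>t. - h t) (- p))"
proof -
  define c where "c = (p + q) / 2"
  have "abs_continuous_on_interval a b (\<lambda>t. complex_of_real (h t - c * t))"
    using AC_add[OF AC AC_linear[of a b "- c"]] by simp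
  moreover have "(q - p) / 2 > 0" using pq by simp
  ultimately have "negligible (steep_set a b (\<lambda>t. h t - c * t) ((q - p) / 2) \<inter> steep_set a b (\<lambda>t. - (h t - c * t)) ((q - p) / 2))"
    by (rule AC_steep_both_negligible)
  moreover have "((q - p) / 2 * (v - u) < h v - c * v - (h u - c * u)) = (q * (v - u) < h v - h u)" for u v
  proof -
    have "(q - p) / 2 * (v - u) + c * (v - u) = q * (v - u)" by (simp add: c_def field_simps)
    then show ?thesis by (auto simp: algebra_simps)
  qed
  moreover have "((q - p) / 2 * (v - u) < - (h v - c * v) - - (h u - c * u)) = (- p * (v - u) < - h v - - h u)" for u v
  proof -
    have "(q - p) / 2 * (v - u) - c * (v - u) = - p * (v - u)" by (simp add: c_def field_simps)
    then show ?thesis by (auto simp: algebra_simps)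
  qed
  ultimately show ?thesis unfolding steep_set_def by simp
qed

text \<open>Off the null set, the slopes over short intervals around \<open>t\<close> stay bounded
  and do not oscillate across a gap between two rationals, so they converge to the infimum
  \<open>L\<close> of their rational eventual upper bounds. Straddling intervals give the derivative
  once one endpoint tends to \<open>t\<close>, which uses continuity.\<close>

lemma AC_real_differentiable_ae:
  fixes h :: "real \<Rightarrow> real"
  assumes AC: "abs_continuous_on_interval a b (\<lambda>t. complex_of_real (h t))"
  obtains N where "negligible N" "\<And>t. t \<in> {a<..<b} - N \<Longrightarrow> \<exists>L. (h has_real_derivative L) (at t)"
proof -
  have ACn: "abs_continuous_on_interval a b (\<lambda>t. complex_of_real (- h t))"
    by (rule AC_dominated[OF AC, of 1]) (auto simp: norm_minus_commute)
  define N where "N = (\<Union>(p,q)\<in>{(p,q)\<in>\<rat>\<times>\<rat>. p < q}. steep_set a b h q \<inter> steep_set a b (\<lambda>t. - h t) (- p))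
    \<union> (\<Inter>q::nat. steep_set a b h q) \<union> (\<Inter>q::nat. steep_set a b (\<lambda>t. - h t) q)"
  have cnt: "countable {(p::real,q)\<in>\<rat>\<times>\<rat>. p < q}"
    by (rule countable_subset[of _ "\<rat>\<times>\<rat>"]) (auto intro: countable_rat)
  have "negligible N" unfolding N_def
  proof (intro negligible_Un negligible_countable_Union AC_steep_negligible_infinite AC ACn)
    show "countable ((\<lambda>(p, q). steep_set a b h q \<inter> steep_set a b (\<lambda>t. - h t) (- p)) ` {(p,q)\<in>\<rat>\<times>\<rat>. p < q})"
      using cnt by (rule countable_image)
  qed (use AC_steep_gap_negligible[OF AC] in auto)
  moreover have "\<exists>L. (h has_real_derivative L) (at t)" if t: "t \<in> {a<..<b} - N" for t
  proof -
    define Le where "Le q \<longleftrightarrow> t \<notin> steep_set a b h q" for q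
    define Ge where "Ge p \<longleftrightarrow> t \<notin> steep_set a b (\<lambda>t. - h t) (- p)" for p
    have LeD: "\<exists>d>0. \<forall>u v. a \<le> u \<and> v \<le> b \<and> t \<in> {u<..<v} \<and> v - u < d \<longrightarrow> h v - h u \<le> q * (v - u)" if "Le q" for q
    proof (rule ccontr)
      assume neg: "\<not> ?thesis"
      have "t \<in> steep_set a b h q"
      proof (rule steep_setI)
        fix d :: real assume "d > 0"
        then obtain u v where "a \<le> u" "v \<le> b" "t \<in> {u<..<v}" "v - u < d" "\<not> h v - h u \<le> q * (v - u)" using neg by blast
        then show "\<exists>u v. a \<le> u \<and> u < v \<and> v \<le> b \<and> t \<in> {u<..<v} \<and> v - u < d \<and> q * (v - u) < h v - h u"
          by (intro exI[of _ u] exI[of _ v]) auto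
      qed
      then show False using that by (simp add: Le_def)
    qed
    have GeD: "\<exists>d>0. \<forall>u v. a \<le> u \<and> v \<le> b \<and> t \<in> {u<..<v} \<and> v - u < d \<longrightarrow> h v - h u \<ge> p * (v - u)" if "Ge p" for p
    proof (rule ccontr)
      assume neg: "\<not> ?thesis"
      have "t \<in> steep_set a b (\<lambda>t. - h t) (- p)"
      proof (rule steep_setI)
        fix d :: real assume "d > 0"
        then obtain u v where "a \<le> u" "v \<le> b" "t \<in> {u<..<v}" "v - u < d" "\<not> h v - h u \<ge> p * (v - u)" using neg by blast
        then show "\<exists>u v. a \<le> u \<and> u < v \<and> v \<le> b \<and> t \<in> {u<..<v} \<and> v - u < d \<and> - p * (v - u) < - h v - - h u"
          by (intro exI[of _ u] exI[of _ v]) auto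
      qed
      then show False using that by (simp add: Ge_def)
    qed
    have cmp: "p \<le> q" if le: "Le q" and ge: "Ge p" for p q
    proof -
      obtain d1 where d1: "d1 > 0" "\<And>u v. a \<le> u \<and> v \<le> b \<and> t \<in> {u<..<v} \<and> v - u < d1 \<Longrightarrow> h v - h u \<le> q * (v - u)"
        using LeD[OF le] by blast
      obtain d2 where d2: "d2 > 0" "\<And>u v. a \<le> u \<and> v \<le> b \<and> t \<in> {u<..<v} \<and> v - u < d2 \<Longrightarrow> h v - h u \<ge> p * (v - u)"
        using GeD[OF ge] by blast
      define e where "e = min (min (t - a) (b - t)) (min d1 d2 / 3)"
      have e: "e > 0" "e \<le> t - a" "e \<le> b - t" "3 * e \<le> d1" "3 * e \<le> d2" using t d1(1) d2(1) by (auto simp: e_def min_def)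
      have "p * (2 * e) \<le> h (t + e) - h (t - e)" using d2(2)[of "t - e" "t + e"] e by simp
      also have "\<dots> \<le> q * (2 * e)" using d1(2)[of "t - e" "t + e"] e by simp
      finally show ?thesis by (rule mult_right_le_imp_le) (use e in simp)
    qed
    have dich: "Le q \<or> Ge p" if "p \<in> \<rat>" "q \<in> \<rat>" "p < q" for p q
      using t that unfolding N_def Le_def Ge_def by blast
    define S where "S = {q\<in>\<rat>. Le q}"
    obtain n1 :: nat where n1: "Le (real n1)" using t unfolding N_def Le_def by blast
    obtain n2 :: nat where n2: "Ge (- real n2)" using t unfolding N_def Ge_def by auto
    have "real n1 \<in> S" using n1 by (simp add: S_def)
    moreover have "- real n2 \<le> x" if "x \<in> S" for x using cmp[OF _ n2] that by (simp add: S_def)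
    ultimately have S: "S \<noteq> {}" "bdd_below S" by (auto intro: bdd_belowI[of S "- real n2"])
    define L where "L = Inf S"
    have main: "\<exists>d>0. \<forall>u v. a \<le> u \<and> v \<le> b \<and> t \<in> {u<..<v} \<and> v - u < d \<longrightarrow> \<bar>h v - h u - L * (v - u)\<bar> \<le> e * (v - u)" if e: "e > 0" for e
    proof -
      obtain q where q: "q \<in> S" "q < L + e" using cInf_lessD[of S "L + e"] S e unfolding L_def by auto
      \<comment> \<open>Two rationals below \<open>L\<close> are taken: \<open>p'\<close> is not an
        eventual upper bound, and then the alternative for the pair \<open>p < p'\<close> makes the
        smaller one an eventual lower bound.\<close>
      obtain p' where p': "p' \<in> \<rat>" "L - e < p'" "p' < L" using Rats_dense_in_real[of "L - e" L] e by auto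
      obtain p where p: "p \<in> \<rat>" "L - e < p" "p < p'" using Rats_dense_in_real[of "L - e" p'] p' by auto
      have "p' \<notin> S" using p'(3) cInf_lower[OF _ S(2), of p'] unfolding L_def by force
      then have "Ge p" using dich[OF p(1) p'(1) p(3)] p'(1) by (auto simp: S_def)
      obtain d1 where d1: "d1 > 0" "\<And>u v. a \<le> u \<and> v \<le> b \<and> t \<in> {u<..<v} \<and> v - u < d1 \<Longrightarrow> h v - h u \<le> q * (v - u)"
        using LeD[of q] q(1) by (auto simp: S_def)
      obtain d2 where d2: "d2 > 0" "\<And>u v. a \<le> u \<and> v \<le> b \<and> t \<in> {u<..<v} \<and> v - u < d2 \<Longrightarrow> h v - h u \<ge> p * (v - u)"
        using GeD[OF \<open>Ge p\<close>] by blast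
      show ?thesis
      proof (intro exI[of _ "min d1 d2"] conjI allI impI)
        fix u v assume uv: "a \<le> u \<and> v \<le> b \<and> t \<in> {u<..<v} \<and> v - u < min d1 d2"
        have "q * (v - u) \<le> (L + e) * (v - u)" "(L - e) * (v - u) \<le> p * (v - u)"
          using q p uv by (auto intro!: mult_right_mono)
        then show "\<bar>h v - h u - L * (v - u)\<bar> \<le> e * (v - u)"
          using d1(2)[of u v] d2(2)[of u v] uv by (auto simp: abs_le_iff algebra_simps)
      qed (use d1 d2 in auto)
    qed
    have cont: "isCont h t"
    proof -
      have "continuous_on {a..b} h"
        using continuous_on_Re[OF AC_continuous_on[OF AC]] by simp
      then show ?thesis using t by (auto intro!: continuous_on_interior[of "{a..b}"])
    qed
    have "(h has_derivative (\<lambda>x. L * x)) (at t)"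
      unfolding has_derivative_at_alt
    proof (intro conjI allI impI)
      fix e :: real assume e: "e > 0"
      obtain d where d: "d > 0" "\<And>u v. a \<le> u \<and> v \<le> b \<and> t \<in> {u<..<v} \<and> v - u < d \<Longrightarrow> \<bar>h v - h u - L * (v - u)\<bar> \<le> e * (v - u)"
        using main[OF e] by blast
      define d' where "d' = min (min (t - a) (b - t)) (d / 2)"
      have d': "d' > 0" "d' \<le> t - a" "d' \<le> b - t" "d' \<le> d / 2" using t d(1) by (auto simp: d'_def min_def)
      show "\<exists>d>0. \<forall>y. norm (y - t) < d \<longrightarrow> norm (h y - h t - L * (y - t)) \<le> e * norm (y - t)"
      proof (intro exI[of _ d'] conjI allI impI)
        fix y assume y: "norm (y - t) < d'"
        have htend: "(h \<longlongrightarrow> h t) (at_left t)" "(h \<longlongrightarrow> h t) (at_right t)"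
          using cont by (auto simp: isCont_def intro: filterlim_mono[OF _ order_refl at_le])
        consider "y = t" | "y > t" | "y < t" by linarith
        then show "norm (h y - h t - L * (y - t)) \<le> e * norm (y - t)"
        proof cases
          case 2
          have "eventually (\<lambda>u. \<bar>h y - h u - L * (y - u)\<bar> \<le> e * (y - u)) (at_left t)"
          proof (rule eventually_mono)
            show "eventually (\<lambda>x. x \<in> {t - d'<..<t}) (at_left t)" using eventually_at_left_real[of "t - d'" t] d'(1) by simp
            fix u assume "u \<in> {t - d'<..<t}"
            then show "\<bar>h y - h u - L * (y - u)\<bar> \<le> e * (y - u)" using d' y 2 by (intro d(2)) (auto)
          qed
          moreover have "((\<lambda>u. e * (y - u)) \<longlongrightarrow> e * (y - t)) (at_left t)" by (intro tendsto_intros)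
          moreover have "((\<lambda>u. \<bar>h y - h u - L * (y - u)\<bar>) \<longlongrightarrow> \<bar>h y - h t - L * (y - t)\<bar>) (at_left t)" by (intro tendsto_intros htend)
          ultimately have "\<bar>h y - h t - L * (y - t)\<bar> \<le> e * (y - t)" by (intro tendsto_le[of "at_left t"]) auto
          then show ?thesis using 2 by simp
        next
          case 3
          have "eventually (\<lambda>v. \<bar>h v - h y - L * (v - y)\<bar> \<le> e * (v - y)) (at_right t)"
          proof (rule eventually_mono)
            show "eventually (\<lambda>x. x \<in> {t<..<t + d'}) (at_right t)" using eventually_at_right_real[of t "t + d'"] d'(1) by simp
            fix v assume "v \<in> {t<..<t + d'}"
            then show "\<bar>h v - h y - L * (v - y)\<bar> \<le> e * (v - y)" using d' y 3 by (intro d(2)) (auto)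
          qed
          moreover have "((\<lambda>v. e * (v - y)) \<longlongrightarrow> e * (t - y)) (at_right t)" by (intro tendsto_intros)
          moreover have "((\<lambda>v. \<bar>h v - h y - L * (v - y)\<bar>) \<longlongrightarrow> \<bar>h t - h y - L * (t - y)\<bar>) (at_right t)" by (intro tendsto_intros htend)
          ultimately have "\<bar>h t - h y - L * (t - y)\<bar> \<le> e * (t - y)" by (intro tendsto_le[of "at_right t"]) auto
          moreover have "h y - h t - L * (y - t) = - (h t - h y - L * (t - y))" by (simp add: algebra_simps)
          ultimately show ?thesis using 3 by (simp only: real_norm_def abs_minus_cancel) (simp add: abs_if)
        qed simp
      qed (rule d'(1))
    qed (rule bounded_linear_mult_right)
    then show ?thesis by (auto simp: has_field_derivative_def)
  qed
  ultimately show ?thesis using that by blast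
qed

lemma AC_differentiable_ae:
  assumes AC: "abs_continuous_on_interval a b g"
  obtains N where "negligible N" "\<And>t. t \<in> {a<..<b} - N \<Longrightarrow> g differentiable (at t)"
proof -
  have re: "abs_continuous_on_interval a b (\<lambda>t. complex_of_real (Re (g t)))"
    by (rule AC_dominated[OF AC, of 1]) (auto simp: abs_Re_le_cmod simp flip: of_real_diff minus_complex.sel)
  have im: "abs_continuous_on_interval a b (\<lambda>t. complex_of_real (Im (g t)))"
    by (rule AC_dominated[OF AC, of 1]) (auto simp: abs_Im_le_cmod simp flip: of_real_diff minus_complex.sel)
  obtain N1 where N1: "negligible N1" "\<And>t. t \<in> {a<..<b} - N1 \<Longrightarrow> \<exists>L. ((\<lambda>t. Re (g t)) has_real_derivative L) (at t)"
    using AC_real_differentiable_ae[OF re] by blast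
  obtain N2 where N2: "negligible N2" "\<And>t. t \<in> {a<..<b} - N2 \<Longrightarrow> \<exists>L. ((\<lambda>t. Im (g t)) has_real_derivative L) (at t)"
    using AC_real_differentiable_ae[OF im] by blast
  show ?thesis
  proof (rule that[of "N1 \<union> N2"])
    fix t assume t: "t \<in> {a<..<b} - (N1 \<union> N2)"
    obtain L1 where L1: "((\<lambda>t. Re (g t)) has_real_derivative L1) (at t)" using N1(2) t by blast
    obtain L2 where L2: "((\<lambda>t. Im (g t)) has_real_derivative L2) (at t)" using N2(2) t by blast
    have "((\<lambda>t. complex_of_real (Re (g t)) + \<i> * complex_of_real (Im (g t))) has_vector_derivative (of_real L1 + \<i> * of_real L2)) (at t)"
      using L1 L2 by (intro derivative_intros) auto
    then have "(g has_vector_derivative (of_real L1 + \<i> * of_real L2)) (at t)"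
      by (simp flip: complex_eq)
    then show "g differentiable (at t)" by (rule differentiableI_vector)
  qed (use N1 N2 in auto)
qed

text \<open>A gauge replaces integration of the derivative. Near a point of differentiability it
  makes an increment at most \<open>M + \<epsilon>\<close> times the length; at the exceptional
  points it confines the intervals to an open set of measure below \<open>\<delta>\<close>, where
  absolute continuity bounds the increments.\<close>

lemma AC_norm_diff_le:
  fixes g :: "real \<Rightarrow> complex"
  assumes AC: "abs_continuous_on_interval a b g" and ab: "a \<le> b"
    and N0: "negligible N0" and M: "\<And>t. t \<in> {a<..<b} - N0 \<Longrightarrow> norm (vector_derivative g (at t)) \<le> M"
  shows "norm (g b - g a) \<le> M * (b - a)"
proof (rule field_le_epsilon)
  fix \<epsilon>0 :: real assume e0: "\<epsilon>0 > 0"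
  \<comment> \<open>The total error is \<open>\<epsilon> * (b - a)\<close> from the points of
    differentiability plus \<open>\<epsilon>\<close> from the exceptional tags.\<close>
  define \<epsilon> where "\<epsilon> = \<epsilon>0 / (b - a + 1)"
  have e: "\<epsilon> > 0" using e0 ab by (simp add: \<epsilon>_def)
  obtain N1 where N1: "negligible N1" "\<And>t. t \<in> {a<..<b} - N1 \<Longrightarrow> g differentiable (at t)"
    using AC_differentiable_ae[OF AC] by blast
  define N where "N = N0 \<union> N1 \<union> {a, b}"
  have N: "negligible N" using N0 N1 by (auto simp: N_def)
  have der: "(g has_vector_derivative vector_derivative g (at t)) (at t)" "norm (vector_derivative g (at t)) \<le> M"
    if "t \<in> {a..b} - N" for t
    using that M[of t] N1(2)[of t] by (auto simp: N_def vector_derivative_works)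
  obtain \<delta> where d: "\<delta> > 0" and AC0: "\<forall>\<D> T. \<D> division_of T \<and> T \<subseteq> {a..b} \<and>
      (\<Sum>K\<in>\<D>. Sup K - Inf K) < \<delta> \<longrightarrow> (\<Sum>K\<in>\<D>. norm (g (Sup K) - g (Inf K))) < \<epsilon>"
    using AC[unfolded abs_continuous_on_interval_def, THEN spec, THEN mp, OF e] by (elim exE conjE)
  have Ns: "N \<in> sets lebesgue" using N by (rule negligible_imp_sets)
  obtain O0 where O0: "open O0" "N \<subseteq> O0" "O0 - N \<in> lmeasurable" "emeasure lebesgue (O0 - N) < ennreal \<delta>"
    using sets_lebesgue_outer_open[OF Ns d] by metis
  have O0m: "O0 \<in> lmeasurable"
    using fmeasurable.Un[OF O0(3) negligible_imp_measurable[OF N]] O0(2) by (simp add: Un_absorb2)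
  have O0le: "measure lebesgue O0 < \<delta>"
  proof -
    have "measure lebesgue (O0 - N) < \<delta>"
      using O0(3,4) d by (simp add: emeasure_eq_measure2 ennreal_less_iff)
    then show ?thesis using measurable_measure_Diff[OF O0m Ns O0(2)] N by (simp add: negligible_imp_measure0)
  qed
  have "\<exists>r>0. \<forall>y. norm (y - t) < r \<longrightarrow> norm (g y - g t - (y - t) *\<^sub>R vector_derivative g (at t)) \<le> \<epsilon> * norm (y - t)"
    if "t \<in> {a..b} - N" for t
    using der(1)[OF that] e unfolding has_vector_derivative_def has_derivative_at_alt by blast
  then obtain r where r: "\<And>t. t \<in> {a..b} - N \<Longrightarrow> r t > 0"
     "\<And>t y. t \<in> {a..b} - N \<Longrightarrow> norm (y - t) < r t \<Longrightarrow> norm (g y - g t - (y - t) *\<^sub>R vector_derivative g (at t)) \<le> \<epsilon> * norm (y - t)"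
    by metis
  define \<gamma> where "\<gamma> t = (if t \<in> N then O0 else if t \<in> {a..b} then ball t (r t) else UNIV)" for t
  have "gauge \<gamma>" unfolding gauge_def \<gamma>_def using O0 r(1) by auto
  then obtain p where p: "p tagged_division_of {a..b}" "\<gamma> fine p"
    by (rule fine_division_exists_real)
  note pD = tagged_division_ofD[OF p(1)]
  have iv: "\<exists>u v. K = {u..v} \<and> u \<le> x \<and> x \<le> v \<and> a \<le> u \<and> v \<le> b" if xK: "(x, K) \<in> p" for x K
  proof -
    obtain u v where "K = cbox u v" using pD(4)[OF xK] by blast
    then show ?thesis using pD(2,3)[OF xK] by auto
  qed
  define p1 where "p1 = {z\<in>p. fst z \<in> N}"
  have fp: "finite p" "p1 \<subseteq> p" using pD(1) by (auto simp: p1_def)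
  have p1: "p1 tagged_division_of \<Union>(snd ` p1)"
    using tagged_partial_division_of_Union_self[OF tagged_partial_division_subset[OF _ fp(2)]] p(1)
    unfolding tagged_division_of_def by blast
  have part1: "(\<Sum>(x,K)\<in>p1. norm (g (Sup K) - g (Inf K))) < \<epsilon>"
  proof -
    \<comment> \<open>One interval may carry two tags only if it is degenerate. \<open>G\<close>
      vanishes on degenerate intervals and on the empty one, so the sum over tagged intervals equals
      the sum over the intervals.\<close>
    define G where "G K = (if K = {} then 0 else norm (g (Sup K) - g (Inf K)))" for K
    have zero: "G (cbox u v) = 0" if "box u v = {}" for u v :: real
      using that by (cases "u = v") (auto simp: G_def)
    have ne: "K \<noteq> {}" if "(x, K) \<in> p1" for x K using pD(2)[of x K] fp(2) that by auto
    have "(\<Sum>(x,K)\<in>p1. norm (g (Sup K) - g (Inf K))) = (\<Sum>(x,K)\<in>p1. G K)"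
      using ne by (intro sum.cong) (auto simp: G_def)
    also have "\<dots> = (\<Sum>K\<in>snd ` p1. G K)"
      by (rule sum.over_tagged_division_lemma[OF p1]) (rule zero)
    also have "\<dots> = (\<Sum>K\<in>snd ` p1. norm (g (Sup K) - g (Inf K)))"
      using ne by (intro sum.cong) (auto simp: G_def)
    also have "\<dots> < \<epsilon>"
    proof (rule AC0[rule_format], intro conjI)
      show dv: "snd ` p1 division_of \<Union>(snd ` p1)" by (rule division_of_tagged_division[OF p1])
      show "\<Union>(snd ` p1) \<subseteq> {a..b}" using pD(3) fp(2) by fastforce
      have "(\<Sum>K\<in>snd ` p1. Sup K - Inf K) = (\<Sum>K\<in>snd ` p1. measure lebesgue K)"
        using iv fp(2) by (intro sum.cong) fastforce+
      also have "\<dots> = measure lebesgue (\<Union>(snd ` p1))" by (rule content_division[OF dv])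
      also have "\<dots> \<le> measure lebesgue O0"
      proof (rule measure_mono_fmeasurable)
        have "K \<subseteq> O0" if "(x, K) \<in> p1" for x K
          using fineD[OF p(2), of x K] that by (auto simp: p1_def \<gamma>_def)
        then show "\<Union>(snd ` p1) \<subseteq> O0" by force
        show "\<Union>(snd ` p1) \<in> sets lebesgue" using lmeasurable_division[OF dv] by (rule fmeasurableD)
      qed (rule O0m)
      finally show "(\<Sum>K\<in>snd ` p1. Sup K - Inf K) < \<delta>" using O0le by simp
    qed
    finally show ?thesis .
  qed
  have part2: "norm (g (Sup K) - g (Inf K)) \<le> (M + \<epsilon>) * (Sup K - Inf K)" if xK: "(x, K) \<in> p - p1" for x K
  proof -
    obtain u v where uv: "K = {u..v}" "u \<le> x" "x \<le> v" "a \<le> u" "v \<le> b" using iv xK by blast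
    have x: "x \<in> {a..b} - N" using uv xK by (auto simp: p1_def)
    have "K \<subseteq> ball x (r x)" using fineD[OF p(2), of x K] xK x by (simp add: \<gamma>_def)
    moreover have "v \<in> K" "u \<in> K" using uv(1-3) by auto
    ultimately have "v \<in> ball x (r x)" "u \<in> ball x (r x)" by blast+
    then have near: "norm (v - x) < r x" "norm (u - x) < r x" by (auto simp: dist_real_def)
    let ?d = "vector_derivative g (at x)"
    have "g v - g u = (g v - g x - (v - x) *\<^sub>R ?d) - (g u - g x - (u - x) *\<^sub>R ?d) + (v - u) *\<^sub>R ?d"
      by (simp add: algebra_simps)
    also have "norm \<dots> \<le> norm (g v - g x - (v - x) *\<^sub>R ?d) + norm (g u - g x - (u - x) *\<^sub>R ?d) + norm ((v - u) *\<^sub>R ?d)"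
      by (meson norm_triangle_ineq norm_triangle_ineq4 add_mono order_refl order_trans)
    also have "\<dots> \<le> \<epsilon> * (v - x) + \<epsilon> * (x - u) + (v - u) * M"
      using r(2)[OF x near(1)] r(2)[OF x near(2)] der(2)[OF x] uv by (intro add_mono) (auto intro!: mult_left_mono)
    also have "\<dots> = (M + \<epsilon>) * (v - u)" by (simp add: algebra_simps)
    finally show ?thesis using uv by simp
  qed
  \<comment> \<open>A nondegenerate interval contains a point outside the null set, where
    \<open>M\<close> bounds a norm. The sign allows the sum over the good tags to be enlarged to the
    whole division.\<close>
  have Mnn: "0 \<le> M" if "a < b"
  proof -
    have "\<not> {a<..<b} \<subseteq> N" using negligible_subset[OF N] that open_not_negligible[of "{a<..<b}"] by auto
    then obtain t where "t \<in> {a<..<b} - N" by blast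
    then show ?thesis using der(2)[of t] norm_ge_zero order_trans by (metis DiffD1 DiffD2 DiffI greaterThanLessThan_subseteq_atLeastAtMost_iff order_refl subsetD)
  qed
  have "g b - g a = (\<Sum>(x,K)\<in>p. g (Sup K) - g (Inf K))"
    using additive_tagged_division_1[OF ab p(1), of g] by simp
  also have "norm \<dots> \<le> (\<Sum>(x,K)\<in>p. norm (g (Sup K) - g (Inf K)))"
    by (rule order_trans[OF norm_sum]) (simp add: case_prod_beta)
  also have "\<dots> = (\<Sum>(x,K)\<in>p - p1. norm (g (Sup K) - g (Inf K))) + (\<Sum>(x,K)\<in>p1. norm (g (Sup K) - g (Inf K)))"
    by (rule sum.subset_diff[OF fp(2,1)])
  also have "\<dots> \<le> (\<Sum>(x,K)\<in>p - p1. (M + \<epsilon>) * (Sup K - Inf K)) + \<epsilon>"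
    using part1 part2 by (intro add_mono sum_mono) (auto simp: case_prod_beta)
  also have "\<dots> \<le> (M + \<epsilon>) * (b - a) + \<epsilon>"
  proof (cases "a = b")
    case True
    then have "Sup K - Inf K = 0" if "(x, K) \<in> p" for x K using iv[OF that] by auto
    then have "(\<Sum>(x,K)\<in>p - p1. (M + \<epsilon>) * (Sup K - Inf K)) = 0" by (intro sum.neutral) auto
    then show ?thesis using True by simp
  next
    case False
    then have Mnn: "0 \<le> M + \<epsilon>" using Mnn ab e by auto
    have "(\<Sum>(x,K)\<in>p - p1. (M + \<epsilon>) * (Sup K - Inf K)) \<le> (\<Sum>(x,K)\<in>p. (M + \<epsilon>) * (Sup K - Inf K))"
      using Mnn iv fp by (intro sum_mono2) fastforce+
    also have "\<dots> = (M + \<epsilon>) * (\<Sum>(x,K)\<in>p. Sup K - Inf K)" by (simp add: sum_distrib_left case_prod_beta)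
    also have "(\<Sum>(x,K)\<in>p. Sup K - Inf K) = b - a"
      using additive_tagged_division_1[OF ab p(1), of "\<lambda>x. x"] by simp
    finally show ?thesis by simp
  qed
  also have "\<dots> = M * (b - a) + \<epsilon> * (b - a + 1)" by (simp add: algebra_simps)
  also have "\<epsilon> * (b - a + 1) = \<epsilon>0" using ab by (simp add: \<epsilon>_def)
  finally show "norm (g b - g a) \<le> M * (b - a) + \<epsilon>0" .
qed

section \<open>Mixed differences\<close>

definition upd :: "real ^ 'n \<Rightarrow> 'n \<Rightarrow> real \<Rightarrow> real ^ 'n" where
  "upd w j t = (\<chi> i. if i = j then t else w $ i)"

definition patch :: "'n set \<Rightarrow> ('n \<Rightarrow> real) \<Rightarrow> real ^ 'n \<Rightarrow> real ^ 'n" where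
  "patch S v w = (\<chi> i. if i \<in> S then v i else w $ i)"

lemma upd_nth [simp]: "upd w j t $ i = (if i = j then t else w $ i)"
  by (simp add: upd_def)

lemma patch_nth [simp]: "patch S v w $ i = (if i \<in> S then v i else w $ i)"
  by (simp add: patch_def)

lemma line_restr_eq: "line_restr j g x t = g (upd x j t)"
  by (simp add: line_restr_def upd_def)

lemma line_restr_upd: "line_restr j g (upd x j s) = line_restr j g x"
  by (auto simp: line_restr_eq fun_eq_iff vec_eq_iff intro!: arg_cong[of _ _ g])

lemma AC_sum:
  assumes "finite I" "\<And>i. i \<in> I \<Longrightarrow> abs_continuous_on_interval a b (f i)"
  shows "abs_continuous_on_interval a b (\<lambda>t. \<Sum>i\<in>I. f i t)"
  using assms
proof (induction I)
  case empty
  show ?case using AC_linear[of a b 0] by simp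
next
  case (insert x F)
  then show ?case using AC_add[of a b "f x" "\<lambda>t. \<Sum>i\<in>F. f i t"] by simp
qed

definition corner :: "('n \<Rightarrow> real \<times> real) \<Rightarrow> 'n set \<Rightarrow> 'n \<Rightarrow> real" where
  "corner p S i = (if i \<in> S then fst (p i) else snd (p i))"

definition mdiff :: "'n set \<Rightarrow> ('n \<Rightarrow> real \<times> real) \<Rightarrow> (real ^ 'n \<Rightarrow> complex) \<Rightarrow> real ^ 'n \<Rightarrow> complex" where
  "mdiff \<zeta> p f w = (\<Sum>S\<in>Pow \<zeta>. (-1) ^ card S * f (patch \<zeta> (corner p S) w))"

lemma mdiff_empty [simp]: "mdiff {} p f w = f w"
  by (auto simp: mdiff_def vec_eq_iff intro!: arg_cong[of _ _ f])

lemma mdiff_insert: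
  fixes \<zeta> :: "'n::finite set"
  assumes j: "j \<notin> \<zeta>"
  shows "mdiff (insert j \<zeta>) p f w = mdiff \<zeta> p f (upd w j (snd (p j))) - mdiff \<zeta> p f (upd w j (fst (p j)))"
proof -
  have "mdiff (insert j \<zeta>) p f w =
     (\<Sum>S\<in>Pow \<zeta>. (-1) ^ card S * f (patch (insert j \<zeta>) (corner p S) w)) +
     (\<Sum>S\<in>insert j ` Pow \<zeta>. (-1) ^ card S * f (patch (insert j \<zeta>) (corner p S) w))"
    unfolding mdiff_def Pow_insert using j by (intro sum.union_disjoint) auto
  also have "(\<Sum>S\<in>insert j ` Pow \<zeta>. (-1) ^ card S * f (patch (insert j \<zeta>) (corner p S) w)) =
     (\<Sum>S\<in>Pow \<zeta>. (-1) ^ card (insert j S) * f (patch (insert j \<zeta>) (corner p (insert j S)) w))"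
  proof (subst sum.reindex)
    show "inj_on (insert j) (Pow \<zeta>)" using j by (auto simp: inj_on_def)
  qed simp
  also have "\<dots> = - mdiff \<zeta> p f (upd w j (fst (p j)))"
    unfolding mdiff_def sum_negf[symmetric]
  proof (rule sum.cong[OF refl])
    fix S assume S: "S \<in> Pow \<zeta>"
    have "card (insert j S) = Suc (card S)" using S j by (intro card_insert_disjoint) auto
    moreover have "patch (insert j \<zeta>) (corner p (insert j S)) w = patch \<zeta> (corner p S) (upd w j (fst (p j)))"
      using j by (auto simp: vec_eq_iff corner_def)
    ultimately show "(-1) ^ card (insert j S) * f (patch (insert j \<zeta>) (corner p (insert j S)) w)
      = - ((-1) ^ card S * f (patch \<zeta> (corner p S) (upd w j (fst (p j)))))" by simp
  qed
  also have "(\<Sum>S\<in>Pow \<zeta>. (-1) ^ card S * f (patch (insert j \<zeta>) (corner p S) w)) = mdiff \<zeta> p f (upd w j (snd (p j)))"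
    unfolding mdiff_def
  proof (rule sum.cong[OF refl])
    fix S assume S: "S \<in> Pow \<zeta>"
    have "patch (insert j \<zeta>) (corner p S) w = patch \<zeta> (corner p S) (upd w j (snd (p j)))"
      using j S by (auto simp: vec_eq_iff corner_def)
    then show "(-1) ^ card S * f (patch (insert j \<zeta>) (corner p S) w)
      = ((-1) ^ card S * f (patch \<zeta> (corner p S) (upd w j (snd (p j)))))" by simp
  qed
  finally show ?thesis by simp
qed

lemma D_insert_less:
  fixes b :: "'n::{finite,linorder}"
  assumes "\<forall>j\<in>\<eta>. b < j"
  shows "D (insert b \<eta>) f = partial_deriv b (D \<eta> f)"
    and "sorted_list_of_set (insert b \<eta>) = b # sorted_list_of_set \<eta>"
proof -
  have b: "b \<notin> \<eta>" using assms by blast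
  have fin: "finite \<eta>" by simp
  show *: "sorted_list_of_set (insert b \<eta>) = b # sorted_list_of_set \<eta>"
    using assms b sorted_list_of_set_insert[OF fin, of b] insort_is_Cons[of "sorted_list_of_set \<eta>" "\<lambda>x. x" b]
    by (simp add: less_imp_le)
  show "D (insert b \<eta>) f = partial_deriv b (D \<eta> f)"
    unfolding D_def * by simp
qed

text \<open>Tonelli is applied to a measurable null set that covers the exceptions, since the
  exceptions themselves need not form a measurable set.\<close>

lemma AE_PiM_insert:
  fixes A :: "'n set"
  assumes fin: "finite A" and b: "b \<notin> A"
    and AE: "AE v in PiM (insert b A) (\<lambda>_. lborel). P v"
  shows "AE t in lborel. AE v in PiM A (\<lambda>_. lborel :: real measure). P (v(b := t))"
proof -
  interpret product_sigma_finite "\<lambda>_::'n. lborel :: real measure" ..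
  obtain N where N: "N \<in> null_sets (PiM (insert b A) (\<lambda>_. lborel))" "{v \<in> space (PiM (insert b A) (\<lambda>_. lborel)). \<not> P v} \<subseteq> N"
    using AE by (auto simp: eventually_ae_filter)
  have [measurable]: "N \<in> sets (PiM (insert b A) (\<lambda>_. lborel))" using N(1) by auto
  have "0 = (\<integral>\<^sup>+ v. indicator N v \<partial>PiM (insert b A) (\<lambda>_. lborel))"
    using N(1) by (simp add: null_setsD1)
  also have "\<dots> = (\<integral>\<^sup>+ t. (\<integral>\<^sup>+ v. indicator N (v(b := t)) \<partial>PiM A (\<lambda>_. lborel)) \<partial>lborel)"
    by (rule product_nn_integral_insert_rev[OF fin b]) measurable
  finally have "(\<integral>\<^sup>+ t. (\<integral>\<^sup>+ v. indicator N (v(b := t)) \<partial>PiM A (\<lambda>_. lborel)) \<partial>lborel) = 0" by simp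
  moreover have "(\<lambda>t. \<integral>\<^sup>+ v. indicator N (v(b := t)) \<partial>PiM A (\<lambda>_. lborel)) \<in> borel_measurable lborel"
  proof -
    interpret F: finite_product_sigma_finite "\<lambda>_. lborel :: real measure" A by standard (rule fin)
    have [measurable]: "(\<lambda>(t, v). v(b := t)) \<in> lborel \<Otimes>\<^sub>M PiM A (\<lambda>_. lborel) \<rightarrow>\<^sub>M PiM (insert b A) (\<lambda>_. lborel)"
      unfolding case_prod_beta by (rule measurable_fun_upd[where J=A]) auto
    have "(\<lambda>(t, v). indicator N (v(b := t)) :: ennreal) \<in> borel_measurable (lborel \<Otimes>\<^sub>M PiM A (\<lambda>_. lborel))"
      by measurable
    then show ?thesis by (rule F.borel_measurable_nn_integral)
  qed
  ultimately have "AE t in lborel. (\<integral>\<^sup>+ v. indicator N (v(b := t)) \<partial>PiM A (\<lambda>_. lborel)) = 0"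
    by (subst (asm) nn_integral_0_iff_AE) auto
  then show ?thesis
  proof (rule eventually_mono)
    fix t assume "(\<integral>\<^sup>+ v. indicator N (v(b := t)) \<partial>PiM A (\<lambda>_. lborel)) = 0"
    then have "AE v in PiM A (\<lambda>_. lborel). indicator N (v(b := t)) = (0::ennreal)"
      by (subst (asm) nn_integral_0_iff_AE) measurable
    then show "AE v in PiM A (\<lambda>_. lborel). P (v(b := t))"
    proof (rule AE_mp[OF _ AE_I2], intro impI)
      fix v assume v: "v \<in> space (PiM A (\<lambda>_. lborel :: real measure))" and "indicator N (v(b := t)) = (0::ennreal)"
      then have "v(b := t) \<notin> N" by (auto simp: indicator_def split: if_splits)
      moreover have "v(b := t) \<in> space (PiM (insert b A) (\<lambda>_. lborel))"
        using v by (auto simp: space_PiM PiE_def extensional_def)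
      ultimately show "P (v(b := t))" using N(2) by blast
    qed
  qed
qed

text \<open>One variable at a time, an increment becomes a derivative by the mean value inequality.
  As \<open>D\<close> differentiates in the largest index first, the variables are taken from the
  largest down, and \<open>\<eta>\<close> holds those already differentiated, all above
  \<open>\<zeta>\<close>. The bound on the full derivative holds almost everywhere and passes to
  almost every slice.\<close>

lemma mdiff_bound:
  fixes f :: "real ^ 'n::{finite,linorder} \<Rightarrow> complex"
  assumes dex: "\<And>\<eta>. \<eta> \<subset> UNIV \<Longrightarrow> D_exists \<eta> f off_hyperplanes"
    and lac: "\<And>\<eta>. \<eta> \<subset> UNIV \<Longrightarrow> lac_in_each_variable (D \<eta> f)"
    and p: "\<And>i. 0 < fst (p i) * snd (p i)"
    and fin: "finite \<zeta>"
  shows "\<forall>i\<in>\<zeta>. \<forall>j\<in>\<eta>. i < j \<Longrightarrow> w \<in> off_hyperplanes \<Longrightarrow>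
    AE v in PiM \<zeta> (\<lambda>_. lborel). (\<forall>i\<in>\<zeta>. v i \<in> closed_segment (fst (p i)) (snd (p i))) \<longrightarrow>
         norm (D (\<zeta> \<union> \<eta>) f (patch \<zeta> v w)) \<le> M \<Longrightarrow>
    norm (mdiff \<zeta> p (D \<eta> f) w) \<le> M * (\<Prod>i\<in>\<zeta>. \<bar>snd (p i) - fst (p i)\<bar>)"
  using fin
proof (induction \<zeta> arbitrary: \<eta> w rule: finite_linorder_max_induct)
  case empty
  have "norm (D \<eta> f (patch {} (\<lambda>_. undefined) w)) \<le> M"
    using empty.prems(3) unfolding PiM_empty AE_count_space by simp
  moreover have "patch {} v w = w" for v by (simp add: vec_eq_iff)
  ultimately show ?case by simp
next
  case (insert b A)
  have bA: "b \<notin> A" using insert.hyps by auto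
  have bn: "\<forall>j\<in>\<eta>. b < j" using insert.prems(1) by auto
  then have b\<eta>: "b \<notin> \<eta>" by auto
  have \<eta>U: "\<eta> \<subset> UNIV" using b\<eta> by auto
  define lo where "lo = min (fst (p b)) (snd (p b))"
  define hi where "hi = max (fst (p b)) (snd (p b))"
  have lohi: "lo \<le> hi" by (simp add: lo_def hi_def)
  have seg: "closed_segment (fst (p b)) (snd (p b)) = {lo..hi}"
    by (auto simp: closed_segment_eq_real_ivl lo_def hi_def)
  have nz: "t \<noteq> 0" if "t \<in> {lo..hi}" for t
    using p[of b] that by (auto simp: lo_def hi_def zero_less_mult_iff min_def max_def split: if_splits)
  have pnz: "fst (p i) \<noteq> 0" "snd (p i) \<noteq> 0" for i using p[of i] by auto
  define \<phi> where "\<phi> t = mdiff A p (D \<eta> f) (upd w b t)" for t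
  have off: "patch A (corner p S) (upd w b t) \<in> off_hyperplanes" if "t \<noteq> 0" for S t
    using insert.prems(2) pnz that by (auto simp: off_hyperplanes_def corner_def)
  have comm: "patch A v (upd w b t) = upd (patch A v w) b t" for v t
    using bA by (auto simp: vec_eq_iff)
  have off1: "patch A (corner p S) w \<in> off_hyperplanes" for S
    using insert.prems(2) pnz by (auto simp: off_hyperplanes_def corner_def)
  have \<phi>_eq: "\<phi> t = (\<Sum>S\<in>Pow A. (-1) ^ card S * line_restr b (D \<eta> f) (patch A (corner p S) w) t)" for t
    by (simp add: \<phi>_def mdiff_def line_restr_eq comm)
  have AC: "abs_continuous_on_interval lo hi \<phi>"
    unfolding \<phi>_eq
  proof (rule AC_sum)
    fix S assume "S \<in> Pow A"
    have "{lo..hi} \<subseteq> - {0}" using nz by auto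
    then have "abs_continuous_on_interval lo hi (line_restr b (D \<eta> f) (patch A (corner p S) w))"
      using lac[OF \<eta>U] off1[of S] lohi unfolding lac_in_each_variable_def locally_abs_continuous_on_def by blast
    then show "abs_continuous_on_interval lo hi (\<lambda>t. (-1) ^ card S * line_restr b (D \<eta> f) (patch A (corner p S) w) t)"
      by (rule AC_dominated[of _ _ _ 1]) (auto simp: norm_mult norm_power simp flip: right_diff_distrib)
  qed simp
  \<comment> \<open>For \<open>A = {}\<close> the set \<open>insert b \<eta>\<close> may be
    \<open>UNIV\<close>; there the equation is the definition of \<open>partial_deriv\<close>, and
    differentiability almost everywhere comes from absolute continuity. Otherwise
    \<open>insert b \<eta>\<close> misses a coordinate, its derivative exists everywhere off the
    hyperplanes, and the alternating sum is differentiated term by term.\<close>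
  have vd: "vector_derivative \<phi> (at t) = mdiff A p (D (insert b \<eta>) f) (upd w b t)" if t: "t \<in> {lo..hi}" for t
  proof (cases "A = {}")
    case True
    then have "\<phi> = line_restr b (D \<eta> f) w" by (auto simp: \<phi>_def line_restr_eq fun_eq_iff)
    then show ?thesis using True by (simp add: D_insert_less(1)[OF bn] partial_deriv_def line_restr_upd)
  next
    case False
    then obtain x where "x \<in> A" by blast
    then have "x \<notin> insert b \<eta>" using insert.prems(1) insert.hyps(2) by force
    then have ins: "insert b \<eta> \<subset> UNIV" by blast
    have dif: "(line_restr b (D \<eta> f) (patch A (corner p S) w) has_vector_derivative
      D (insert b \<eta>) f (patch A (corner p S) (upd w b t))) (at t)" for S
    proof -
      have "D_exists (insert b \<eta>) f off_hyperplanes" by (rule dex[OF ins])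
      then have "line_restr b (D \<eta> f) (patch A (corner p S) (upd w b t)) differentiable (at t)"
        using off[OF nz[OF t], of S] bA unfolding D_exists_def D_insert_less(2)[OF bn] D_def
        by (auto dest!: bspec[of _ _ "patch A (corner p S) (upd w b t)"])
      then show ?thesis
        unfolding D_insert_less(1)[OF bn] partial_deriv_def comm line_restr_upd
        by (simp add: vector_derivative_works)
    qed
    show ?thesis
      unfolding \<phi>_eq[abs_def] mdiff_def
      by (intro vector_derivative_at has_vector_derivative_sum has_vector_derivative_mult_right dif)
  qed
  have "AE t in lborel. AE v in PiM A (\<lambda>_. lborel). (\<forall>i\<in>insert b A. (v(b := t)) i \<in> closed_segment (fst (p i)) (snd (p i))) \<longrightarrow>
         norm (D (insert b A \<union> \<eta>) f (patch (insert b A) (v(b := t)) w)) \<le> M"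
    by (rule AE_PiM_insert[OF _ bA insert.prems(3)]) simp
  then have "AE t in lborel. t \<in> {lo..hi} \<longrightarrow> norm (vector_derivative \<phi> (at t)) \<le> M * (\<Prod>i\<in>A. \<bar>snd (p i) - fst (p i)\<bar>)"
  proof (rule eventually_mono, intro impI)
    fix t assume AEv: "AE v in PiM A (\<lambda>_. lborel). (\<forall>i\<in>insert b A. (v(b := t)) i \<in> closed_segment (fst (p i)) (snd (p i))) \<longrightarrow>
         norm (D (insert b A \<union> \<eta>) f (patch (insert b A) (v(b := t)) w)) \<le> M" and t: "t \<in> {lo..hi}"
    show "norm (vector_derivative \<phi> (at t)) \<le> M * (\<Prod>i\<in>A. \<bar>snd (p i) - fst (p i)\<bar>)"
      unfolding vd[OF t]
    proof (rule insert.IH)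
      show "\<forall>i\<in>A. \<forall>j\<in>insert b \<eta>. i < j" using insert.hyps insert.prems by auto
      show "upd w b t \<in> off_hyperplanes" using insert.prems(2) nz[OF t] by (auto simp: off_hyperplanes_def)
      show "AE v in PiM A (\<lambda>_. lborel). (\<forall>i\<in>A. v i \<in> closed_segment (fst (p i)) (snd (p i))) \<longrightarrow>
         norm (D (A \<union> insert b \<eta>) f (patch A v (upd w b t))) \<le> M"
        using AEv
      proof (rule eventually_mono, intro impI)
        fix v assume 1: "(\<forall>i\<in>insert b A. (v(b := t)) i \<in> closed_segment (fst (p i)) (snd (p i))) \<longrightarrow>
         norm (D (insert b A \<union> \<eta>) f (patch (insert b A) (v(b := t)) w)) \<le> M"
         and 2: "\<forall>i\<in>A. v i \<in> closed_segment (fst (p i)) (snd (p i))"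
        have "patch (insert b A) (v(b := t)) w = patch A v (upd w b t)" using bA by (auto simp: vec_eq_iff)
        moreover have "\<forall>i\<in>insert b A. (v(b := t)) i \<in> closed_segment (fst (p i)) (snd (p i))"
          using 2 bA t by (auto simp: seg)
        ultimately show "norm (D (A \<union> insert b \<eta>) f (patch A v (upd w b t))) \<le> M" using 1 by simp
      qed
    qed
  qed
  then obtain N where N: "N \<in> null_sets lborel"
     "{t. \<not> (t \<in> {lo..hi} \<longrightarrow> norm (vector_derivative \<phi> (at t)) \<le> M * (\<Prod>i\<in>A. \<bar>snd (p i) - fst (p i)\<bar>))} \<subseteq> N"
    by (auto simp: eventually_ae_filter)
  have "norm (\<phi> hi - \<phi> lo) \<le> (M * (\<Prod>i\<in>A. \<bar>snd (p i) - fst (p i)\<bar>)) * (hi - lo)"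
  proof (rule AC_norm_diff_le[OF AC lohi])
    show "negligible N" using N(1) by (simp add: negligible_iff_null_sets null_sets_completionI)
    fix t assume t: "t \<in> {lo<..<hi} - N"
    then have "t \<notin> {t. \<not> (t \<in> {lo..hi} \<longrightarrow> norm (vector_derivative \<phi> (at t)) \<le> M * (\<Prod>i\<in>A. \<bar>snd (p i) - fst (p i)\<bar>))}"
      by (intro contra_subsetD[OF N(2)]) simp
    moreover have "t \<in> {lo..hi}" using t by simp
    ultimately show "norm (vector_derivative \<phi> (at t)) \<le> M * (\<Prod>i\<in>A. \<bar>snd (p i) - fst (p i)\<bar>)" by blast
  qed
  also have "norm (\<phi> hi - \<phi> lo) = norm (\<phi> (snd (p b)) - \<phi> (fst (p b)))"
    by (auto simp: lo_def hi_def min_def max_def norm_minus_commute)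
  also have "hi - lo = \<bar>snd (p b) - fst (p b)\<bar>" by (auto simp: lo_def hi_def)
  finally show ?case
    using bA insert.hyps(1) by (simp add: mdiff_insert \<phi>_def mult_ac)
qed

text \<open>A coordinate whose increment is not exploited costs a factor 2 by the triangle
  inequality.\<close>

lemma mdiff_union_bound:
  fixes f :: "real ^ 'n::finite \<Rightarrow> complex" and A :: "'n set"
  assumes "finite A"
  shows "A \<inter> \<zeta> = {} \<Longrightarrow>
    (\<And>w'. (\<forall>i\<in>A. w' $ i \<in> {fst (p i), snd (p i)}) \<Longrightarrow> (\<forall>i. i \<notin> A \<longrightarrow> w' $ i = w $ i) \<Longrightarrow> norm (mdiff \<zeta> p f w') \<le> B) \<Longrightarrow>
    norm (mdiff (A \<union> \<zeta>) p f w) \<le> 2 ^ card A * B"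
  using assms
proof (induction A arbitrary: w)
  case empty
  then show ?case by simp
next
  case (insert b A)
  have b: "b \<notin> A \<union> \<zeta>" using insert by auto
  have "norm (mdiff (A \<union> \<zeta>) p f (upd w b t)) \<le> 2 ^ card A * B" if t: "t \<in> {fst (p b), snd (p b)}" for t
  proof (rule insert.IH)
    fix w' assume "\<forall>i\<in>A. w' $ i \<in> {fst (p i), snd (p i)}" "\<forall>i. i \<notin> A \<longrightarrow> w' $ i = upd w b t $ i"
    then show "norm (mdiff \<zeta> p f w') \<le> B" using t insert.hyps by (intro insert.prems(2)) auto
  qed (use insert.prems in auto)
  from this[of "fst (p b)"] this[of "snd (p b)"] show ?case
    using insert.hyps norm_triangle_ineq4[of "mdiff (A \<union> \<zeta>) p f (upd w b (snd (p b)))" "mdiff (A \<union> \<zeta>) p f (upd w b (fst (p b)))"]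
    by (simp add: mdiff_insert[OF b])
qed

lemma mdiff_UNIV_indep: "mdiff UNIV p f w = mdiff UNIV p f w'"
  by (auto simp: mdiff_def vec_eq_iff intro!: sum.cong arg_cong[of _ _ f])

lemma mdiff_degenerate:
  fixes f :: "real ^ 'n::finite \<Rightarrow> complex"
  assumes "j \<in> \<zeta>" "fst (p j) = snd (p j)"
  shows "mdiff \<zeta> p f w = 0"
  using mdiff_insert[of j "\<zeta> - {j}" p f w] assms by (simp add: insert_absorb)

text \<open>Increments in \<open>\<zeta>\<close> are traded for the derivative, so the segments
  there must not cross 0. In \<open>A\<close> only the two endpoint values enter, which may lie on
  opposite sides of 0.\<close>

lemma mdiff_le_majorant:
  fixes f :: "real ^ 'n::{finite,linorder} \<Rightarrow> complex"
  assumes dex: "\<And>\<eta>. \<eta> \<subset> UNIV \<Longrightarrow> D_exists \<eta> f off_hyperplanes"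
    and lac: "\<And>\<eta>. \<eta> \<subset> UNIV \<Longrightarrow> lac_in_each_variable (D \<eta> f)"
    and A\<zeta>: "A \<inter> \<zeta> = {}" "A \<union> \<zeta> = UNIV"
    and z: "\<And>i. 0 < z $ i" "\<And>i. z $ i \<le> \<bar>fst (p i)\<bar>" "\<And>i. z $ i \<le> \<bar>snd (p i)\<bar>"
    and p: "\<And>i. i \<in> \<zeta> \<Longrightarrow> 0 < fst (p i) * snd (p i)"
  shows "ennreal (norm (mdiff UNIV p f w)) \<le>
    2 ^ card A * ennreal (\<Prod>i\<in>\<zeta>. \<bar>snd (p i) - fst (p i)\<bar>) * majorant f A \<zeta> z"
proof (cases "\<exists>i\<in>\<zeta>. fst (p i) = snd (p i)")
  case True
  then show ?thesis using mdiff_degenerate by force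
next
  case False
  then have prod_pos: "(\<Prod>i\<in>\<zeta>. \<bar>snd (p i) - fst (p i)\<bar>) > 0" by (intro prod_pos) auto
  show ?thesis
  proof (cases "majorant f A \<zeta> z = top")
    case True
    \<comment> \<open>With an infinite majorant the right-hand side is \<open>top\<close> only if no
      length vanishes, because \<open>0 * top = 0\<close>; this is why degenerate pairs were split
      off.\<close>
    have "2 ^ card A * ennreal (\<Prod>i\<in>\<zeta>. \<bar>snd (p i) - fst (p i)\<bar>) \<noteq> 0"
      using prod_pos by (simp del: abs_prod prod_zero_iff)
    then show ?thesis by (simp only: True ennreal_mult_top) simp
  next
    case fin: False
    define M where "M = enn2real (majorant f A \<zeta> z)"
    have M: "majorant f A \<zeta> z = ennreal M" "M \<ge> 0" using fin by (auto simp: M_def less_top)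
    define R where "R = {v. \<forall>j\<in>\<zeta>. \<bar>v j\<bar> \<ge> \<bar>z $ j\<bar> \<and> \<bar>z $ j\<bar> > 0}"
    \<comment> \<open>\<open>mdiff_bound\<close> asks for endpoints of one sign in every coordinate.
      The pairs outside \<open>\<zeta>\<close> do not enter \<open>mdiff \<zeta>\<close> and may be
      replaced.\<close>
    define q where "q i = (if i \<in> \<zeta> then p i else (1, 1))" for i
    have mq: "mdiff \<zeta> q g w = mdiff \<zeta> p g w" for g w
      by (auto simp: mdiff_def corner_def q_def vec_eq_iff intro!: sum.cong arg_cong[of _ _ g])
    have bd: "norm (mdiff \<zeta> p f w') \<le> M * (\<Prod>i\<in>\<zeta>. \<bar>snd (p i) - fst (p i)\<bar>)"
      if w': "\<forall>i\<in>A. w' $ i \<in> {fst (p i), snd (p i)}" "\<forall>i. i \<notin> A \<longrightarrow> w' $ i = vec 1 $ i" for w'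
    proof -
      have wz: "\<forall>i\<in>A. \<bar>w' $ i\<bar> \<ge> \<bar>z $ i\<bar>"
      proof
        fix i assume "i \<in> A"
        then have "w' $ i = fst (p i) \<or> w' $ i = snd (p i)" using w'(1) by blast
        then show "\<bar>w' $ i\<bar> \<ge> \<bar>z $ i\<bar>" using z(1)[of i] z(2)[of i] z(3)[of i] by auto
      qed
      have off: "w' \<in> off_hyperplanes"
        unfolding off_hyperplanes_def
      proof (intro CollectI allI)
        fix j show "w' $ j \<noteq> 0" using wz z(1)[of j] w'(2) by (cases "j \<in> A") force+
      qed
      have "esssup (restrict_space (PiM \<zeta> (\<lambda>_. lborel)) R)
          (\<lambda>v. ennreal (norm (D \<zeta> f (\<chi> i. if i \<in> \<zeta> then v i else w' $ i)))) \<le> majorant f A \<zeta> z"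
        unfolding majorant_def R_def by (rule SUP_upper) (use wz in simp)
      then have "AE v in restrict_space (PiM \<zeta> (\<lambda>_. lborel)) R. ennreal (norm (D \<zeta> f (patch \<zeta> v w'))) \<le> ennreal M"
        using esssup_AE[where M="restrict_space (PiM \<zeta> (\<lambda>_. lborel)) R" and f="\<lambda>v. ennreal (norm (D \<zeta> f (patch \<zeta> v w')))"]
        unfolding patch_def M(1) by (auto elim!: eventually_mono intro: order_trans)
      then have AE: "AE v in PiM \<zeta> (\<lambda>_. lborel). v \<in> R \<longrightarrow> norm (D \<zeta> f (patch \<zeta> v w')) \<le> M"
      proof (subst (asm) AE_restrict_space_iff)
        have "R \<inter> space (PiM \<zeta> (\<lambda>_. lborel)) = {v \<in> space (PiM \<zeta> (\<lambda>_. lborel)). \<forall>j\<in>\<zeta>. \<bar>v j\<bar> \<ge> \<bar>z $ j\<bar> \<and> \<bar>z $ j\<bar> > 0}"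
          by (auto simp: R_def)
        also have "\<dots> \<in> sets (PiM \<zeta> (\<lambda>_. lborel))" by measurable
        finally show "R \<inter> space (PiM \<zeta> (\<lambda>_. lborel)) \<in> sets (PiM \<zeta> (\<lambda>_. lborel))" .
      qed (use M(2) in simp)
      have "norm (mdiff \<zeta> q (D {} f) w') \<le> M * (\<Prod>i\<in>\<zeta>. \<bar>snd (q i) - fst (q i)\<bar>)"
      proof (rule mdiff_bound[OF dex lac])
        show "AE v in PiM \<zeta> (\<lambda>_. lborel). (\<forall>i\<in>\<zeta>. v i \<in> closed_segment (fst (q i)) (snd (q i))) \<longrightarrow>
         norm (D (\<zeta> \<union> {}) f (patch \<zeta> v w')) \<le> M"
          using AE
        proof (rule eventually_mono, intro impI)
          fix v assume 1: "v \<in> R \<longrightarrow> norm (D \<zeta> f (patch \<zeta> v w')) \<le> M" and 2: "\<forall>i\<in>\<zeta>. v i \<in> closed_segment (fst (q i)) (snd (q i))"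
          have "v \<in> R" unfolding R_def
          proof (intro CollectI ballI conjI)
            fix j assume j: "j \<in> \<zeta>"
            show "\<bar>z $ j\<bar> > 0" using z(1)[of j] by simp
            have "v j \<in> closed_segment (fst (p j)) (snd (p j))" using 2 j by (simp add: q_def)
            then show "\<bar>v j\<bar> \<ge> \<bar>z $ j\<bar>"
              using p[OF j] z(1-3)[of j] by (auto simp: closed_segment_eq_real_ivl zero_less_mult_iff split: if_splits)
          qed
          then show "norm (D (\<zeta> \<union> {}) f (patch \<zeta> v w')) \<le> M" using 1 by simp
        qed
        show "0 < fst (q i) * snd (q i)" for i using p by (simp add: q_def)
      qed (use off in auto)
      then show ?thesis by (simp add: mq D_def) (simp add: q_def)
    qed
    have "norm (mdiff UNIV p f w) = norm (mdiff (A \<union> \<zeta>) p f (vec 1))"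
      unfolding A\<zeta>(2) by (simp add: mdiff_UNIV_indep[of p f w "vec 1"])
    also have "\<dots> \<le> 2 ^ card A * (M * (\<Prod>i\<in>\<zeta>. \<bar>snd (p i) - fst (p i)\<bar>))"
      by (rule mdiff_union_bound[OF _ A\<zeta>(1) bd]) auto
    finally have le: "norm (mdiff UNIV p f w) \<le> 2 ^ card A * (M * (\<Prod>i\<in>\<zeta>. \<bar>snd (p i) - fst (p i)\<bar>))" .
    define P where "P = (\<Prod>i\<in>\<zeta>. \<bar>snd (p i) - fst (p i)\<bar>)"
    have P: "P \<ge> 0" using prod_pos by (simp add: P_def)
    have "ennreal (norm (mdiff UNIV p f w)) \<le> ennreal (2 ^ card A * (M * P))"
      using le unfolding P_def by (rule ennreal_leI)
    also have "\<dots> = ennreal 2 ^ card A * (ennreal M * ennreal P)"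
      using M(2) P by (simp add: ennreal_mult ennreal_power del: ennreal_numeral)
    finally show ?thesis unfolding M(1) P_def by (simp add: mult_ac)
  qed
qed

section \<open>Fejer kernels and series of hat functions\<close>

definition fejer :: "real \<Rightarrow> real \<Rightarrow> real" where
  "fejer a x = (1 - cos (a * x)) / x\<^sup>2"

lemma fejer_nonneg: "0 \<le> fejer a x"
  by (simp add: fejer_def)

lemma fejer_measurable [measurable]: "fejer a \<in> borel_measurable borel"
  unfolding fejer_def[abs_def] by measurable

lemma fejer_one_le: "fejer 1 x \<le> 4 * inverse (1 + x\<^sup>2)"
proof (cases "\<bar>x\<bar> \<le> 1")
  case True
  have "1 - cos x = 2 * (sin (x / 2))\<^sup>2" using cos_double_sin[of "x / 2"] by simp
  also have "(sin (x / 2))\<^sup>2 \<le> (x / 2)\<^sup>2"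
    using abs_sin_x_le_abs_x[of "x/2"] by (simp add: abs_le_square_iff[symmetric])
  finally have "1 - cos x \<le> x\<^sup>2 / 2" by (simp add: power2_eq_square)
  then have "fejer 1 x \<le> 1 / 2"
    by (cases "x = 0") (auto simp: fejer_def divide_le_eq)
  also have "\<dots> \<le> 4 * inverse (1 + x\<^sup>2)"
  proof -
    have "x\<^sup>2 \<le> 1" using True by (simp add: abs_square_le_1)
    moreover have "0 < 1 + x\<^sup>2" by (simp add: add_pos_nonneg)
    ultimately show ?thesis by (simp add: field_simps)
  qed
  finally show ?thesis .
next
  case False
  then have x: "x\<^sup>2 > 1" by (metis linorder_not_less abs_square_le_1)
  have "2 / X \<le> 4 * inverse (1 + X)" if "X > 1" for X :: real
    using that by (simp add: field_simps)
  from this[OF x] have le: "2 / x\<^sup>2 \<le> 4 * inverse (1 + x\<^sup>2)" .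
  have "fejer 1 x \<le> 2 / x\<^sup>2" unfolding fejer_def by (intro divide_right_mono) auto
  then show ?thesis using le by (rule order_trans)
qed

lemma fejer_one_integrable: "integrable lborel (fejer 1)"
proof (rule Bochner_Integration.integrable_bound)
  have "set_integrable lborel (einterval (-\<infinity>) \<infinity>) (\<lambda>x. inverse (1 + x\<^sup>2))"
    by (rule integrable_inverse_1_plus_square)
  then show "integrable lborel (\<lambda>x::real. 4 * inverse (1 + x\<^sup>2))"
    by (simp add: set_integrable_def)
qed (use fejer_one_le fejer_nonneg in \<open>auto intro!: AE_I2\<close>)

definition fejer_const :: real where "fejer_const = (\<integral>x. fejer 1 x \<partial>lborel)"

lemma fejer_const_pos: "fejer_const > 0"
proof -
  have "fejer_const \<noteq> 0"
  proof
    assume "fejer_const = 0"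
    then have "AE x in lborel. fejer 1 x = 0"
      unfolding fejer_const_def
      by (subst (asm) integral_nonneg_eq_0_iff_AE[OF fejer_one_integrable]) (auto simp: fejer_nonneg)
    moreover have "fejer 1 x \<noteq> 0" if "x \<in> {0<..<1}" for x
    proof -
      have "cos x < cos 0" using that pi_gt3 by (intro cos_monotone_0_pi) auto
      then show ?thesis using that by (simp add: fejer_def)
    qed
    ultimately have "AE x in lborel. x \<notin> {0<..<1::real}" by (auto elim!: eventually_mono)
    then have "{0<..<1::real} \<in> null_sets lborel" by (subst (asm) AE_iff_null_sets[symmetric]) auto
    then have "emeasure lborel {0<..<1::real} = 0" by (rule null_setsD1)
    then show False by simp
  qed
  moreover have "fejer_const \<ge> 0" unfolding fejer_const_def by (intro integral_nonneg_AE) (auto simp: fejer_nonneg)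
  ultimately show ?thesis by simp
qed

text \<open>Scaling: \<open>fejer a x = a\<^sup>2 * fejer 1 (a * x)\<close>. The constant, which is
  \<pi>, is divided out again in \<open>kernel1\<close>.\<close>

lemma fejer_integral: "has_bochner_integral lborel (fejer a) (fejer_const * \<bar>a\<bar>)"
proof (cases "a = 0")
  case True
  then have "fejer a = (\<lambda>x. 0)" by (simp add: fejer_def fun_eq_iff)
  then show ?thesis using True by (simp add: has_bochner_integral_zero)
next
  case False
  have "has_bochner_integral lborel (fejer 1) fejer_const"
    unfolding fejer_const_def using fejer_one_integrable by (rule has_bochner_integral_integrable)
  then have "has_bochner_integral lborel (\<lambda>x. fejer 1 (0 + a * x)) (fejer_const /\<^sub>R \<bar>a\<bar>)"
    using False by (subst (asm) lborel_has_bochner_integral_real_affine_iff[of a _ _ 0]) auto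
  then have "has_bochner_integral lborel (\<lambda>x. fejer 1 (0 + a * x) * a\<^sup>2) (fejer_const /\<^sub>R \<bar>a\<bar> * a\<^sup>2)"
    by (rule has_bochner_integral_mult_left)
  note 1 = this
  have 2: "(\<lambda>x. fejer 1 (0 + a * x) * a\<^sup>2) = fejer a"
    using False by (simp add: fejer_def fun_eq_iff power_mult_distrib)
  have 3: "fejer_const /\<^sub>R \<bar>a\<bar> * a\<^sup>2 = fejer_const * \<bar>a\<bar>"
    using False by (auto simp: field_simps power2_eq_square abs_if)
  show ?thesis using 1 unfolding 2 3 .
qed

definition hat :: "real \<Rightarrow> real" where "hat y = max 0 (1 - \<bar>y\<bar>)"

definition kernel1 :: "real \<Rightarrow> real \<Rightarrow> real" where
  "kernel1 h x = fejer h x / (fejer_const * h)"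

lemma kernel1_nonneg: "h > 0 \<Longrightarrow> 0 \<le> kernel1 h x"
  using fejer_const_pos by (simp add: kernel1_def fejer_nonneg)

text \<open>The product formula for cosines writes the integrand through
  \<open>fejer (h + y)\<close>, \<open>fejer (h - y)\<close> and \<open>fejer y\<close>; the same
  combination of \<open>\<bar>h + y\<bar>\<close>, \<open>\<bar>h - y\<bar>\<close> and
  \<open>\<bar>y\<bar>\<close> is the hat.\<close>

lemma kernel1_cos_integral:
  assumes h: "h > 0"
  shows "has_bochner_integral lborel (\<lambda>x. kernel1 h x * cos (x * y)) (hat (y / h))"
proof -
  have eq: "kernel1 h x * cos (x * y) = (fejer (h + y) x / 2 + fejer (h - y) x / 2 - fejer y x) / (fejer_const * h)" for x
  proof -
    have "cos (h * x) * cos (x * y) = (cos ((h - y) * x) + cos ((h + y) * x)) / 2"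
      using cos_times_cos[of "h * x" "x * y"] by (simp add: algebra_simps)
    then have "(1 - cos (h * x)) * cos (x * y) = cos (x * y) - (cos ((h - y) * x) + cos ((h + y) * x)) / 2"
      unfolding left_diff_distrib by simp
    also have "\<dots> = (1 - cos ((h + y) * x)) / 2 + (1 - cos ((h - y) * x)) / 2 - (1 - cos (y * x))"
      by (simp add: field_simps)
    finally have "(1 - cos (h * x)) * cos (x * y) / x\<^sup>2 = ((1 - cos ((h + y) * x)) / 2 + (1 - cos ((h - y) * x)) / 2 - (1 - cos (y * x))) / x\<^sup>2"
      by (rule arg_cong)
    also have "\<dots> = fejer (h + y) x / 2 + fejer (h - y) x / 2 - fejer y x"
      unfolding fejer_def by (simp only: add_divide_distrib diff_divide_distrib divide_divide_eq_left mult.commute[of 2])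
    finally have E: "fejer h x * cos (x * y) = fejer (h + y) x / 2 + fejer (h - y) x / 2 - fejer y x"
      by (simp add: fejer_def)
    have "kernel1 h x * cos (x * y) = (fejer h x * cos (x * y)) / (fejer_const * h)" by (simp add: kernel1_def)
    then show ?thesis unfolding E .
  qed
  have "has_bochner_integral lborel (\<lambda>x. (fejer (h + y) x / 2 + fejer (h - y) x / 2 - fejer y x) / (fejer_const * h))
     ((fejer_const * \<bar>h + y\<bar> / 2 + fejer_const * \<bar>h - y\<bar> / 2 - fejer_const * \<bar>y\<bar>) / (fejer_const * h))"
    by (intro has_bochner_integral_divide has_bochner_integral_diff has_bochner_integral_add fejer_integral)
  moreover have "(fejer_const * \<bar>h + y\<bar> / 2 + fejer_const * \<bar>h - y\<bar> / 2 - fejer_const * \<bar>y\<bar>) / (fejer_const * h) = hat (y / h)"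
  proof -
    have "(fejer_const * \<bar>h + y\<bar> / 2 + fejer_const * \<bar>h - y\<bar> / 2 - fejer_const * \<bar>y\<bar>) / (fejer_const * h)
       = (\<bar>h + y\<bar> / 2 + \<bar>h - y\<bar> / 2 - \<bar>y\<bar>) / h"
      using fejer_const_pos h by (simp add: field_simps)
    also have "\<dots> = hat (y / h)" using h by (auto simp: hat_def abs_if max_def field_simps)
    finally show ?thesis .
  qed
  ultimately show ?thesis by (simp add: eq)
qed

lemma hat_0 [simp]: "hat 0 = 1"
  by (auto simp: hat_def)

text \<open>This is the orthonormality of the exponentials at points with spacing
  \<open>2 * h\<close> under the Fejer density.\<close>

lemma hat_int: "hat (2 * real_of_int m) = (if m = 0 then 1 else 0)"
  by (auto simp: hat_def)

lemma kernel1_integral: "h > 0 \<Longrightarrow> has_bochner_integral lborel (kernel1 h) 1"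
  using kernel1_cos_integral[of h 0] by simp

lemma kernel1_measurable [measurable]: "kernel1 h \<in> borel_measurable borel"
  unfolding kernel1_def[abs_def] by measurable

lemma kernel1_exp_integral:
  assumes h: "h > 0"
  shows "has_bochner_integral lborel (\<lambda>x. complex_of_real (kernel1 h x) * exp (\<i> * complex_of_real (x * y))) (of_real (hat (y / h)))"
proof -
  have int: "integrable lborel (kernel1 h)" using kernel1_integral[OF h] by (simp add: has_bochner_integral_iff)
  have ints: "integrable lborel (\<lambda>x. kernel1 h x * sin (x * y))"
    by (rule Bochner_Integration.integrable_bound[OF int]) (auto simp: abs_mult intro!: AE_I2 mult_left_le)
  have "(\<integral>x. kernel1 h x * sin (x * y) \<partial>lborel) = (\<integral>x. kernel1 h (0 + (-1) * x) * sin ((0 + (-1) * x) * y) \<partial>lborel)"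
    by (subst lborel_integral_real_affine[of "-1" _ 0]) auto
  also have "\<dots> = (\<integral>x. - (kernel1 h x * sin (x * y)) \<partial>lborel)"
    by (simp add: kernel1_def fejer_def)
  finally have "(\<integral>x. kernel1 h x * sin (x * y) \<partial>lborel) = 0" by simp
  then have s: "has_bochner_integral lborel (\<lambda>x. kernel1 h x * sin (x * y)) 0"
    using ints by (simp add: has_bochner_integral_iff)
  have "has_bochner_integral lborel (\<lambda>x. complex_of_real (kernel1 h x * cos (x * y)) + \<i> * complex_of_real (kernel1 h x * sin (x * y)))
     (of_real (hat (y / h)) + \<i> * of_real 0)"
    by (intro has_bochner_integral_add has_bochner_integral_mult_right has_bochner_integral_of_real kernel1_cos_integral h s)
  moreover have "complex_of_real (kernel1 h x * cos (x * y)) + \<i> * complex_of_real (kernel1 h x * sin (x * y))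
     = complex_of_real (kernel1 h x) * exp (\<i> * complex_of_real (x * y))" for x
    unfolding exp_Euler cos_of_real sin_of_real by (simp add: algebra_simps)
  ultimately show ?thesis by simp
qed

section \<open>The product Fejer density in several variables\<close>

lemma lborel_vec_eq: "(lborel :: (real ^ 'n) measure) = distr (PiM UNIV (\<lambda>_. lborel)) borel (\<lambda>f. \<chi> i. f i)"
proof (rule lborel_eqI)
  interpret product_sigma_finite "\<lambda>_::'n. lborel :: real measure" ..
  fix l u :: "real ^ 'n"
  assume le: "\<And>b. b \<in> Basis \<Longrightarrow> l \<bullet> b \<le> u \<bullet> b"
  have le': "l $ i \<le> u $ i" for i using le[of "axis i 1"] by (simp add: inner_axis)
  have m: "(\<lambda>f. \<chi> i. f i) \<in> PiM UNIV (\<lambda>_. lborel :: real measure) \<rightarrow>\<^sub>M (borel :: (real ^ 'n) measure)"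
  proof (rule borel_measurable_euclidean_space[THEN iffD2], intro ballI)
    fix b :: "real ^ 'n" assume "b \<in> Basis"
    then obtain i where "b = axis i 1" by (auto simp: Basis_vec_def)
    then show "(\<lambda>f. (\<chi> i. f i) \<bullet> b) \<in> borel_measurable (PiM UNIV (\<lambda>_. lborel :: real measure))"
      by (simp add: inner_axis)
  qed
  have "emeasure (distr (PiM UNIV (\<lambda>_. lborel)) borel (\<lambda>f. \<chi> i. f i)) (box l u) =
     emeasure (PiM UNIV (\<lambda>_. lborel)) (PiE UNIV (\<lambda>i. {l $ i<..<u $ i}))"
    using m by (subst emeasure_distr) (auto simp: space_PiM mem_box_cart PiE_iff intro!: arg_cong[where f="emeasure _"])
  also have "\<dots> = (\<Prod>i\<in>UNIV. emeasure lborel {l $ i<..<u $ i})"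
    by (rule emeasure_PiM) auto
  also have "\<dots> = (\<Prod>i\<in>UNIV. ennreal (u $ i - l $ i))" using le' by simp
  also have "\<dots> = ennreal (\<Prod>i\<in>UNIV. u $ i - l $ i)" using le' by (intro prod_ennreal) auto
  also have "(\<Prod>i\<in>UNIV. u $ i - l $ i) = (\<Prod>b\<in>Basis. (u - l) \<bullet> b)"
  proof -
    have "(Basis :: (real ^ 'n) set) = (\<lambda>i. axis i 1) ` UNIV" by (auto simp: Basis_vec_def)
    then show ?thesis by (subst \<open>Basis = _\<close>, subst prod.reindex) (auto simp: inj_on_def axis_eq_axis inner_axis)
  qed
  finally show "emeasure (distr (PiM UNIV (\<lambda>_. lborel)) borel (\<lambda>f. \<chi> i. f i)) (box l u) = ennreal (\<Prod>b\<in>Basis. (u - l) \<bullet> b)" .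
qed simp

definition kernel :: "('n \<Rightarrow> real) \<Rightarrow> real ^ 'n \<Rightarrow> real" where
  "kernel h x = (\<Prod>j\<in>UNIV. kernel1 (h j) (x $ j))"

lemma kernel_nonneg: "(\<And>j. h j > 0) \<Longrightarrow> 0 \<le> kernel h x"
  unfolding kernel_def by (intro prod_nonneg) (auto intro: kernel1_nonneg)

lemma vec_nth_measurable [measurable]: "(\<lambda>x :: real ^ 'n. x $ i) \<in> borel_measurable borel"
  by simp

lemma kernel_measurable [measurable]: "kernel h \<in> borel_measurable borel"
  unfolding kernel_def[abs_def] by measurable

lemma kernel_exp_integral:
  fixes h :: "'n::finite \<Rightarrow> real"
  assumes h: "\<And>j. h j > 0"
  shows "has_bochner_integral lborel (\<lambda>x. complex_of_real (kernel h x) * exp (\<i> * complex_of_real (x \<bullet> y)))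
     (of_real (\<Prod>j\<in>UNIV. hat (y $ j / h j)))"
proof -
  interpret product_sigma_finite "\<lambda>_::'n. lborel :: real measure" ..
  define F where "F j x = complex_of_real (kernel1 (h j) x) * exp (\<i> * complex_of_real (x * (y $ j)))" for j x
  have F: "has_bochner_integral lborel (F j) (of_real (hat (y $ j / h j)))" for j
    unfolding F_def[abs_def] by (rule kernel1_exp_integral[OF h])
  have eq: "complex_of_real (kernel h x) * exp (\<i> * complex_of_real (x \<bullet> y)) = (\<Prod>j\<in>UNIV. F j (x $ j))" for x
    by (simp add: F_def kernel_def inner_vec_def prod.distrib exp_sum sum_distrib_left)
  have m: "(\<lambda>f. \<chi> i. f i) \<in> PiM UNIV (\<lambda>_. lborel :: real measure) \<rightarrow>\<^sub>M (borel :: (real ^ 'n) measure)"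
  proof (rule borel_measurable_euclidean_space[THEN iffD2], intro ballI)
    fix b :: "real ^ 'n" assume "b \<in> Basis"
    then obtain i where "b = axis i 1" by (auto simp: Basis_vec_def)
    then show "(\<lambda>f. (\<chi> i. f i) \<bullet> b) \<in> borel_measurable (PiM UNIV (\<lambda>_. lborel :: real measure))"
      by (simp add: inner_axis)
  qed
  have "has_bochner_integral (PiM UNIV (\<lambda>_. lborel)) (\<lambda>x. \<Prod>j\<in>UNIV. F j (x j)) (\<Prod>j\<in>UNIV. of_real (hat (y $ j / h j)))"
    using F product_integrable_prod[of UNIV F] product_integral_prod[of UNIV F]
    by (simp add: has_bochner_integral_iff)
  then show ?thesis
    unfolding eq lborel_vec_eq
    by (intro has_bochner_integral_distr[OF _ m]) (auto simp: F_def)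
qed

section \<open>Bounds for the norm of A\<close>

definition A_bdd :: "real \<Rightarrow> (real ^ 'n::finite \<Rightarrow> complex) \<Rightarrow> bool" where
  "A_bdd C f \<longleftrightarrow> (\<exists>g. integrable lborel g \<and> (\<integral>x. norm (g x) \<partial>lborel) \<le> C \<and>
     (\<forall>y. f y = (\<integral>x. g x * exp (\<i> * complex_of_real (x \<bullet> y)) \<partial>lborel)))"

lemma A_bdd_imp_A_space: "A_bdd C f \<Longrightarrow> f \<in> A_space"
  by (auto simp: A_bdd_def A_space_def)

text \<open>Completeness of A: the densities form an absolutely convergent series in L1, and
  dominated convergence identifies the transform of its sum with the prescribed pointwise sum
  \<open>f\<close>.\<close>

lemma A_bdd_suminf:
  fixes F :: "nat \<Rightarrow> real ^ 'n::finite \<Rightarrow> complex"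
  assumes F: "\<And>i. A_bdd (C i) (F i)" and C: "summable C" and f: "\<And>y. (\<lambda>i. F i y) sums f y"
  shows "A_bdd (suminf C) f"
proof -
  obtain g where g: "\<And>i. integrable lborel (g i)" "\<And>i. (\<integral>x. norm (g i x) \<partial>lborel) \<le> C i"
    "\<And>i y. F i y = (\<integral>x. g i x * exp (\<i> * complex_of_real (x \<bullet> y)) \<partial>lborel)"
  proof -
    define G where "G i = (SOME g. integrable lborel g \<and> (\<integral>x. norm (g x) \<partial>lborel) \<le> C i \<and>
     (\<forall>y. F i y = (\<integral>x. g x * exp (\<i> * complex_of_real (x \<bullet> y)) \<partial>lborel)))" for i
    have "integrable lborel (G i) \<and> (\<integral>x. norm (G i x) \<partial>lborel) \<le> C i \<and>
     (\<forall>y. F i y = (\<integral>x. G i x * exp (\<i> * complex_of_real (x \<bullet> y)) \<partial>lborel))" for i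
      using someI_ex[OF F[of i, unfolded A_bdd_def]] unfolding G_def .
    then show ?thesis using that[of G] by blast
  qed
  have [measurable]: "g i \<in> borel_measurable lborel" for i using g(1) by auto
  have nrm: "summable (\<lambda>i. \<integral>x. norm (g i x) \<partial>lborel)"
    by (rule summable_comparison_test'[OF C, of 0]) (use g(2) in auto)
  have ae: "AE x in lborel. summable (\<lambda>i. norm (g i x))"
  proof -
    have "(\<integral>\<^sup>+x. (\<Sum>i. ennreal (norm (g i x))) \<partial>lborel) = (\<Sum>i. \<integral>\<^sup>+x. ennreal (norm (g i x)) \<partial>lborel)"
      by (rule nn_integral_suminf) measurable
    also have "\<dots> = (\<Sum>i. ennreal (\<integral>x. norm (g i x) \<partial>lborel))"
      using g(1) by (intro suminf_cong nn_integral_eq_integral) auto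
    also have "\<dots> \<noteq> \<infinity>" using nrm by (subst suminf_ennreal2) auto
    finally have "AE x in lborel. (\<Sum>i. ennreal (norm (g i x))) \<noteq> \<infinity>"
      by (intro nn_integral_noteq_infinite) auto
    then show ?thesis by (rule eventually_mono) (auto intro!: summable_suminf_not_top)
  qed
  have int: "integrable lborel (\<lambda>x. \<Sum>i. g i x)"
    using g(1) ae nrm by (rule integrable_suminf)
  have "A_bdd (suminf C) f"
    unfolding A_bdd_def
  proof (intro exI conjI allI)
    show "integrable lborel (\<lambda>x. \<Sum>i. g i x)" by (rule int)
    have intn: "integrable lborel (\<lambda>x. \<Sum>i. norm (g i x))"
      using g(1) ae nrm by (intro integrable_suminf) auto
    have "(\<integral>x. norm (\<Sum>i. g i x) \<partial>lborel) \<le> (\<integral>x. (\<Sum>i. norm (g i x)) \<partial>lborel)"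
      using ae by (intro integral_mono_AE integrable_norm int intn) (auto elim!: eventually_mono intro: summable_norm)
    also have "\<dots> = (\<Sum>i. \<integral>x. norm (g i x) \<partial>lborel)"
      using g(1) ae nrm by (intro integral_suminf) auto
    also have "\<dots> \<le> suminf C" using g(2) nrm C by (rule suminf_le)
    finally show "(\<integral>x. norm (\<Sum>i. g i x) \<partial>lborel) \<le> suminf C" .
    fix y
    define e where "e x = exp (\<i> * complex_of_real (x \<bullet> y))" for x :: "real ^ 'n"
    have [measurable]: "e \<in> borel_measurable borel" unfolding e_def[abs_def] by measurable
    have ne: "norm (e x) = 1" for x by (simp add: e_def)
    have inte: "integrable lborel (\<lambda>x. g i x * e x)" for i
      by (rule Bochner_Integration.integrable_bound[OF g(1)[of i]]) (auto simp: norm_mult ne)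
    have "(\<lambda>i. \<integral>x. g i x * e x \<partial>lborel) sums (\<integral>x. (\<Sum>i. g i x * e x) \<partial>lborel)"
      using inte ae nrm by (intro sums_integral) (auto simp: norm_mult ne)
    moreover have "(\<integral>x. (\<Sum>i. g i x * e x) \<partial>lborel) = (\<integral>x. (\<Sum>i. g i x) * e x \<partial>lborel)"
    proof (rule integral_cong_AE)
      show "AE x in lborel. (\<Sum>i. g i x * e x) = (\<Sum>i. g i x) * e x"
        using ae
      proof (rule eventually_mono)
        fix x assume s: "summable (\<lambda>i. norm (g i x))"
        show "(\<Sum>i. g i x * e x) = (\<Sum>i. g i x) * e x"
          by (rule suminf_mult2[OF summable_norm_cancel[OF s], symmetric])
      qed
    qed measurable
    ultimately have "(\<lambda>i. F i y) sums (\<integral>x. (\<Sum>i. g i x) * e x \<partial>lborel)" by (simp add: g(3) e_def)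
    then show "f y = (\<integral>x. (\<Sum>i. g i x) * exp (\<i> * complex_of_real (x \<bullet> y)) \<partial>lborel)"
      using f[of y] sums_unique2 by (auto simp: e_def)
  qed
  then show ?thesis .
qed

text \<open>The centres are \<open>h j * (2 * k j + o' j)\<close> and the half-widths
  \<open>h j\<close>, so for different \<open>k\<close> no two of these functions are nonzero at the
  same point.\<close>

definition hats :: "('n \<Rightarrow> real) \<Rightarrow> ('n \<Rightarrow> real) \<Rightarrow> ('n \<Rightarrow> int) \<Rightarrow> real ^ 'n \<Rightarrow> real" where
  "hats h o' k y = (\<Prod>j\<in>UNIV. hat (y $ j / h j - (2 * real_of_int (k j) + o' j)))"

text \<open>Translating a hat multiplies its density by an exponential, so the sum has the density
  \<open>kernel h * P\<close> with a trigonometric polynomial \<open>P\<close>. By orthonormality,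
  the L2 norm of \<open>P\<close> for the probability density \<open>kernel h\<close> is the l2 norm
  of the coefficients, and it dominates the L1 norm.\<close>

lemma A_bdd_hats_finite:
  fixes h o' :: "'n::finite \<Rightarrow> real" and c :: "'i \<Rightarrow> complex"
  assumes h: "\<And>j. h j > 0" and I: "finite I" and inj: "inj_on \<kappa> I"
  shows "A_bdd (sqrt (\<Sum>i\<in>I. (norm (c i))\<^sup>2)) (\<lambda>y. \<Sum>i\<in>I. c i * hats h o' (\<kappa> i) y)"
proof -
  define \<xi> :: "'i \<Rightarrow> real ^ 'n" where "\<xi> i = (\<chi> j. h j * (2 * real_of_int (\<kappa> i j) + o' j))" for i
  define E where "E y x = exp (\<i> * complex_of_real (x \<bullet> y))" for x y :: "real ^ 'n"
  have [measurable]: "E y \<in> borel_measurable borel" for y unfolding E_def[abs_def] by measurable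
  have nE: "norm (E y x) = 1" for x y by (simp add: E_def)
  have KE: "has_bochner_integral lborel (\<lambda>x. complex_of_real (kernel h x) * E y x) (of_real (\<Prod>j\<in>UNIV. hat (y $ j / h j)))" for y
    unfolding E_def by (rule kernel_exp_integral[OF h])
  have intK: "integrable lborel (kernel h)" "(\<integral>x. kernel h x \<partial>lborel) = 1"
  proof -
    have "has_bochner_integral lborel (\<lambda>x. complex_of_real (kernel h x)) 1"
      using KE[of 0] by (simp add: E_def)
    then show "integrable lborel (kernel h)" "(\<integral>x. kernel h x \<partial>lborel) = 1"
      by (auto simp: has_bochner_integral_iff complex_of_real_integrable_eq)
  qed
  define P where "P x = (\<Sum>i\<in>I. c i * E (- \<xi> i) x)" for x
  have [measurable]: "P \<in> borel_measurable borel" unfolding P_def[abs_def] by measurable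
  have EE: "E y x * E z x = E (y + z) x" for x y z
    by (simp add: E_def inner_add_right exp_add[symmetric] algebra_simps)
  have hats_eq: "(\<Prod>j\<in>UNIV. hat ((y - \<xi> i) $ j / h j)) = hats h o' (\<kappa> i) y" for y i
    unfolding hats_def \<xi>_def using h by (intro prod.cong refl arg_cong[where f=hat]) (simp add: diff_divide_distrib less_imp_neq[symmetric])
  define g where "g x = complex_of_real (kernel h x) * P x" for x
  have gE: "has_bochner_integral lborel (\<lambda>x. g x * E y x) (\<Sum>i\<in>I. c i * of_real (hats h o' (\<kappa> i) y))" for y
  proof -
    have "has_bochner_integral lborel (\<lambda>x. \<Sum>i\<in>I. c i * (complex_of_real (kernel h x) * E (y - \<xi> i) x))
      (\<Sum>i\<in>I. c i * of_real (\<Prod>j\<in>UNIV. hat ((y - \<xi> i) $ j / h j)))"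
      by (intro has_bochner_integral_sum has_bochner_integral_mult_right KE)
    moreover have "(\<Sum>i\<in>I. c i * (complex_of_real (kernel h x) * E (y - \<xi> i) x)) = g x * E y x" for x
    proof -
      have "E (y - \<xi> i) x = E (- \<xi> i) x * E y x" for i by (simp add: EE)
      then show ?thesis by (simp add: g_def P_def sum_distrib_left sum_distrib_right mult_ac)
    qed
    ultimately show ?thesis by (simp only: hats_eq)
  qed
  have intg: "integrable lborel g" using gE[of 0] by (simp add: has_bochner_integral_iff E_def)
  define N where "N = sqrt (\<Sum>i\<in>I. (norm (c i))\<^sup>2)"
  have N2: "N\<^sup>2 = (\<Sum>i\<in>I. (norm (c i))\<^sup>2)" by (simp add: N_def sum_nonneg)
  have KP2: "has_bochner_integral lborel (\<lambda>x. kernel h x * (norm (P x))\<^sup>2) (N\<^sup>2)"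
  proof -
    have cE: "cnj (E y x) = E (- y) x" for x y by (simp add: E_def exp_cnj)
    have "complex_of_real (kernel h x * (norm (P x))\<^sup>2) = (\<Sum>i\<in>I. \<Sum>l\<in>I. c i * cnj (c l) * (complex_of_real (kernel h x) * E (\<xi> l - \<xi> i) x))" for x
    proof -
      have "complex_of_real ((norm (P x))\<^sup>2) = P x * cnj (P x)" by (rule complex_norm_square)
      also have "\<dots> = (\<Sum>i\<in>I. \<Sum>l\<in>I. (c i * E (- \<xi> i) x) * (cnj (c l) * E (\<xi> l) x))"
        unfolding P_def cnj_sum by (simp add: sum_product cE)
      also have "\<dots> = (\<Sum>i\<in>I. \<Sum>l\<in>I. c i * cnj (c l) * E (\<xi> l - \<xi> i) x)"
      proof (intro sum.cong refl)
        fix i l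
        have "E (\<xi> l - \<xi> i) x = E (- \<xi> i) x * E (\<xi> l) x" by (simp add: EE)
        then show "(c i * E (- \<xi> i) x) * (cnj (c l) * E (\<xi> l) x) = c i * cnj (c l) * E (\<xi> l - \<xi> i) x" by simp
      qed
      finally show ?thesis by (simp add: sum_distrib_left mult_ac)
    qed
    moreover have "has_bochner_integral lborel (\<lambda>x. \<Sum>i\<in>I. \<Sum>l\<in>I. c i * cnj (c l) * (complex_of_real (kernel h x) * E (\<xi> l - \<xi> i) x))
       (\<Sum>i\<in>I. \<Sum>l\<in>I. c i * cnj (c l) * of_real (\<Prod>j\<in>UNIV. hat ((\<xi> l - \<xi> i) $ j / h j)))"
      by (intro has_bochner_integral_sum has_bochner_integral_mult_right KE)
    moreover have "(\<Sum>i\<in>I. \<Sum>l\<in>I. c i * cnj (c l) * of_real (\<Prod>j\<in>UNIV. hat ((\<xi> l - \<xi> i) $ j / h j))) = of_real (N\<^sup>2)"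
    proof -
      have "(\<Prod>j\<in>UNIV. hat ((\<xi> l - \<xi> i) $ j / h j)) = (if l = i then 1 else 0)" if "i \<in> I" "l \<in> I" for i l
      proof -
        have "(\<xi> l - \<xi> i) $ j / h j = 2 * real_of_int (\<kappa> l j - \<kappa> i j)" for j
          using h[of j] by (simp add: \<xi>_def field_simps)
        then have "(\<Prod>j\<in>UNIV. hat ((\<xi> l - \<xi> i) $ j / h j)) = (\<Prod>j\<in>UNIV. if \<kappa> l j - \<kappa> i j = 0 then 1 else 0)"
          by (simp only: hat_int)
        also have "\<dots> = (if l = i then 1 else 0)"
        proof (cases "l = i")
          case False
          then have "\<kappa> l \<noteq> \<kappa> i" using inj that by (auto simp: inj_on_def)
          then obtain j where "\<kappa> l j \<noteq> \<kappa> i j" by auto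
          then show ?thesis using False by (auto intro!: prod_zero)
        qed simp
        finally show ?thesis .
      qed
      then have "(\<Sum>i\<in>I. \<Sum>l\<in>I. c i * cnj (c l) * of_real (\<Prod>j\<in>UNIV. hat ((\<xi> l - \<xi> i) $ j / h j)))
        = (\<Sum>i\<in>I. \<Sum>l\<in>I. if l = i then c i * cnj (c l) else 0)"
        by (intro sum.cong refl) auto
      also have "\<dots> = (\<Sum>i\<in>I. of_real ((norm (c i))\<^sup>2))"
        using I by (simp add: sum.delta complex_norm_square del: of_real_power)
      finally show ?thesis by (simp add: N2)
    qed
    ultimately have "has_bochner_integral lborel (\<lambda>x. complex_of_real (kernel h x * (norm (P x))\<^sup>2)) (of_real (N\<^sup>2))" by simp
    from has_bochner_integral_bounded_linear[OF bounded_linear_Re this] show ?thesis by simp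
  qed
  have bound: "(\<integral>x. norm (g x) \<partial>lborel) \<le> N"
  proof (cases "N = 0")
    case True
    then have "\<forall>i\<in>I. c i = 0" using I by (simp add: N_def sum_nonneg_eq_0_iff)
    then have "g = (\<lambda>x. 0)" by (auto simp: g_def P_def)
    then show ?thesis using True by simp
  next
    case False
    then have N: "N > 0" by (simp add: N_def less_le sum_nonneg)
    \<comment> \<open>Cauchy--Schwarz in the form
      \<open>2 * norm (P x) * N \<le> (norm (P x))\<^sup>2 + N\<^sup>2\<close>. After division by
      \<open>N\<close>, both terms integrate to \<open>N\<close>.\<close>
    have "(\<integral>x. norm (g x) \<partial>lborel) \<le> (\<integral>x. (kernel h x * (norm (P x))\<^sup>2 / N + kernel h x * N) / 2 \<partial>lborel)"
    proof (rule integral_mono)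
      show "integrable lborel (\<lambda>x. (kernel h x * (norm (P x))\<^sup>2 / N + kernel h x * N) / 2)"
        using KP2 intK by (auto simp: has_bochner_integral_iff)
      fix x
      have "2 * norm (P x) * N \<le> (norm (P x))\<^sup>2 + N\<^sup>2" by (rule sum_squares_bound)
      then have "norm (P x) \<le> ((norm (P x))\<^sup>2 / N + N) / 2" using N by (simp add: field_simps power2_eq_square)
      then have "kernel h x * norm (P x) \<le> kernel h x * (((norm (P x))\<^sup>2 / N + N) / 2)"
        using kernel_nonneg[OF h] by (intro mult_left_mono)
      then show "norm (g x) \<le> (kernel h x * (norm (P x))\<^sup>2 / N + kernel h x * N) / 2"
        using kernel_nonneg[of h x, OF h] by (simp add: g_def norm_mult algebra_simps)
    qed (use intg in auto)
    also have "\<dots> = (N\<^sup>2 / N + N) / 2"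
      using KP2 intK by (simp add: has_bochner_integral_iff)
    also have "\<dots> = N" using N by (simp add: power2_eq_square)
    finally show ?thesis .
  qed
  show ?thesis unfolding A_bdd_def
    using intg bound gE by (intro exI[of _ g]) (auto simp: N_def E_def has_bochner_integral_iff)
qed

text \<open>The blocks of the series are cut so that their \<open>\<ell>\<^sup>2\<close> norms decrease geometrically.\<close>

lemma A_bdd_hats:
  fixes h o' :: "'n::finite \<Rightarrow> real" and c :: "nat \<Rightarrow> complex"
  assumes h: "\<And>j. h j > 0" and inj: "inj \<kappa>"
    and c: "summable (\<lambda>i. (norm (c i))\<^sup>2)" "(\<Sum>i. (norm (c i))\<^sup>2) \<le> N\<^sup>2" and N: "N \<ge> 0"
    and F: "\<And>y. (\<lambda>i. c i * hats h o' (\<kappa> i) y) sums F y"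
  shows "A_bdd (2 * N) F"
proof (cases "N = 0")
  case True
  have "c i = 0" for i
  proof -
    have "(norm (c i))\<^sup>2 \<le> (\<Sum>i. (norm (c i))\<^sup>2)"
      using sum_le_suminf[OF c(1), of "{i}"] by simp
    from order_trans[OF this c(2)] have "(norm (c i))\<^sup>2 \<le> 0" using True by simp
    then show ?thesis by simp
  qed
  then have "F y = 0" for y using F[of y] sums_unique2[OF sums_zero] by force
  then have "F = (\<lambda>_. 0)" by auto
  moreover have "A_bdd 0 (\<lambda>_ :: real ^ 'n. 0)" unfolding A_bdd_def by (intro exI[of _ "\<lambda>_. 0"]) auto
  ultimately show ?thesis using True by simp
next
  case False
  with N have N0: "N > 0" by simp
  define a where "a i = (norm (c i))\<^sup>2" for i
  have sa: "summable a" unfolding a_def by (rule c(1))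
  have a0: "a i \<ge> 0" for i by (simp add: a_def)
  have "\<exists>n\<ge>m. (\<Sum>i. a (i + n)) \<le> e" if e: "e > 0" for m e
  proof -
    obtain n0 where "\<And>n. n \<ge> n0 \<Longrightarrow> norm (\<Sum>i. a (i + n)) < e" using suminf_exist_split[OF e sa] by blast
    from this[of "max m n0"] show ?thesis by (intro exI[of _ "max m n0"]) auto
  qed
  then have ex: "\<And>m k. \<exists>n\<ge>m. (\<Sum>i. a (i + n)) \<le> N\<^sup>2 / 4 ^ k" using N0 by simp
  define r where "r = rec_nat 0 (\<lambda>k m. SOME n. n \<ge> Suc m \<and> (\<Sum>i. a (i + n)) \<le> N\<^sup>2 / 4 ^ Suc k)"
  have r0: "r 0 = 0" by (simp add: r_def)
  have rS: "r (Suc k) \<ge> Suc (r k) \<and> (\<Sum>i. a (i + r (Suc k))) \<le> N\<^sup>2 / 4 ^ Suc k" for k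
  proof -
    have eq: "r (Suc k) = (SOME n. n \<ge> Suc (r k) \<and> (\<Sum>i. a (i + n)) \<le> N\<^sup>2 / 4 ^ Suc k)" by (simp add: r_def)
    show ?thesis unfolding eq by (rule someI_ex) (use ex in blast)
  qed
  have tail: "(\<Sum>i. a (i + r k)) \<le> N\<^sup>2 / 4 ^ k" for k
    by (cases k) (use rS c(2) in \<open>auto simp: r0 a_def\<close>)
  have sm: "strict_mono r" using rS by (auto simp: strict_mono_Suc_iff Suc_le_eq)
  define B where "B k = {r k..<r (Suc k)}" for k
  have blk: "A_bdd (N * (1 / 2) ^ k) (\<lambda>y. \<Sum>i\<in>B k. c i * hats h o' (\<kappa> i) y)" for k
  proof -
    have "(\<Sum>i\<in>B k. a i) = (\<Sum>i<r (Suc k) - r k. a (i + r k))"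
      unfolding B_def lessThan_atLeast0 by (subst sum.shift_bounds_nat_ivl[symmetric]) (use rS[of k] in simp)
    also have "\<dots> \<le> (\<Sum>i. a (i + r k))"
      using sa a0 by (intro sum_le_suminf) (auto simp: summable_iff_shift)
    also have "\<dots> \<le> N\<^sup>2 / 4 ^ k" by (rule tail)
    also have "\<dots> = (N * (1 / 2) ^ k)\<^sup>2" by (simp add: power_mult_distrib power_divide power2_eq_square flip: power_mult_distrib)
    finally have "sqrt (\<Sum>i\<in>B k. (norm (c i))\<^sup>2) \<le> N * (1 / 2) ^ k"
      using N by (intro real_le_lsqrt) (auto simp: a_def)
    moreover have "A_bdd (sqrt (\<Sum>i\<in>B k. (norm (c i))\<^sup>2)) (\<lambda>y. \<Sum>i\<in>B k. c i * hats h o' (\<kappa> i) y)"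
      by (rule A_bdd_hats_finite[OF h]) (use inj in \<open>auto simp: B_def intro: inj_on_subset\<close>)
    ultimately show ?thesis unfolding A_bdd_def by (meson order_trans)
  qed
  have geo: "(\<lambda>k. N * (1 / 2) ^ k) sums (N * 2)" using sums_mult[OF geometric_sums[of "1/2::real"], of N] by simp
  have "A_bdd (\<Sum>k. N * (1 / 2) ^ k) F"
  proof (rule A_bdd_suminf[OF blk])
    show "summable (\<lambda>k. N * (1 / 2) ^ k)" using geo by (rule sums_summable)
    fix y
    have "(\<Sum>k<m. \<Sum>i\<in>B k. c i * hats h o' (\<kappa> i) y) = (\<Sum>i<r m. c i * hats h o' (\<kappa> i) y)" for m
    proof (induction m)
      case (Suc m)
      have eq: "{..<r (Suc m)} = {..<r m} \<union> B m" using rS[of m] by (auto simp: B_def)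
      have "(\<Sum>i<r (Suc m). c i * hats h o' (\<kappa> i) y) = (\<Sum>i<r m. c i * hats h o' (\<kappa> i) y) + (\<Sum>i\<in>B m. c i * hats h o' (\<kappa> i) y)"
        unfolding eq by (rule sum.union_disjoint) (auto simp: B_def)
      then show ?case using Suc by simp
    qed (simp add: r0)
    moreover have "(\<lambda>m. \<Sum>i<r m. c i * hats h o' (\<kappa> i) y) \<longlonglongrightarrow> F y"
      using LIMSEQ_subseq_LIMSEQ[OF F[of y, unfolded sums_def] sm] by (simp add: o_def)
    ultimately show "(\<lambda>k. \<Sum>i\<in>B k. c i * hats h o' (\<kappa> i) y) sums F y" by (simp add: sums_def)
  qed
  then show ?thesis using geo by (simp add: sums_iff mult.commute)
qed

section \<open>The tensor Faber--Schauder expansion\<close>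

text \<open>Finitely supported functions on the line stand for combinations of point evaluations.\<close>

definition atom :: "real \<Rightarrow> real \<Rightarrow> real" where "atom x z = (if z = x then 1 else 0)"

definition fin_supp :: "(real \<Rightarrow> real) \<Rightarrow> bool" where "fin_supp a \<longleftrightarrow> finite {z. a z \<noteq> 0}"

definition tensor :: "('n \<Rightarrow> real \<Rightarrow> real) \<Rightarrow> (real ^ 'n \<Rightarrow> complex) \<Rightarrow> complex" where
  "tensor a f = (\<Sum>z | \<forall>j. a j (z $ j) \<noteq> 0. (\<Prod>j\<in>UNIV. complex_of_real (a j (z $ j))) * f z)"

lemma finite_vec_set:
  fixes A :: "'n::finite \<Rightarrow> real set"
  assumes "\<And>j. finite (A j)"
  shows "finite {z :: real ^ 'n. \<forall>j. z $ j \<in> A j}"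
proof -
  have "{z :: real ^ 'n. \<forall>j. z $ j \<in> A j} \<subseteq> vec_lambda ` (PiE UNIV A)"
  proof
    fix z :: "real ^ 'n" assume "z \<in> {z. \<forall>j. z $ j \<in> A j}"
    then show "z \<in> vec_lambda ` (PiE UNIV A)" by (intro image_eqI[of _ _ "vec_nth z"]) auto
  qed
  then show ?thesis by (rule finite_subset) (intro finite_imageI finite_PiE, use assms in auto)
qed

lemma tensor_superset:
  fixes a :: "'n::finite \<Rightarrow> real \<Rightarrow> real"
  assumes "\<And>j. finite (A j)" "\<And>j. {z. a j z \<noteq> 0} \<subseteq> A j"
  shows "tensor a f = (\<Sum>z | \<forall>j. z $ j \<in> A j. (\<Prod>j\<in>UNIV. complex_of_real (a j (z $ j))) * f z)"
  unfolding tensor_def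
proof (rule sum.mono_neutral_left)
  show "finite {z :: real ^ 'n. \<forall>j. z $ j \<in> A j}" by (rule finite_vec_set[OF assms(1)])
  show "{z :: real ^ 'n. \<forall>j. a j (z $ j) \<noteq> 0} \<subseteq> {z. \<forall>j. z $ j \<in> A j}" using assms(2) by blast
qed (auto intro!: prod_zero)

text \<open>Multilinearity. All tensors are written over one common finite grid of points, so that
  the two sums can be interchanged.\<close>

lemma tensor_sum:
  fixes a :: "'n::finite \<Rightarrow> real \<Rightarrow> real"
  assumes S: "\<And>j. finite (S j)" and b: "\<And>j s. s \<in> S j \<Longrightarrow> fin_supp (b j s)"
    and a: "\<And>j z. a j z = (\<Sum>s\<in>S j. r j s * b j s z)"
  shows "tensor a f = (\<Sum>\<sigma>\<in>PiE UNIV S. (\<Prod>j\<in>UNIV. complex_of_real (r j (\<sigma> j))) * tensor (\<lambda>j. b j (\<sigma> j)) f)"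
proof -
  define A where "A j = (\<Union>s\<in>S j. {z. b j s z \<noteq> 0})" for j
  have A: "finite (A j)" for j unfolding A_def using S b by (auto simp: fin_supp_def)
  have "{z. a j z \<noteq> 0} \<subseteq> A j" for j
  proof
    fix z assume "z \<in> {z. a j z \<noteq> 0}"
    then show "z \<in> A j" unfolding a A_def by (auto elim!: sum.not_neutral_contains_not_neutral)
  qed
  then have "tensor a f = (\<Sum>z | \<forall>j. z $ j \<in> A j. (\<Prod>j\<in>UNIV. complex_of_real (a j (z $ j))) * f z)"
    by (rule tensor_superset[OF A])
  also have "\<dots> = (\<Sum>z | \<forall>j. z $ j \<in> A j. (\<Sum>\<sigma>\<in>PiE UNIV S. \<Prod>j\<in>UNIV. complex_of_real (r j (\<sigma> j) * b j (\<sigma> j) (z $ j))) * f z)"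
    unfolding a of_real_sum by (subst prod_sum_PiE) (use S in auto)
  also have "\<dots> = (\<Sum>z | \<forall>j. z $ j \<in> A j. \<Sum>\<sigma>\<in>PiE UNIV S. (\<Prod>j\<in>UNIV. complex_of_real (r j (\<sigma> j))) * ((\<Prod>j\<in>UNIV. complex_of_real (b j (\<sigma> j) (z $ j))) * f z))"
    by (simp add: sum_distrib_right prod.distrib mult.assoc)
  also have "\<dots> = (\<Sum>\<sigma>\<in>PiE UNIV S. \<Sum>z | \<forall>j. z $ j \<in> A j. (\<Prod>j\<in>UNIV. complex_of_real (r j (\<sigma> j))) * ((\<Prod>j\<in>UNIV. complex_of_real (b j (\<sigma> j) (z $ j))) * f z))"
    by (rule sum.swap)
  also have "\<dots> = (\<Sum>\<sigma>\<in>PiE UNIV S. (\<Prod>j\<in>UNIV. complex_of_real (r j (\<sigma> j))) * tensor (\<lambda>j. b j (\<sigma> j)) f)"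
  proof (rule sum.cong[OF refl])
    fix \<sigma> assume \<sigma>: "\<sigma> \<in> PiE UNIV S"
    have "tensor (\<lambda>j. b j (\<sigma> j)) f = (\<Sum>z | \<forall>j. z $ j \<in> A j. (\<Prod>j\<in>UNIV. complex_of_real (b j (\<sigma> j) (z $ j))) * f z)"
      by (rule tensor_superset[OF A]) (use \<sigma> in \<open>auto simp: A_def\<close>)
    then show "(\<Sum>z | \<forall>j. z $ j \<in> A j. (\<Prod>j\<in>UNIV. complex_of_real (r j (\<sigma> j))) * ((\<Prod>j\<in>UNIV. complex_of_real (b j (\<sigma> j) (z $ j))) * f z))
      = (\<Prod>j\<in>UNIV. complex_of_real (r j (\<sigma> j))) * tensor (\<lambda>j. b j (\<sigma> j)) f"
      by (simp add: sum_distrib_left)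
  qed
  finally show ?thesis .
qed

lemma fin_supp_atom: "fin_supp (atom x)"
  by (simp add: fin_supp_def atom_def)

lemma tensor_atom:
  fixes x :: "'n::finite \<Rightarrow> real"
  shows "tensor (\<lambda>j. atom (x j)) f = f (\<chi> j. x j)"
proof -
  have "{z :: real ^ 'n. \<forall>j. atom (x j) (z $ j) \<noteq> 0} = {\<chi> j. x j}"
    by (auto simp: atom_def vec_eq_iff)
  then show ?thesis by (simp add: tensor_def atom_def)
qed

lemma tensor_atoms:
  fixes a :: "'n::finite \<Rightarrow> real \<Rightarrow> real"
  assumes I: "finite I" and a: "\<And>j z. a j z = (\<Sum>i\<in>I. c j i * atom (x j i) z)"
  shows "tensor a f = (\<Sum>\<iota>\<in>PiE UNIV (\<lambda>_. I). (\<Prod>j\<in>UNIV. complex_of_real (c j (\<iota> j))) * f (\<chi> j. x j (\<iota> j)))"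
  by (subst tensor_sum[of "\<lambda>_. I" "\<lambda>j i. atom (x j i)" a c]) (use I in \<open>auto simp: fin_supp_atom a tensor_atom\<close>)

text \<open>
  Since \<open>2 * shift (s + 1) - shift s\<close> is always an integer, the grid of level \<open>s + 1\<close> consists of
  every other point of the grid of level \<open>s\<close>; no grid contains \<open>0\<close>.
\<close>

definition shift :: "int \<Rightarrow> real" where "shift s = (if even s then 1 / 3 else 2 / 3)"

definition grid_pt :: "int \<Rightarrow> int \<Rightarrow> real" where "grid_pt s k = 2 powi s * (real_of_int k + shift s)"

definition cell :: "int \<Rightarrow> real \<Rightarrow> int" where "cell s y = \<lfloor>y / 2 powi s - shift s\<rfloor>"

definition cell_pos :: "int \<Rightarrow> real \<Rightarrow> real" where "cell_pos s y = y / 2 powi s - shift s - real_of_int (cell s y)"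

text \<open>The functional that evaluates at \<open>y\<close> the piecewise linear interpolant on
  the grid of level \<open>s\<close>.\<close>

definition interp :: "int \<Rightarrow> real \<Rightarrow> real \<Rightarrow> real" where
  "interp s y z = (1 - cell_pos s y) * atom (grid_pt s (cell s y)) z + cell_pos s y * atom (grid_pt s (cell s y + 1)) z"

text \<open>The midpoint of the cell with number \<open>k\<close> on level \<open>s + 1\<close>: a
  grid point of level \<open>s\<close> but not of level \<open>s + 1\<close>.\<close>

definition mid :: "int \<Rightarrow> int \<Rightarrow> real" where
  "mid s k = 2 powi s * (2 * real_of_int k + (2 * shift (s + 1) + 1))"

definition second_diff :: "int \<Rightarrow> int \<Rightarrow> real \<Rightarrow> real" where
  "second_diff s k z = atom (mid s k) z - atom (mid s k - 2 powi s) z / 2 - atom (mid s k + 2 powi s) z / 2"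

lemma cell_pos_bounds: "0 \<le> cell_pos s y" "cell_pos s y < 1"
  unfolding cell_pos_def cell_def by linarith+

text \<open>The coarse cell of \<open>y\<close> consists of two fine cells, and two interpolants
  that agree at its ends differ by a hat at the midpoint times the second difference there. The
  integer \<open>m\<close> translates coarse cell numbers into fine ones: the halves are
  \<open>2 * k + m\<close> and \<open>2 * k + m + 1\<close>.\<close>

lemma interp_diff:
  "interp s y z - interp (s + 1) y z =
     hat (y / 2 powi s - (2 * real_of_int (cell (s + 1) y) + (2 * shift (s + 1) + 1))) * second_diff s (cell (s + 1) y) z"
proof -
  define h :: real where "h = 2 powi s"
  have h: "h > 0" by (simp add: h_def)
  have h2: "2 powi (s + 1) = 2 * h" by (simp add: h_def power_int_add)
  define k where "k = cell (s + 1) y"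
  define t where "t = cell_pos (s + 1) y"
  have t: "0 \<le> t" "t < 1" unfolding t_def by (rule cell_pos_bounds)+
  have y: "y / h = 2 * (t + real_of_int k + shift (s + 1))"
  proof -
    have "t = y / (2 * h) - shift (s + 1) - real_of_int k" by (simp only: t_def k_def cell_pos_def h2)
    then show ?thesis by simp
  qed
  obtain m :: int where m: "2 * shift (s + 1) - shift s = real_of_int m"
  proof (cases "even s")
    case True
    then show ?thesis by (intro that[of 1]) (simp add: shift_def)
  next
    case False
    then show ?thesis by (intro that[of 0]) (simp add: shift_def)
  qed
  have L: "grid_pt (s + 1) k = mid s k - h" "grid_pt (s + 1) (k + 1) = mid s k + h"
    unfolding grid_pt_def mid_def h2 h_def[symmetric] by (simp_all add: algebra_simps)
  have grid_pt_s: "grid_pt s (2 * k + m) = mid s k - h" "grid_pt s (2 * k + m + 1) = mid s k" "grid_pt s (2 * k + m + 1 + 1) = mid s k + h"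
    unfolding grid_pt_def mid_def h_def[symmetric] of_int_add of_int_mult m[symmetric] by (simp_all add: algebra_simps)
  have hatarg: "y / h - (2 * real_of_int k + (2 * shift (s + 1) + 1)) = 2 * t - 1"
    unfolding y by simp
  have cs: "y / h - shift s = 2 * t + real_of_int (2 * k + m)"
    unfolding y of_int_add m[symmetric] by simp
  have fl: "\<lfloor>2 * t + real_of_int (2 * k + m)\<rfloor> = \<lfloor>2 * t\<rfloor> + (2 * k + m)" by linarith
  show ?thesis
  proof (cases "t < 1 / 2")
    case True
    then have "\<lfloor>2 * t\<rfloor> = 0" using t by (simp add: floor_eq_iff)
    then have c: "cell s y = 2 * k + m" unfolding cell_def h_def[symmetric] cs fl by simp
    have p: "cell_pos s y = 2 * t" unfolding cell_pos_def c h_def[symmetric] cs by simp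
    have H: "hat (2 * t - 1) = 2 * t" using True t by (simp add: hat_def)
    show ?thesis unfolding interp_def c p k_def[symmetric] t_def[symmetric] L grid_pt_s hatarg second_diff_def h_def[symmetric] H
      by (simp add: algebra_simps)
  next
    case False
    then have "\<lfloor>2 * t\<rfloor> = 1" using t by (simp add: floor_eq_iff)
    then have c: "cell s y = 2 * k + m + 1" unfolding cell_def h_def[symmetric] cs fl by simp
    have p: "cell_pos s y = 2 * t - 1" unfolding cell_pos_def c h_def[symmetric] cs by simp
    have H: "hat (2 * t - 1) = 2 - 2 * t" using False t by (simp add: hat_def)
    show ?thesis unfolding interp_def c p k_def[symmetric] t_def[symmetric] L grid_pt_s hatarg second_diff_def h_def[symmetric] H
      by (simp add: field_simps)
  qed
qed

lemma hat_other_cell: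
  assumes "k \<noteq> cell (s + 1) y"
  shows "hat (y / 2 powi s - (2 * real_of_int k + (2 * shift (s + 1) + 1))) = 0"
proof -
  have h2: "(2::real) powi (s + 1) = 2 * 2 powi s" by (simp add: power_int_add)
  define u where "u = y / 2 powi (s + 1) - shift (s + 1)"
  have e: "y / 2 powi s - (2 * real_of_int k + (2 * shift (s + 1) + 1)) = 2 * (u - real_of_int k) - 1"
    by (simp add: u_def h2)
  have "k \<noteq> \<lfloor>u\<rfloor>" using assms by (simp add: cell_def u_def)
  then have "u < k \<or> u \<ge> k + 1" by linarith
  then show ?thesis unfolding e by (auto simp: hat_def)
qed

lemma interp_telescope:
  "(\<Sum>s\<in>{- int N..int N}. interp s y z - interp (s + 1) y z) = interp (- int N) y z - interp (int N + 1) y z"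
proof (induction N)
  case (Suc N)
  have "{- int (Suc N)..int (Suc N)} = insert (- int (Suc N)) (insert (int (Suc N)) {- int N..int N})" by auto
  then show ?case using Suc by (simp add: algebra_simps)
qed simp

definition coef :: "(real ^ 'n \<Rightarrow> complex) \<Rightarrow> ('n \<Rightarrow> int) \<Rightarrow> ('n \<Rightarrow> int) \<Rightarrow> complex" where
  "coef f s k = tensor (\<lambda>j. second_diff (s j) (k j)) f"

lemma fin_supp_second_diff: "fin_supp (second_diff s k)"
  unfolding fin_supp_def
  by (rule finite_subset[of _ "{mid s k, mid s k - 2 powi s, mid s k + 2 powi s}"]) (auto simp: second_diff_def atom_def)

lemma grid_pt_abs_ge: "\<bar>grid_pt s k\<bar> \<ge> 2 powi s / 3"
proof -
  have "\<bar>real_of_int k + shift s\<bar> \<ge> 1 / 3"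
  proof (cases "k \<ge> 0")
    case False
    then have "real_of_int k \<le> -1" by linarith
    then show ?thesis by (simp add: shift_def)
  qed (auto simp: shift_def)
  then have "2 powi s * \<bar>real_of_int k + shift s\<bar> \<ge> 2 powi s * (1 / 3)" by (intro mult_left_mono) auto
  then show ?thesis by (simp add: grid_pt_def abs_mult)
qed

lemma grid_pt_cell_near:
  "\<bar>grid_pt s (cell s y) - y\<bar> \<le> 2 powi s" "\<bar>grid_pt s (cell s y + 1) - y\<bar> \<le> 2 powi s"
proof -
  have y: "y = 2 powi s * (cell_pos s y + real_of_int (cell s y) + shift s)"
    by (simp add: cell_pos_def field_simps)
  have 1: "grid_pt s (cell s y) - y = - (2 powi s * cell_pos s y)" by (subst y) (simp add: grid_pt_def algebra_simps)
  have 2: "grid_pt s (cell s y + 1) - y = 2 powi s * (1 - cell_pos s y)" by (subst y) (simp add: grid_pt_def algebra_simps)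
  show "\<bar>grid_pt s (cell s y) - y\<bar> \<le> 2 powi s" "\<bar>grid_pt s (cell s y + 1) - y\<bar> \<le> 2 powi s"
    unfolding 1 2 using cell_pos_bounds[of s y] by (auto simp: abs_mult mult_left_le)
qed

text \<open>Terms with only fine nodes converge to \<open>f y\<close> by continuity. A coarse node
  in any coordinate has absolute value at least \<open>2 ^ N / 3\<close>, because the grids keep
  away from 0, so such terms vanish in the limit as \<open>f\<close> tends to 0 at infinity.
  Therefore no lower-dimensional terms remain in the expansion.\<close>

lemma tensor_interp_tendsto:
  fixes f :: "real ^ 'n::finite \<Rightarrow> complex"
  assumes f: "f \<in> C0"
  shows "(\<lambda>N. tensor (\<lambda>j z. interp (- int N) (y $ j) z - interp (int N + 1) (y $ j) z) f) \<longlonglongrightarrow> f y"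
proof -
  \<comment> \<open>Indices 0 and 1 stand for the two fine nodes, 2 and 3 for the two coarse nodes
    with the opposite sign.\<close>
  define c where "c N j i = (if i = 0 then 1 - cell_pos (- int N) (y $ j) else if i = 1 then cell_pos (- int N) (y $ j)
     else if i = 2 then - (1 - cell_pos (int N + 1) (y $ j)) else - cell_pos (int N + 1) (y $ j))" for N j and i :: nat
  define x where "x N j i = (if i = 0 then grid_pt (- int N) (cell (- int N) (y $ j)) else if i = 1 then grid_pt (- int N) (cell (- int N) (y $ j) + 1)
     else if i = 2 then grid_pt (int N + 1) (cell (int N + 1) (y $ j)) else grid_pt (int N + 1) (cell (int N + 1) (y $ j) + 1))" for N j and i :: nat
  define I where "I = {0,1,2,3::nat}"
  define J where "J = PiE (UNIV :: 'n set) (\<lambda>_. I)"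
  define J0 where "J0 = PiE (UNIV :: 'n set) (\<lambda>_. {0,1::nat})"
  have fin: "finite J" "J0 \<subseteq> J" by (auto simp: J_def J0_def I_def intro!: finite_PiE PiE_mono)
  define P where "P N \<iota> = (\<Prod>j\<in>UNIV. complex_of_real (c N j (\<iota> j)))" for N \<iota>
  have T: "tensor (\<lambda>j z. interp (- int N) (y $ j) z - interp (int N + 1) (y $ j) z) f =
    (\<Sum>\<iota>\<in>J. P N \<iota> * f (\<chi> j. x N j (\<iota> j)))" for N
    unfolding P_def J_def
    by (rule tensor_atoms) (auto simp: I_def c_def x_def interp_def algebra_simps)
  have one: "(\<Sum>\<iota>\<in>J0. P N \<iota>) = 1" for N
  proof -
    have "(\<Sum>\<iota>\<in>J0. P N \<iota>) = (\<Prod>j\<in>UNIV. \<Sum>i\<in>{0,1::nat}. complex_of_real (c N j i))"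
      unfolding P_def J0_def by (rule prod_sum_PiE[symmetric]) auto
    also have "\<dots> = 1" by (intro prod.neutral) (auto simp: c_def)
    finally show ?thesis .
  qed
  have Pb: "norm (P N \<iota>) \<le> 1" for N \<iota>
  proof -
    have "norm (P N \<iota>) = (\<Prod>j\<in>UNIV. \<bar>c N j (\<iota> j)\<bar>)" by (simp add: P_def flip: prod_norm)
    also have "\<dots> \<le> 1"
    proof (rule prod_le_1)
      fix j show "0 \<le> \<bar>c N j (\<iota> j)\<bar> \<and> \<bar>c N j (\<iota> j)\<bar> \<le> 1"
        using cell_pos_bounds[of "- int N" "y $ j"] cell_pos_bounds[of "int N + 1" "y $ j"] by (auto simp: c_def)
    qed
    finally show ?thesis .
  qed
  define R where "R N \<iota> = f (\<chi> j. x N j (\<iota> j)) - (if \<iota> \<in> J0 then f y else 0)" for N \<iota>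
  have R: "(\<lambda>N. R N \<iota>) \<longlonglongrightarrow> 0" if \<iota>: "\<iota> \<in> J" for \<iota>
  proof (cases "\<iota> \<in> J0")
    case True
    have "(\<lambda>N. x N j (\<iota> j)) \<longlonglongrightarrow> y $ j" for j
    proof (rule LIM_zero_cancel, rule Lim_null_comparison)
      have "\<iota> j = 0 \<or> \<iota> j = 1" using True by (auto simp: J0_def PiE_iff)
      then show "\<forall>\<^sub>F N in sequentially. norm (x N j (\<iota> j) - y $ j) \<le> (1 / 2) ^ N"
        using grid_pt_cell_near[of "- int N" "y $ j" for N] by (intro always_eventually) (auto simp: x_def power_int_minus power_divide field_simps)
      show "(\<lambda>N. (1 / 2 :: real) ^ N) \<longlonglongrightarrow> 0" by (rule LIMSEQ_realpow_zero) auto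
    qed
    then have "(\<lambda>N. \<chi> j. x N j (\<iota> j)) \<longlonglongrightarrow> (\<chi> j. y $ j)" by (intro tendsto_vec_lambda)
    moreover have "isCont f y" using f by (auto simp: C0_def continuous_on_eq_continuous_at)
    ultimately have "(\<lambda>N. f (\<chi> j. x N j (\<iota> j))) \<longlonglongrightarrow> f y" using isCont_tendsto_compose by fastforce
    then show ?thesis using True unfolding R_def by (simp add: LIM_zero)
  next
    case False
    then obtain j where j: "\<iota> j \<notin> {0,1}" by (auto simp: J0_def)
    have jI: "\<iota> j \<in> I" using \<iota> by (auto simp: J_def)
    have "norm (\<chi> j. x N j (\<iota> j)) \<ge> 2 ^ N / 3" for N
    proof -
      have "2 ^ N \<le> (2::real) powi (int N + 1)" by (simp add: power_int_add)
      then have "2 ^ N / 3 \<le> \<bar>x N j (\<iota> j)\<bar>"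
        using j jI grid_pt_abs_ge[of "int N + 1" "cell (int N + 1) (y $ j)"] grid_pt_abs_ge[of "int N + 1" "cell (int N + 1) (y $ j) + 1"]
        by (auto simp: I_def x_def)
      also have "\<dots> \<le> norm (\<chi> j. x N j (\<iota> j))" using component_le_norm_cart[of "\<chi> j. x N j (\<iota> j)" j] by simp
      finally show ?thesis .
    qed
    note ge = this
    have "filterlim (\<lambda>N. 2 ^ N / 3 :: real) at_top sequentially" by real_asymp
    then have "filterlim (\<lambda>N. norm (\<chi> j. x N j (\<iota> j))) at_top sequentially"
      by (rule filterlim_at_top_mono) (intro always_eventually allI ge)
    then have "filterlim (\<lambda>N. \<chi> j. x N j (\<iota> j)) at_infinity sequentially"
      by (rule filterlim_norm_at_top_imp_at_infinity)
    then have "(\<lambda>N. f (\<chi> j. x N j (\<iota> j))) \<longlonglongrightarrow> 0" using f by (auto simp: C0_def intro: filterlim_compose)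
    then show ?thesis using False by (simp add: R_def)
  qed
  have "(\<lambda>N. \<Sum>\<iota>\<in>J. P N \<iota> * R N \<iota>) \<longlonglongrightarrow> 0"
  proof (rule tendsto_null_sum)
    fix \<iota> assume "\<iota> \<in> J"
    show "(\<lambda>N. P N \<iota> * R N \<iota>) \<longlonglongrightarrow> 0"
    proof (rule Lim_null_comparison[OF _ tendsto_norm_zero[OF R[OF \<open>\<iota> \<in> J\<close>]]])
      show "\<forall>\<^sub>F N in sequentially. norm (P N \<iota> * R N \<iota>) \<le> norm (R N \<iota>)"
        using Pb[of _ \<iota>] by (intro always_eventually) (auto simp: norm_mult mult_left_le_one_le)
    qed
  qed
  moreover have "(\<Sum>\<iota>\<in>J. P N \<iota> * R N \<iota>) = (\<Sum>\<iota>\<in>J. P N \<iota> * f (\<chi> j. x N j (\<iota> j))) - f y" for N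
  proof -
    have "(\<Sum>\<iota>\<in>J. P N \<iota> * R N \<iota>) = (\<Sum>\<iota>\<in>J. P N \<iota> * f (\<chi> j. x N j (\<iota> j))) - (\<Sum>\<iota>\<in>J. P N \<iota> * (if \<iota> \<in> J0 then f y else 0))"
      by (simp add: R_def right_diff_distrib sum_subtractf)
    also have "(\<Sum>\<iota>\<in>J. P N \<iota> * (if \<iota> \<in> J0 then f y else 0)) = (\<Sum>\<iota>\<in>J0. P N \<iota> * f y)"
      using fin by (intro sum.mono_neutral_cong_right) auto
    also have "\<dots> = f y" using one[of N] by (simp flip: sum_distrib_right)
    finally show ?thesis .
  qed
  ultimately show ?thesis unfolding T by (simp add: LIM_zero_iff)
qed

section \<open>The Faber--Schauder series as a sum of hat series\<close>

definition bscale :: "('n \<Rightarrow> int) \<Rightarrow> 'n \<Rightarrow> real" where "bscale s j = 2 powi s j"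

definition boff :: "('n \<Rightarrow> int) \<Rightarrow> 'n \<Rightarrow> real" where "boff s j = 2 * shift (s j + 1) + 1"

definition bcell :: "('n \<Rightarrow> int) \<Rightarrow> real ^ 'n \<Rightarrow> 'n \<Rightarrow> int" where "bcell s y j = cell (s j + 1) (y $ j)"

lemma faber_partial_sum:
  fixes f :: "real ^ 'n::finite \<Rightarrow> complex"
  shows "tensor (\<lambda>j z. interp (- int N) (y $ j) z - interp (int N + 1) (y $ j) z) f =
    (\<Sum>s\<in>PiE UNIV (\<lambda>_. {- int N..int N}). coef f s (bcell s y) * hats (bscale s) (boff s) (bcell s y) y)"
proof -
  have "tensor (\<lambda>j z. interp (- int N) (y $ j) z - interp (int N + 1) (y $ j) z) f =
    (\<Sum>\<sigma>\<in>PiE UNIV (\<lambda>_. {- int N..int N}). (\<Prod>j\<in>UNIV. complex_of_real (hat (y $ j / 2 powi (\<sigma> j) - (2 * real_of_int (cell (\<sigma> j + 1) (y $ j)) + (2 * shift (\<sigma> j + 1) + 1)))))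
      * tensor (\<lambda>j. second_diff (\<sigma> j) (cell (\<sigma> j + 1) (y $ j))) f)"
    by (rule tensor_sum) (auto simp: fin_supp_second_diff interp_telescope[symmetric] interp_diff)
  also have "\<dots> = (\<Sum>s\<in>PiE UNIV (\<lambda>_. {- int N..int N}). coef f s (bcell s y) * hats (bscale s) (boff s) (bcell s y) y)"
    by (simp add: coef_def hats_def bcell_def[abs_def] bscale_def boff_def mult.commute)
  finally show ?thesis .
qed

lemma hats_other_cell:
  fixes y :: "real ^ 'n::finite"
  assumes "k \<noteq> bcell s y"
  shows "hats (bscale s) (boff s) k y = 0"
proof -
  obtain j where "k j \<noteq> cell (s j + 1) (y $ j)" using assms by (auto simp: bcell_def fun_eq_iff)
  then have "hat (y $ j / bscale s j - (2 * real_of_int (k j) + boff s j)) = 0"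
    unfolding bscale_def boff_def by (rule hat_other_cell)
  then show ?thesis unfolding hats_def by (auto intro: prod_zero)
qed

lemma A_bdd_norm_le:
  assumes "A_bdd C F" shows "norm (F y) \<le> C"
proof -
  obtain g where g: "integrable lborel g" "(\<integral>x. norm (g x) \<partial>lborel) \<le> C"
     "F y = (\<integral>x. g x * exp (\<i> * complex_of_real (x \<bullet> y)) \<partial>lborel)" using assms by (auto simp: A_bdd_def)
  have "norm (F y) \<le> (\<integral>x. norm (g x * exp (\<i> * complex_of_real (x \<bullet> y))) \<partial>lborel)"
    unfolding g(3) by (rule integral_norm_bound)
  then show ?thesis using g(2) by (simp add: norm_mult)
qed

text \<open>At a fixed \<open>y\<close> only the cell containing \<open>y\<close> contributes on
  each level, so a hat series reduces to one term there. The sup norm is bounded by the norm of A,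
  so the series of levels converges absolutely and its sum may be computed along cubes of
  levels.\<close>

theorem A_space_if_coef_summable:
  fixes f :: "real ^ 'n::finite \<Rightarrow> complex"
  assumes f: "f \<in> C0"
    and fin: "(\<integral>\<^sup>+s. ennsqrt (\<integral>\<^sup>+k. ennreal ((norm (coef f s k))\<^sup>2) \<partial>count_space UNIV) \<partial>count_space UNIV) < \<infinity>"
  shows "f \<in> A_space"
proof -
  define q where "q s = (\<integral>\<^sup>+k. ennreal ((norm (coef f s k))\<^sup>2) \<partial>count_space UNIV)" for s
  have inf: "infinite (UNIV :: ('n \<Rightarrow> int) set)"
  proof
    assume "finite (UNIV :: ('n \<Rightarrow> int) set)"
    moreover have "inj (\<lambda>i::int. \<lambda>_::'n. i)" by (auto simp: inj_on_def fun_eq_iff)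
    ultimately have "finite (UNIV :: int set)" by (metis finite_imageD finite_subset subset_UNIV)
    then show False by simp
  qed
  \<comment> \<open>The same enumeration serves twice: for the cells of a level and for the levels
    themselves.\<close>
  define e :: "nat \<Rightarrow> 'n \<Rightarrow> int" where "e = from_nat_into UNIV"
  have e: "bij e" unfolding e_def using bij_betw_from_nat_into[OF _ inf] by simp
  have sqfin: "ennsqrt (q s) < \<infinity>" for s
  proof -
    have "ennsqrt (q s) \<le> (\<integral>\<^sup>+s. ennsqrt (q s) \<partial>count_space UNIV)"
      by (rule nn_integral_ge_point) simp
    also have "\<dots> < \<infinity>" using fin by (simp add: q_def)
    finally show ?thesis .
  qed
  define N where "N s = sqrt (enn2real (q s))" for s
  have N0: "N s \<ge> 0" for s by (simp add: N_def)
  have qfin: "q s \<noteq> \<infinity>" for s using sqfin[of s] by (auto simp: ennsqrt_def split: if_splits)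
  then have qN: "ennsqrt (q s) = ennreal (N s)" for s by (simp add: ennsqrt_def N_def)
  define F where "F s y = coef f s (bcell s y) * hats (bscale s) (boff s) (bcell s y) y" for s y
  have AF: "A_bdd (2 * N s) (F s)" for s
  proof (rule A_bdd_hats[where \<kappa>=e and c="\<lambda>i. coef f s (e i)" and h="bscale s" and o'="boff s"])
    show "inj e" using e by (rule bij_is_inj)
    have qs: "q s = (\<Sum>i. ennreal ((norm (coef f s (e i)))\<^sup>2))"
      unfolding q_def by (subst nn_integral_bij_count_space[OF e, symmetric]) (simp add: nn_integral_count_space_nat)
    have sf: "(\<Sum>i. ennreal ((norm (coef f s (e i)))\<^sup>2)) \<noteq> top" using qfin[of s] unfolding qs infinity_ennreal_def .
    show sm: "summable (\<lambda>i. (norm (coef f s (e i)))\<^sup>2)" using sf by (intro summable_suminf_not_top) auto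
    have "q s = ennreal (\<Sum>i. (norm (coef f s (e i)))\<^sup>2)"
      unfolding qs using sf by (intro suminf_ennreal) auto
    then show "(\<Sum>i. (norm (coef f s (e i)))\<^sup>2) \<le> (N s)\<^sup>2"
      using sm by (simp add: N_def suminf_nonneg)
    fix y
    obtain i0 where i0: "e i0 = bcell s y" using e by (metis bij_pointE)
    have "(\<lambda>i. if i = i0 then F s y else 0) sums F s y" by (rule sums_single)
    moreover have "coef f s (e i) * complex_of_real (hats (bscale s) (boff s) (e i) y) = (if i = i0 then F s y else 0)" for i
    proof (cases "i = i0")
      case False
      then have "e i \<noteq> bcell s y" using i0 bij_is_inj[OF e] by (metis injD)
      then show ?thesis using False by (simp add: hats_other_cell)
    qed (simp add: i0 F_def)
    ultimately show "(\<lambda>i. coef f s (e i) * complex_of_real (hats (bscale s) (boff s) (e i) y)) sums F s y" by simp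
  qed (use N0 in \<open>auto simp: bscale_def\<close>)
  have "(\<Sum>i. ennreal (N (e i))) = (\<integral>\<^sup>+s. ennsqrt (q s) \<partial>count_space UNIV)"
    unfolding qN by (subst nn_integral_bij_count_space[OF e, symmetric]) (simp add: nn_integral_count_space_nat)
  then have "(\<Sum>i. ennreal (N (e i))) \<noteq> top" using fin by (simp add: q_def)
  then have sN: "summable (\<lambda>i. N (e i))" using N0 by (intro summable_suminf_not_top) auto
  have "A_bdd (\<Sum>i. 2 * N (e i)) f"
  proof (rule A_bdd_suminf[OF AF])
    show "summable (\<lambda>i. 2 * N (e i))" using sN by (rule summable_mult)
    fix y
    have "summable (\<lambda>i. norm (F (e i) y))"
      by (rule summable_comparison_test'[OF summable_mult[OF sN, of 2], of 0]) (use A_bdd_norm_le[OF AF] in auto)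
    then have "(\<lambda>i. F (e i) y) summable_on UNIV" by (rule norm_summable_imp_summable_on)
    then obtain S where S: "((\<lambda>i. F (e i) y) has_sum S) UNIV" by (auto simp: summable_on_def)
    then have "((\<lambda>s. F s y) has_sum S) UNIV"
      using has_sum_reindex_bij_betw[OF e, of "\<lambda>s. F s y"] by simp
    then have lim: "(sum (\<lambda>s. F s y) \<longlongrightarrow> S) (finite_subsets_at_top UNIV)" by (simp add: has_sum_def)
    \<comment> \<open>The cubes exhaust the set of levels; for them the partial sums are known from
      telescoping.\<close>
    have "filterlim (\<lambda>N. PiE UNIV (\<lambda>_. {- int N..int N}) :: ('n \<Rightarrow> int) set) (finite_subsets_at_top UNIV) sequentially"
      unfolding filterlim_finite_subsets_at_top
    proof (intro allI impI)
      fix X :: "('n \<Rightarrow> int) set" assume X: "finite X \<and> X \<subseteq> UNIV"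
      define M where "M = Max (insert 0 ((\<lambda>(s,j). nat \<bar>s j\<bar>) ` (X \<times> UNIV)))"
      have M: "nat \<bar>s j\<bar> \<le> M" if "s \<in> X" for s j
        unfolding M_def using X that by (intro Max_ge) (auto intro!: finite_imageI finite_cartesian_product)
      show "\<forall>\<^sub>F N in sequentially. finite (PiE UNIV (\<lambda>_. {- int N..int N}) :: ('n \<Rightarrow> int) set) \<and> X \<subseteq> PiE UNIV (\<lambda>_. {- int N..int N}) \<and> PiE UNIV (\<lambda>_. {- int N..int N}) \<subseteq> (UNIV :: ('n \<Rightarrow> int) set)"
        using eventually_ge_at_top[of M]
      proof (rule eventually_mono, intro conjI)
        fix N assume "M \<le> N"
        then have "s j \<in> {- int N..int N}" if "s \<in> X" for s j using M[OF that, of j] by auto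
        then show "X \<subseteq> PiE UNIV (\<lambda>_. {- int N..int N})" by (auto simp: PiE_iff)
      qed (auto intro: finite_PiE)
    qed
    from filterlim_compose[OF lim this]
    have "(\<lambda>N. \<Sum>s\<in>PiE UNIV (\<lambda>_. {- int N..int N}). F s y) \<longlonglongrightarrow> S" .
    moreover have "(\<lambda>N. \<Sum>s\<in>PiE UNIV (\<lambda>_. {- int N..int N}). F s y) \<longlonglongrightarrow> f y"
      using tensor_interp_tendsto[OF f, of y] unfolding faber_partial_sum F_def .
    ultimately have "S = f y" by (rule LIMSEQ_unique)
    then show "(\<lambda>i. F (e i) y) sums f y" using S has_sum_imp_sums by blast
  qed
  then show ?thesis by (rule A_bdd_imp_A_space)
qed

section \<open>Coefficients as sums of mixed differences\<close>

text \<open>\<open>KX\<close>, \<open>KH\<close>, \<open>KZ\<close> mark the coordinates that belong to \<open>\<chi>\<close>, \<open>\<eta>\<close>, \<open>\<zeta>\<close>.\<close>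

datatype kind = KX | KH | KZ

text \<open>Dyadic order of the distance from the cell to 0, in units of the cell length. On every
  level the cell containing 0 is number -1, for which the argument 1 is a placeholder; the
  neighbours 0 and -2 have octave 0.\<close>

definition octave :: "int \<Rightarrow> nat" where
  "octave k = floor_log (nat (if k \<ge> 0 then k + 1 else if k = -1 then 1 else - k - 1))"

text \<open>
  The switch between \<open>KZ\<close> and \<open>KH\<close> for small \<open>s\<close>. With \<open>tau s\<close> about \<open>- s / 2\<close>, the \<open>\<ell>\<^sup>2\<close> weight
  \<open>sqrt (2 powi (tau s + s))\<close> of the derivative bound decays geometrically as \<open>s\<close> tends to \<open>-\<infinity>\<close>, while
  each value of \<open>tau s\<close> is attained only twice.
\<close>

definition tau :: "int \<Rightarrow> int" where "tau s = (5 - s) div 2"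

definition node :: "int \<Rightarrow> int \<Rightarrow> int \<Rightarrow> real" where
  "node s k i = mid s k + real_of_int i * 2 powi s"

text \<open>The second component is the scale at which the integrals are entered. The threshold 4 is
  the least \<open>s\<close> with \<open>s - 3 \<ge> 1\<close>, and \<open>tau s \<ge> 1\<close> for
  \<open>s < 4\<close>, so the scales of \<open>KX\<close> and \<open>KH\<close> belong to
  \<open>u > 1\<close>. For \<open>KZ\<close> the scale is capped at 0 because \<open>x < 1\<close>;
  lowering it only enlarges the majorants. For \<open>KH\<close> it is a strict lower bound for the
  position \<open>s - 2 + octave k\<close>, as \<open>u\<close> is for the inner integration
  variable.\<close>

definition kindof :: "int \<Rightarrow> int \<Rightarrow> kind \<times> int" where
  "kindof s k = (if s \<ge> 4 then (if k = -1 then (KX, s - 2) else (KH, s - 3))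
     else if s - 2 + int (octave k) \<le> tau s then (KZ, min (s - 2 + int (octave k)) 0) else (KH, tau s))"

definition special :: "int \<Rightarrow> int \<Rightarrow> bool" where "special s k \<longleftrightarrow> s < 4 \<and> k = -1"

text \<open>
  The value \<open>(1, 1)\<close> is an absent piece: a difference over it vanishes. In the special cell, which
  contains \<open>0\<close>, each node is joined to \<open>0\<close> through the points obtained by halving it; the limits at
  \<open>0\<close> cancel because the coefficients \<open>1, - 1/2, - 1/2\<close> of a second difference sum to \<open>0\<close>.
\<close>

definition piece :: "int \<Rightarrow> int \<Rightarrow> int \<times> kind \<times> int \<Rightarrow> real \<times> real" where
  "piece s k = (\<lambda>(i, kd, m).
     if i \<notin> {-1, 0, 1} then (1, 1)
     else if special s k then
       (if kd = KZ \<and> m \<le> s - 3 then (node s k i * 2 powi (m + 2 - s), node s k i * 2 powi (m + 3 - s)) else (1, 1))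
     else if kindof s k = (kd, m) then (mid s k, node s k i) else (1, 1))"

section \<open>Position of the nodes relative to 0\<close>

lemma node_eq: "node s k i = 2 powi s * (2 * real_of_int k + 2 * shift (s + 1) + 1 + real_of_int i)"
  by (simp add: node_def mid_def algebra_simps)

lemma shift_cases: "shift s = 1 / 3 \<or> shift s = 2 / 3" by (simp add: shift_def)

text \<open>Twice a shift is 2/3 or 4/3, so a node is at least a third of the mesh away from 0; a
  quarter turns the bound into a power of two.\<close>

lemma node_abs_ge: "2 powi (s - 2) \<le> \<bar>node s k i\<bar>"
proof -
  have "1 / 3 \<le> \<bar>2 * real_of_int k + 2 * shift (s + 1) + 1 + real_of_int i\<bar>"
  proof (cases "2 * k + 1 + i \<ge> 0")
    case True
    then have "2 * real_of_int k + 1 + real_of_int i \<ge> 0" by linarith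
    then show ?thesis using shift_cases[of "s + 1"] by auto
  next
    case False
    then have "2 * k + 1 + i = -1 \<or> 2 * k + 1 + i \<le> -2" by linarith
    then have "2 * real_of_int k + 1 + real_of_int i = -1 \<or> 2 * real_of_int k + 1 + real_of_int i \<le> -2" by linarith
    then show ?thesis using shift_cases[of "s + 1"] by (auto simp: abs_if)
  qed
  then have "2 powi s * (1 / 3) \<le> 2 powi s * \<bar>2 * real_of_int k + 2 * shift (s + 1) + 1 + real_of_int i\<bar>"
    by (intro mult_left_mono) auto
  moreover have "2 powi (s - 2) = (2 powi s :: real) * (1 / 4)" by (simp add: power_int_diff)
  moreover have "(2::real) powi s * (1 / 4) \<le> 2 powi s * (1 / 3)" by (intro mult_left_mono) auto
  ultimately have "2 powi (s - 2) \<le> 2 powi s * \<bar>2 * real_of_int k + 2 * shift (s + 1) + 1 + real_of_int i\<bar>" by linarith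
  then show ?thesis by (simp add: node_eq abs_mult)
qed

lemma node_mid: "node s k 0 = mid s k" by (simp add: node_def)

lemma two_power_octave:
  assumes "k \<noteq> -1"
  shows "2 ^ octave k \<le> (if k \<ge> 0 then real_of_int k + 1 else - real_of_int k - 1)"
proof -
  define n where "n = nat (if k \<ge> 0 then k + 1 else - k - 1)"
  have n: "n > 0" "real n = (if k \<ge> 0 then real_of_int k + 1 else - real_of_int k - 1)" using assms by (auto simp: n_def)
  have "octave k = floor_log n" using assms by (simp add: octave_def n_def)
  then have "2 ^ octave k \<le> n" using floor_log_exp2_le[OF n(1)] by simp
  then have "real (2 ^ octave k) \<le> real n" by (rule of_nat_mono)
  then show ?thesis using n(2) by simp
qed

text \<open>Outside the cell of 0 all three nodes lie on the same side of 0, so the segments joining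
  them avoid it and derivatives may be used.\<close>

lemma node_far:
  assumes k: "k \<noteq> -1" and i: "i \<in> {-1, 0, 1}"
  shows "2 powi (s - 2 + int (octave k)) \<le> \<bar>node s k i\<bar>" "0 < node s k i * (if k \<ge> 0 then 1 else -1)"
proof -
  let ?c = "2 * real_of_int k + 2 * shift (s + 1) + 1 + real_of_int i"
  have b: "2 ^ octave k \<le> (if k \<ge> 0 then real_of_int k + 1 else - real_of_int k - 1)" by (rule two_power_octave[OF k])
  have i': "real_of_int i \<ge> -1" "real_of_int i \<le> 1" using i by auto
  have c: "2 ^ octave k / 4 \<le> ?c * (if k \<ge> 0 then 1 else -1)"
  proof (cases "k \<ge> 0")
    case True
    then show ?thesis using b i' shift_cases[of "s + 1"] by auto
  next
    case False
    then have "k \<le> -2" using k by linarith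
    then have "real_of_int k \<le> -2" by linarith
    then show ?thesis using False b i' shift_cases[of "s + 1"] by auto
  qed
  have p: "2 powi (s - 2 + int (octave k)) = 2 powi s * (2 ^ octave k / 4 :: real)"
    by (simp add: power_int_add power_int_diff)
  have c0: "0 < ?c * (if k \<ge> 0 then 1 else -1)" by (rule less_le_trans[OF _ c]) simp
  have n: "node s k i * (if k \<ge> 0 then 1 else -1) = 2 powi s * (?c * (if k \<ge> 0 then 1 else -1))" by (simp add: node_eq)
  show "0 < node s k i * (if k \<ge> 0 then 1 else -1)" unfolding n by (rule mult_pos_pos[OF _ c0]) simp
  have "2 powi s * (2 ^ octave k / 4) \<le> 2 powi s * (?c * (if k \<ge> 0 then 1 else -1))" using c by (intro mult_left_mono) auto
  then have "2 powi (s - 2 + int (octave k)) \<le> node s k i * (if k \<ge> 0 then 1 else -1)" unfolding p n .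
  also have "\<dots> \<le> \<bar>node s k i\<bar>" by (auto simp: abs_if)
  finally show "2 powi (s - 2 + int (octave k)) \<le> \<bar>node s k i\<bar>" .
qed

lemma node_special_le:
  assumes "i \<in> {-1, 0, 1}"
  shows "\<bar>node s (-1) i\<bar> \<le> 2 powi (s + 1)"
proof -
  have "\<bar>2 * shift (s + 1) - 1 + real_of_int i\<bar> \<le> 2" using shift_cases[of "s + 1"] assms by auto
  then have "2 powi s * \<bar>2 * shift (s + 1) - 1 + real_of_int i\<bar> \<le> 2 powi s * 2" by (intro mult_left_mono) auto
  then show ?thesis by (simp add: node_eq abs_mult power_int_add)
qed

section \<open>Decomposition of second differences into increments\<close>

definition node_coef :: "int \<Rightarrow> real" where "node_coef i = (if i = 0 then 1 else - 1 / 2)"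

definition pieces_upto :: "nat \<Rightarrow> int \<Rightarrow> int \<Rightarrow> (int \<times> kind \<times> int) set" where
  "pieces_upto L s k = (if special s k then {-1, 0, 1} \<times> ({KZ} \<times> {s - 3 - int L<..s - 3})
     else {-1, 0, 1} \<times> {kindof s k})"

lemma finite_pieces_upto: "finite (pieces_upto L s k)" by (simp add: pieces_upto_def)

text \<open>The end of the truncated chain that starts at a node. In a regular cell it is
  \<open>mid s k\<close> for all three nodes, so it cancels at once.\<close>

definition refpt :: "nat \<Rightarrow> int \<Rightarrow> int \<Rightarrow> int \<Rightarrow> real" where
  "refpt L s k i = (if special s k then node s k i * 2 powi (- int L) else mid s k)"

lemma piece_telescope:
  fixes x :: real
  shows "(\<Sum>m\<in>{s - 3 - int L<..s - 3}. atom (x * 2 powi (m + 3 - s)) z - atom (x * 2 powi (m + 2 - s)) z) = atom x z - atom (x * 2 powi (- int L)) z"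
proof (induction L)
  case (Suc L)
  have "{s - 3 - int (Suc L)<..s - 3} = insert (s - 3 - int L) {s - 3 - int L<..s - 3}" by auto
  then have "(\<Sum>m\<in>{s - 3 - int (Suc L)<..s - 3}. atom (x * 2 powi (m + 3 - s)) z - atom (x * 2 powi (m + 2 - s)) z) =
     (atom (x * 2 powi (- int L)) z - atom (x * 2 powi (- 1 - int L)) z) + (atom x z - atom (x * 2 powi (- int L)) z)"
    using Suc by (simp add: algebra_simps)
  moreover have "- int (Suc L) = - 1 - int L" by simp
  ultimately show ?case by (simp only:)
qed simp

lemma sum_pieces_upto:
  "(\<Sum>(i, q)\<in>pieces_upto L s k. node_coef i * (atom (snd (piece s k (i, q))) z - atom (fst (piece s k (i, q))) z)) =
    (\<Sum>i\<in>{-1, 0, 1}. node_coef i * (atom (node s k i) z - atom (refpt L s k i) z))"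
proof (cases "special s k")
  case True
  have "(\<Sum>(i, q)\<in>pieces_upto L s k. node_coef i * (atom (snd (piece s k (i, q))) z - atom (fst (piece s k (i, q))) z)) =
    (\<Sum>i\<in>{-1, 0, 1}. \<Sum>q\<in>{KZ} \<times> {s - 3 - int L<..s - 3}. node_coef i * (atom (snd (piece s k (i, q))) z - atom (fst (piece s k (i, q))) z))"
    using True by (simp only: pieces_upto_def if_True sum.cartesian_product)
  also have "\<dots> = (\<Sum>i\<in>{-1, 0, 1}. \<Sum>kd\<in>{KZ}. \<Sum>m\<in>{s - 3 - int L<..s - 3}. node_coef i * (atom (snd (piece s k (i, kd, m))) z - atom (fst (piece s k (i, kd, m))) z))"
    unfolding sum.cartesian_product by (rule sum.cong[OF refl]) auto
  also have "\<dots> = (\<Sum>i\<in>{-1, 0, 1}. \<Sum>m\<in>{s - 3 - int L<..s - 3}. node_coef i * (atom (node s k i * 2 powi (m + 3 - s)) z - atom (node s k i * 2 powi (m + 2 - s)) z))"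
    by (rule sum.cong[OF refl]) (use True in \<open>auto simp: piece_def intro!: sum.cong\<close>)
  also have "\<dots> = (\<Sum>i\<in>{-1, 0, 1}. node_coef i * (atom (node s k i) z - atom (refpt L s k i) z))"
    using True by (simp add: sum_distrib_left[symmetric] piece_telescope refpt_def)
  finally show ?thesis .
next
  case False
  have "(\<Sum>(i, q)\<in>pieces_upto L s k. node_coef i * (atom (snd (piece s k (i, q))) z - atom (fst (piece s k (i, q))) z)) =
    (\<Sum>i\<in>{-1, 0, 1}. \<Sum>q\<in>{kindof s k}. node_coef i * (atom (snd (piece s k (i, q))) z - atom (fst (piece s k (i, q))) z))"
    using False by (simp only: pieces_upto_def if_False sum.cartesian_product)
  also have "\<dots> = (\<Sum>i\<in>{-1, 0, 1}. node_coef i * (atom (node s k i) z - atom (refpt L s k i) z))"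
    by (rule sum.cong[OF refl]) (use False in \<open>auto simp: piece_def refpt_def split: prod.splits\<close>)
  finally show ?thesis .
qed

lemma mdiff_eq_tensor:
  fixes p :: "'n::finite \<Rightarrow> real \<times> real"
  shows "mdiff UNIV p f w = tensor (\<lambda>j z. atom (snd (p j)) z - atom (fst (p j)) z) f"
proof -
  define c where "c b = (if b then -1 else 1 :: real)" for b
  have "tensor (\<lambda>j z. atom (snd (p j)) z - atom (fst (p j)) z) f =
     (\<Sum>\<iota>\<in>PiE UNIV (\<lambda>_. UNIV). (\<Prod>j\<in>UNIV. complex_of_real (c (\<iota> j))) * f (\<chi> j. if \<iota> j then fst (p j) else snd (p j)))"
    by (rule tensor_atoms) (auto simp: UNIV_bool c_def)
  also have "\<dots> = (\<Sum>S\<in>Pow UNIV. (-1) ^ card S * f (patch UNIV (corner p S) w))"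
  proof (rule sum.reindex_bij_witness[of _ "\<lambda>S j. j \<in> S" "\<lambda>\<iota>. {j. \<iota> j}"])
    fix \<iota> :: "'n \<Rightarrow> bool"
    have "(\<Prod>j\<in>UNIV. complex_of_real (c (\<iota> j))) = (\<Prod>j\<in>{j. \<iota> j}. -1)"
      by (rule prod.mono_neutral_cong_right) (auto simp: c_def)
    moreover have "patch UNIV (corner p {j. \<iota> j}) w = (\<chi> j. if \<iota> j then fst (p j) else snd (p j))"
      by (simp add: vec_eq_iff corner_def)
    ultimately show "(-1) ^ card {j. \<iota> j} * f (patch UNIV (corner p {j. \<iota> j}) w)
      = (\<Prod>j\<in>UNIV. complex_of_real (c (\<iota> j))) * f (\<chi> j. if \<iota> j then fst (p j) else snd (p j))" by simp
  qed auto
  finally show ?thesis by (simp add: mdiff_def)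
qed

text \<open>The truncated chains give finite sums whose norms are bounded uniformly in
  \<open>L\<close>, and the coefficient is their limit. Convergence of the full sum of pieces is
  thereby avoided: if it diverges, the bound is trivial.\<close>

lemma coef_le_pieces:
  fixes f :: "real ^ 'n::finite \<Rightarrow> complex"
  assumes cont: "continuous_on UNIV f"
  shows "ennreal (norm (coef f s k)) \<le> (\<integral>\<^sup>+\<kappa>. ennreal (norm (mdiff UNIV (\<lambda>j. piece (s j) (k j) (\<kappa> j)) f 0)) \<partial>count_space UNIV)"
    (is "_ \<le> ?B")
proof -
  define a where "a L j z = (\<Sum>(i, q)\<in>pieces_upto L (s j) (k j). node_coef i * (atom (snd (piece (s j) (k j) (i, q))) z - atom (fst (piece (s j) (k j) (i, q))) z))" for L j z
  have le: "ennreal (norm (tensor (a L) f)) \<le> ?B" for L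
  proof -
    define K where "K = PiE (UNIV :: 'n set) (\<lambda>j. pieces_upto L (s j) (k j))"
    have finK: "finite K" unfolding K_def by (intro finite_PiE finite_pieces_upto) auto
    have fs: "fin_supp (\<lambda>z. atom x z - atom y z)" for x y
      unfolding fin_supp_def by (rule finite_subset[of _ "{x, y}"]) (auto simp: atom_def)
    have "tensor (a L) f = (\<Sum>\<sigma>\<in>K. (\<Prod>j\<in>UNIV. complex_of_real (node_coef (fst (\<sigma> j)))) *
       tensor (\<lambda>j z. atom (snd (piece (s j) (k j) (\<sigma> j))) z - atom (fst (piece (s j) (k j) (\<sigma> j))) z) f)"
      unfolding K_def by (rule tensor_sum) (auto simp: finite_pieces_upto fs a_def case_prod_beta)
    also have "norm \<dots> \<le> (\<Sum>\<sigma>\<in>K. norm (mdiff UNIV (\<lambda>j. piece (s j) (k j) (\<sigma> j)) f 0))"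
    proof (rule sum_norm_le)
      fix \<sigma> :: "'n \<Rightarrow> int \<times> kind \<times> int"
      have "norm (\<Prod>j\<in>UNIV. complex_of_real (node_coef (fst (\<sigma> j)))) = (\<Prod>j\<in>UNIV. \<bar>node_coef (fst (\<sigma> j))\<bar>)" by (simp flip: prod_norm)
      also have "\<dots> \<le> 1" by (rule prod_le_1) (auto simp: node_coef_def)
      finally show "norm ((\<Prod>j\<in>UNIV. complex_of_real (node_coef (fst (\<sigma> j)))) *
         tensor (\<lambda>j z. atom (snd (piece (s j) (k j) (\<sigma> j))) z - atom (fst (piece (s j) (k j) (\<sigma> j))) z) f)
         \<le> norm (mdiff UNIV (\<lambda>j. piece (s j) (k j) (\<sigma> j)) f 0)"
        by (simp add: mdiff_eq_tensor norm_mult mult_left_le_one_le)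
    qed
    finally have "ennreal (norm (tensor (a L) f)) \<le> (\<Sum>\<sigma>\<in>K. ennreal (norm (mdiff UNIV (\<lambda>j. piece (s j) (k j) (\<sigma> j)) f 0)))"
      by (simp add: ennreal_leI sum_ennreal)
    also have "\<dots> = (\<integral>\<^sup>+\<kappa>. ennreal (norm (mdiff UNIV (\<lambda>j. piece (s j) (k j) (\<kappa> j)) f 0)) * indicator K \<kappa> \<partial>count_space UNIV)"
      by (simp add: nn_integral_count_space_indicator[symmetric] nn_integral_count_space_finite[OF finK])
    also have "\<dots> \<le> ?B" by (intro nn_integral_mono) (auto simp: indicator_def)
    finally show ?thesis .
  qed
  define I where "I = {-1, 0, 1::int} \<times> (UNIV :: bool set)"
  define c where "c = (\<lambda>(i, b). if b then node_coef i else - node_coef i)"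
  define x where "x L j = (\<lambda>(i, b). if b then node (s j) (k j) i else refpt L (s j) (k j) i)" for L j
  \<comment> \<open>Limit positions: the end of a chain tends to 0, and every other point does not
    depend on \<open>L\<close>.\<close>
  define x' where "x' j = (\<lambda>(i, b). if b then node (s j) (k j) i else if special (s j) (k j) then 0 else mid (s j) (k j))" for j
  have sumI: "(\<Sum>\<iota>\<in>I. g \<iota>) = (\<Sum>i\<in>{-1, 0, 1}. g (i, True) + g (i, False))" for g :: "int \<times> bool \<Rightarrow> real"
  proof -
    have "(\<Sum>\<iota>\<in>I. g \<iota>) = (\<Sum>i\<in>{-1, 0, 1}. \<Sum>b\<in>UNIV. g (i, b))"
      unfolding I_def sum.cartesian_product by (rule sum.cong[OF refl]) auto
    then show ?thesis by (simp add: UNIV_bool add.commute)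
  qed
  have aL: "tensor (a L) f = (\<Sum>\<iota>\<in>PiE UNIV (\<lambda>_. I). (\<Prod>j\<in>UNIV. complex_of_real (c (\<iota> j))) * f (\<chi> j. x L j (\<iota> j)))" for L
  proof (rule tensor_atoms)
    show "finite I" by (simp add: I_def)
    show "a L j z = (\<Sum>i\<in>I. c i * atom (x L j i) z)" for j z
      unfolding a_def sum_pieces_upto sumI by (simp add: c_def x_def algebra_simps)
  qed
  have "coef f s k = (\<Sum>\<iota>\<in>PiE UNIV (\<lambda>_. I). (\<Prod>j\<in>UNIV. complex_of_real (c (\<iota> j))) * f (\<chi> j. x' j (\<iota> j)))"
    unfolding coef_def
  proof (rule tensor_atoms)
    show "finite I" by (simp add: I_def)
    show "second_diff (s j) (k j) z = (\<Sum>i\<in>I. c i * atom (x' j i) z)" for j z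
      unfolding sumI by (simp add: c_def x'_def second_diff_def node_coef_def node_def algebra_simps)
  qed
  moreover have "(\<lambda>L. tensor (a L) f) \<longlonglongrightarrow> (\<Sum>\<iota>\<in>PiE UNIV (\<lambda>_. I). (\<Prod>j\<in>UNIV. complex_of_real (c (\<iota> j))) * f (\<chi> j. x' j (\<iota> j)))"
    unfolding aL
  proof (intro tendsto_sum tendsto_mult tendsto_const)
    fix \<iota>
    have "(\<lambda>L. x L j (\<iota> j)) \<longlonglongrightarrow> x' j (\<iota> j)" for j
    proof (cases "\<not> snd (\<iota> j) \<and> special (s j) (k j)")
      case True
      have "(\<lambda>L. node (s j) (k j) (fst (\<iota> j)) * (1 / 2) ^ L) \<longlonglongrightarrow> node (s j) (k j) (fst (\<iota> j)) * 0"
        by (intro tendsto_mult tendsto_const LIMSEQ_realpow_zero) auto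
      moreover have "x L j (\<iota> j) = node (s j) (k j) (fst (\<iota> j)) * (1 / 2) ^ L" for L
      proof -
        have "(2::real) powi (- int L) = (1 / 2) ^ L" by (simp add: power_int_minus power_one_over inverse_eq_divide)
        then show ?thesis using True by (simp add: x_def refpt_def case_prod_beta)
      qed
      moreover have "x' j (\<iota> j) = 0" using True by (simp add: x'_def case_prod_beta)
      ultimately show ?thesis by simp
    next
      case False
      then show ?thesis by (auto simp: x_def x'_def refpt_def case_prod_beta)
    qed
    then have lim: "(\<lambda>L. \<chi> j. x L j (\<iota> j)) \<longlonglongrightarrow> (\<chi> j. x' j (\<iota> j))" by (rule tendsto_vec_lambda)
    have "isCont f (\<chi> j. x' j (\<iota> j))" using cont by (simp add: continuous_on_eq_continuous_at)
    from isCont_tendsto_compose[OF this lim] show "(\<lambda>L. f (\<chi> j. x L j (\<iota> j))) \<longlonglongrightarrow> f (\<chi> j. x' j (\<iota> j))" .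
  qed
  ultimately have "(\<lambda>L. ennreal (norm (tensor (a L) f))) \<longlonglongrightarrow> ennreal (norm (coef f s k))"
    by (intro tendsto_ennrealI tendsto_norm) simp
  then show ?thesis by (rule LIMSEQ_le_const2) (use le in auto)
qed

section \<open>Sums of extended reals over product index sets\<close>

lemma ennsqrt_ennreal: "x \<ge> 0 \<Longrightarrow> ennsqrt (ennreal x) = ennreal (sqrt x)"
  by (simp add: ennsqrt_def)

lemma ennsqrt_top [simp]: "ennsqrt top = top"
  by (simp add: ennsqrt_def)

lemma ennsqrt_0 [simp]: "ennsqrt 0 = 0"
  by (simp add: ennsqrt_def)

lemma ennsqrt_square: "ennsqrt (x ^ 2) = x"
proof (cases x)
  case (real r)
  then show ?thesis by (simp add: ennreal_power ennsqrt_ennreal)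
qed simp

lemma ennsqrt_power2: "(ennsqrt x) ^ 2 = x"
proof (cases x)
  case (real r)
  then show ?thesis by (simp add: ennreal_power ennsqrt_ennreal)
qed simp

lemma ennsqrt_mono: "x \<le> y \<Longrightarrow> ennsqrt x \<le> ennsqrt y"
proof (cases x; cases y)
  fix r q assume "x \<le> y" "x = ennreal r" "0 \<le> r" "y = ennreal q" "0 \<le> q"
  then show ?thesis by (simp add: ennsqrt_ennreal ennreal_le_iff)
qed (auto simp: top_unique)

lemma ennsqrt_mult: "ennsqrt (x * y) = ennsqrt x * ennsqrt y"
proof -
  have "ennsqrt (x * y) = ennsqrt ((ennsqrt x * ennsqrt y) ^ 2)" by (simp add: power_mult_distrib ennsqrt_power2)
  then show ?thesis by (simp add: ennsqrt_square)
qed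

lemma nn_integral_count_space_swap:
  "(\<integral>\<^sup>+x. \<integral>\<^sup>+y. g x y \<partial>count_space UNIV \<partial>count_space UNIV) = (\<integral>\<^sup>+y. \<integral>\<^sup>+x. g x y \<partial>count_space UNIV \<partial>count_space UNIV)"
  using nn_integral_fst_count_space[of "\<lambda>(x, y). g x y"] nn_integral_snd_count_space[of "\<lambda>(x, y). g x y"] by simp

text \<open>The square of the left-hand side is a double sum over \<open>i\<close> and
  \<open>l\<close>. Cauchy--Schwarz in \<open>k\<close> bounds each pair by
  \<open>N i * N l\<close>, and these products sum to the square of the right-hand side.\<close>

lemma minkowski_count_space:
  fixes a :: "'k \<Rightarrow> 'i \<Rightarrow> ennreal"
  shows "ennsqrt (\<integral>\<^sup>+k. (\<integral>\<^sup>+i. a k i \<partial>count_space UNIV)\<^sup>2 \<partial>count_space UNIV)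
    \<le> (\<integral>\<^sup>+i. ennsqrt (\<integral>\<^sup>+k. (a k i)\<^sup>2 \<partial>count_space UNIV) \<partial>count_space UNIV)"
proof -
  define N where "N i = ennsqrt (\<integral>\<^sup>+k. (a k i)\<^sup>2 \<partial>count_space UNIV)" for i
  have CS: "(\<integral>\<^sup>+k. a k i * a k l \<partial>count_space UNIV) \<le> N i * N l" for i l
  proof -
    have "(\<integral>\<^sup>+k. a k i * a k l \<partial>count_space UNIV)\<^sup>2 \<le> (\<integral>\<^sup>+k. (a k i)\<^sup>2 \<partial>count_space UNIV) * (\<integral>\<^sup>+k. (a k l)\<^sup>2 \<partial>count_space UNIV)"
      by (rule Cauchy_Schwarz_nn_integral) auto
    from ennsqrt_mono[OF this] show ?thesis by (simp add: ennsqrt_square ennsqrt_mult N_def)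
  qed
  have "(\<integral>\<^sup>+k. (\<integral>\<^sup>+i. a k i \<partial>count_space UNIV)\<^sup>2 \<partial>count_space UNIV)
      = (\<integral>\<^sup>+k. \<integral>\<^sup>+i. \<integral>\<^sup>+l. a k i * a k l \<partial>count_space UNIV \<partial>count_space UNIV \<partial>count_space UNIV)"
    by (simp add: power2_eq_square nn_integral_cmult nn_integral_multc)
  also have "\<dots> = (\<integral>\<^sup>+i. \<integral>\<^sup>+k. \<integral>\<^sup>+l. a k i * a k l \<partial>count_space UNIV \<partial>count_space UNIV \<partial>count_space UNIV)"
    by (rule nn_integral_count_space_swap)
  also have "\<dots> = (\<integral>\<^sup>+i. \<integral>\<^sup>+l. \<integral>\<^sup>+k. a k i * a k l \<partial>count_space UNIV \<partial>count_space UNIV \<partial>count_space UNIV)"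
    by (intro nn_integral_cong nn_integral_count_space_swap)
  also have "\<dots> \<le> (\<integral>\<^sup>+i. \<integral>\<^sup>+l. N i * N l \<partial>count_space UNIV \<partial>count_space UNIV)"
    by (intro nn_integral_mono CS)
  also have "\<dots> = (\<integral>\<^sup>+i. N i \<partial>count_space UNIV)\<^sup>2"
    by (simp add: power2_eq_square nn_integral_cmult nn_integral_multc)
  finally show ?thesis using ennsqrt_mono ennsqrt_square unfolding N_def by metis
qed

lemma nn_integral_count_space_prod:
  fixes w :: "'n::finite \<Rightarrow> 'i::countable \<Rightarrow> ennreal"
  shows "(\<integral>\<^sup>+\<sigma>. (\<Prod>j\<in>UNIV. w j (\<sigma> j)) \<partial>count_space UNIV) = (\<Prod>j\<in>UNIV. \<integral>\<^sup>+i. w j i \<partial>count_space UNIV)"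
proof -
  interpret product_sigma_finite "\<lambda>_::'n. count_space (UNIV :: 'i set)"
    by (intro product_sigma_finite.intro sigma_finite_measure_count_space_countable) auto
  have "PiM UNIV (\<lambda>_::'n. count_space (UNIV :: 'i set)) = count_space (PiE UNIV (\<lambda>_. UNIV))"
    by (rule count_space_PiM_finite) auto
  then have eq: "PiM UNIV (\<lambda>_::'n. count_space (UNIV :: 'i set)) = count_space UNIV" by simp
  show ?thesis
    using product_nn_integral_prod[of UNIV w] unfolding eq by simp
qed

lemma prod_indicator_singleton:
  fixes \<rho> :: "'n::finite \<Rightarrow> 'r"
  shows "(\<Prod>j\<in>UNIV. indicator {r j} (\<rho> j) :: ennreal) = indicator {r} \<rho>"
proof (cases "\<rho> = r")
  case False
  then obtain j where "\<rho> j \<noteq> r j" by auto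
  then have "\<exists>j\<in>UNIV. indicator {r j} (\<rho> j) = (0 :: ennreal)" by (intro bexI[of _ j]) auto
  then have "(\<Prod>j\<in>UNIV. indicator {r j} (\<rho> j) :: ennreal) = 0" by (intro prod_zero) auto
  then show ?thesis using False by simp
qed simp

text \<open>The factor \<open>G\<close> depends on \<open>k\<close> only through its labels, so
  grouping by label vectors splits the weights into one-dimensional sums, one for each
  coordinate.\<close>

lemma nn_integral_count_space_fibres:
  fixes w :: "'n::finite \<Rightarrow> 'i::countable \<Rightarrow> ennreal" and \<rho> :: "'n \<Rightarrow> 'i \<Rightarrow> 'r::countable"
  shows "(\<integral>\<^sup>+k. (\<Prod>j\<in>UNIV. w j (k j)) * G (\<lambda>j. \<rho> j (k j)) \<partial>count_space UNIV)
    = (\<integral>\<^sup>+r. (\<Prod>j\<in>UNIV. \<integral>\<^sup>+i. w j i * indicator {r j} (\<rho> j i) \<partial>count_space UNIV) * G r \<partial>count_space UNIV)"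
proof -
  have "(\<integral>\<^sup>+r. (\<Prod>j\<in>UNIV. \<integral>\<^sup>+i. w j i * indicator {r j} (\<rho> j i) \<partial>count_space UNIV) * G r \<partial>count_space UNIV)
    = (\<integral>\<^sup>+r. (\<integral>\<^sup>+k. (\<Prod>j\<in>UNIV. w j (k j) * indicator {r j} (\<rho> j (k j))) \<partial>count_space UNIV) * G r \<partial>count_space UNIV)"
    by (intro nn_integral_cong arg_cong2[where f="(*)"] nn_integral_count_space_prod[symmetric] refl)
  also have "\<dots> = (\<integral>\<^sup>+r. \<integral>\<^sup>+k. (\<Prod>j\<in>UNIV. w j (k j)) * G r * indicator {\<lambda>j. \<rho> j (k j)} r \<partial>count_space UNIV \<partial>count_space UNIV)"
  proof (rule nn_integral_cong)
    fix r
    have "(\<Prod>j\<in>UNIV. w j (k j) * indicator {r j} (\<rho> j (k j))) = (\<Prod>j\<in>UNIV. w j (k j)) * indicator {\<lambda>j. \<rho> j (k j)} r" for k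
      using prod_indicator_singleton[of r "\<lambda>j. \<rho> j (k j)"] by (simp add: prod.distrib) (auto simp: indicator_def)
    then show "(\<integral>\<^sup>+k. (\<Prod>j\<in>UNIV. w j (k j) * indicator {r j} (\<rho> j (k j))) \<partial>count_space UNIV) * G r
      = (\<integral>\<^sup>+k. (\<Prod>j\<in>UNIV. w j (k j)) * G r * indicator {\<lambda>j. \<rho> j (k j)} r \<partial>count_space UNIV)"
      by (simp add: nn_integral_cmult mult_ac)
  qed
  also have "\<dots> = (\<integral>\<^sup>+k. \<integral>\<^sup>+r. (\<Prod>j\<in>UNIV. w j (k j)) * G r * indicator {\<lambda>j. \<rho> j (k j)} r \<partial>count_space UNIV \<partial>count_space UNIV)"
    by (rule nn_integral_count_space_swap)
  also have "\<dots> = (\<integral>\<^sup>+k. (\<Prod>j\<in>UNIV. w j (k j)) * G (\<lambda>j. \<rho> j (k j)) \<partial>count_space UNIV)"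
  proof (rule nn_integral_cong)
    fix k
    show "(\<integral>\<^sup>+r. (\<Prod>j\<in>UNIV. w j (k j)) * G r * indicator {\<lambda>j. \<rho> j (k j)} r \<partial>count_space UNIV) = (\<Prod>j\<in>UNIV. w j (k j)) * G (\<lambda>j. \<rho> j (k j))"
      by (subst nn_integral_count_space_indicator[symmetric]) (auto simp: nn_integral_count_space_finite)
  qed
  finally show ?thesis by simp
qed

section \<open>Square sums over one level\<close>

lemma UNIV_kind: "(UNIV :: kind set) = {KX, KH, KZ}"
  using kind.exhaust by auto

instance kind :: finite
  by standard (simp add: UNIV_kind)

text \<open>The dyadic position at which the majorants are evaluated. For \<open>KH\<close> it
  varies with the cell, corresponding to the inner integration variable; for the other kinds it is
  the scale itself.\<close>

definition label_of :: "int \<Rightarrow> kind \<times> int \<Rightarrow> int \<Rightarrow> int" where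
  "label_of s q k = (if fst q = KH then s - 2 + int (octave k) else snd q)"

text \<open>A squared difference is bounded by the product of two estimates: a \<open>KZ\<close>
  coordinate is differentiated in both, a \<open>KH\<close> coordinate in one and a
  \<open>KX\<close> coordinate in neither. Hence the increment enters with exponent 2, 1 or 0, and
  for \<open>KH\<close> it is replaced by its bound \<open>2 powi s\<close>.\<close>

definition piece_weight :: "int \<Rightarrow> int \<times> kind \<times> int \<Rightarrow> int \<Rightarrow> real" where
  "piece_weight s \<kappa> k = (let p = piece s k \<kappa> in if fst p = snd p then 0 else
     (case fst (snd \<kappa>) of KX \<Rightarrow> 1 | KH \<Rightarrow> 2 powi s | KZ \<Rightarrow> (snd p - fst p)\<^sup>2))"

lemma piece_weight_nonneg: "0 \<le> piece_weight s \<kappa> k"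
  by (auto simp: piece_weight_def Let_def split: kind.split)

lemma kindof_cases:
  assumes "kindof s k = q"
  shows "(s \<ge> 4 \<and> k = -1 \<and> q = (KX, s - 2)) \<or> (s \<ge> 4 \<and> k \<noteq> -1 \<and> q = (KH, s - 3)) \<or>
    (s < 4 \<and> s - 2 + int (octave k) \<le> tau s \<and> q = (KZ, min (s - 2 + int (octave k)) 0)) \<or>
    (s < 4 \<and> s - 2 + int (octave k) > tau s \<and> q = (KH, tau s))"
  using assms by (auto simp: kindof_def split: if_splits)

lemma piece_cases:
  assumes nd: "fst (piece s k \<kappa>) \<noteq> snd (piece s k \<kappa>)"
  obtains (special) i m where "\<kappa> = (i, KZ, m)" "i \<in> {-1, 0, 1}" "s < 4" "k = -1" "m \<le> s - 3"
     "piece s k \<kappa> = (node s k i * 2 powi (m + 2 - s), node s k i * 2 powi (m + 3 - s))"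
  | (generic) i where "\<kappa> = (i, kindof s k)" "i \<in> {-1, 0, 1}" "\<not> special s k" "piece s k \<kappa> = (mid s k, node s k i)"
proof (cases \<kappa>)
  case (fields i kd m)
  show ?thesis
  proof (cases "special s k")
    case True
    then have "i \<in> {-1, 0, 1}" "kd = KZ" "m \<le> s - 3"
      using nd by (auto simp: piece_def fields split: if_splits)
    then show ?thesis using True by (intro special[of i m]) (auto simp: piece_def fields special_def)
  next
    case False
    then have "i \<in> {-1, 0, 1}" "kindof s k = (kd, m)"
      using nd by (auto simp: piece_def fields split: if_splits)
    then show ?thesis using False by (intro generic[of i]) (auto simp: piece_def fields)
  qed
qed

text \<open>Only a coarse cell around 0, of kind \<open>KX\<close>, may join nodes on opposite sides
  of 0, and there no derivative is taken.\<close>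

lemma piece_props:
  assumes nd: "fst (piece s k \<kappa>) \<noteq> snd (piece s k \<kappa>)"
  shows "2 powi (label_of s (snd \<kappa>) k) \<le> \<bar>fst (piece s k \<kappa>)\<bar>" (is ?A)
    "2 powi (label_of s (snd \<kappa>) k) \<le> \<bar>snd (piece s k \<kappa>)\<bar>" (is ?B)
    "fst (snd \<kappa>) \<noteq> KX \<Longrightarrow> 0 < fst (piece s k \<kappa>) * snd (piece s k \<kappa>)"
    "fst (snd \<kappa>) = KH \<Longrightarrow> \<bar>snd (piece s k \<kappa>) - fst (piece s k \<kappa>)\<bar> \<le> 2 powi s"
proof -
  have "?A \<and> ?B \<and> (fst (snd \<kappa>) \<noteq> KX \<longrightarrow> 0 < fst (piece s k \<kappa>) * snd (piece s k \<kappa>)) \<and>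
     (fst (snd \<kappa>) = KH \<longrightarrow> \<bar>snd (piece s k \<kappa>) - fst (piece s k \<kappa>)\<bar> \<le> 2 powi s)"
    using nd
  proof (cases rule: piece_cases)
    case (special i m)
    have n: "2 powi (s - 2) \<le> \<bar>node s k i\<bar>" by (rule node_abs_ge)
    moreover have "(0::real) < 2 powi (s - 2)" by simp
    ultimately have n0: "node s k i \<noteq> 0" by (metis abs_zero not_less)
    have 1: "(2::real) powi (s - 2) * 2 powi (m + 2 - s) = 2 powi m"
      by (simp flip: power_int_add)
    have 2: "(2::real) powi m \<le> \<bar>node s k i\<bar> * 2 powi (m + 2 - s)"
      unfolding 1[symmetric] using n by (intro mult_right_mono) auto
    also have "\<dots> \<le> \<bar>node s k i\<bar> * 2 powi (m + 3 - s)"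
      by (intro mult_left_mono power_int_increasing) auto
    finally have 3: "(2::real) powi m \<le> \<bar>node s k i\<bar> * 2 powi (m + 3 - s)" .
    have "0 < (node s k i)\<^sup>2 * (2 powi (m + 2 - s) * 2 powi (m + 3 - s))" using n0 by simp
    then have "0 < (node s k i * 2 powi (m + 2 - s)) * (node s k i * 2 powi (m + 3 - s))"
      by (simp add: power2_eq_square mult_ac)
    then show ?thesis using 2 3 special by (simp add: label_of_def abs_mult)
  next
    case (generic i)
    have m0: "mid s k = node s k 0" by (simp add: node_mid)
    have dist: "\<bar>node s k i - mid s k\<bar> \<le> 2 powi s"
      using generic(2) by (auto simp: node_def)
    show ?thesis
    proof (cases "k = -1")
      case True
      then have "kindof s k = (KX, s - 2)" using generic(3) by (auto simp: kindof_def special_def)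
      then show ?thesis using node_abs_ge[of s k 0] node_abs_ge[of s k i] generic dist by (simp add: label_of_def m0)
    next
      case False
      have f: "2 powi (s - 2 + int (octave k)) \<le> \<bar>node s k 0\<bar>" "2 powi (s - 2 + int (octave k)) \<le> \<bar>node s k i\<bar>"
        "0 < node s k 0 * (if k \<ge> 0 then 1 else -1)" "0 < node s k i * (if k \<ge> 0 then 1 else -1)"
        using node_far[OF False, of 0 s] node_far[OF False generic(2), of s] by auto
      then have pos: "0 < node s k 0 * node s k i" by (auto split: if_splits intro: mult_neg_neg)
      have le: "label_of s (kindof s k) k \<le> s - 2 + int (octave k)"
        using kindof_cases[OF refl, of s k] False by (auto simp: label_of_def)
      then have "(2::real) powi (label_of s (kindof s k) k) \<le> 2 powi (s - 2 + int (octave k))"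
        by (intro power_int_increasing) auto
      then have "2 powi (label_of s (kindof s k) k) \<le> \<bar>node s k 0\<bar>" "2 powi (label_of s (kindof s k) k) \<le> \<bar>node s k i\<bar>"
        using f(1,2) by linarith+
      then show ?thesis using pos dist generic by (simp add: m0)
    qed
  qed
  then show ?A ?B "fst (snd \<kappa>) \<noteq> KX \<Longrightarrow> 0 < fst (piece s k \<kappa>) * snd (piece s k \<kappa>)"
    "fst (snd \<kappa>) = KH \<Longrightarrow> \<bar>snd (piece s k \<kappa>) - fst (piece s k \<kappa>)\<bar> \<le> 2 powi s" by blast+
qed

definition far_product ::
    "(real ^ 'n::{finite,linorder} \<Rightarrow> complex) \<Rightarrow> ('n \<Rightarrow> kind) \<Rightarrow> ('n \<Rightarrow> int) \<Rightarrow> ennreal" where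
  "far_product f \<tau> r = majorant f ({j. \<tau> j = KX} \<union> {j. \<tau> j = KH}) {j. \<tau> j = KZ} (\<chi> i. 2 powi r i) *
     majorant f {j. \<tau> j = KX} ({j. \<tau> j = KH} \<union> {j. \<tau> j = KZ}) (\<chi> i. 2 powi r i)"

text \<open>The same difference is estimated twice: the \<open>KH\<close> coordinates are once
  treated by the triangle inequality and once by the derivative. Either estimate costs a factor of
  at most \<open>2 ^ CARD('n)\<close>.\<close>

lemma mdiff_pieces_square_le:
  fixes f :: "real ^ 'n::{finite,linorder} \<Rightarrow> complex"
  assumes dex: "\<And>\<eta>. \<eta> \<subset> UNIV \<Longrightarrow> D_exists \<eta> f off_hyperplanes"
    and lac: "\<And>\<eta>. \<eta> \<subset> UNIV \<Longrightarrow> lac_in_each_variable (D \<eta> f)"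
  shows "(ennreal (norm (mdiff UNIV (\<lambda>j. piece (s j) (k j) (\<kappa> j)) f w)))\<^sup>2 \<le>
    4 ^ CARD('n) * ((\<Prod>j\<in>UNIV. ennreal (piece_weight (s j) (\<kappa> j) (k j))) *
      far_product f (\<lambda>j. fst (snd (\<kappa> j))) (\<lambda>j. label_of (s j) (snd (\<kappa> j)) (k j)))"
proof -
  define p where "p j = piece (s j) (k j) (\<kappa> j)" for j
  show ?thesis
  proof (cases "\<exists>j. fst (p j) = snd (p j)")
    case True
    then obtain j where "fst (p j) = snd (p j)" by blast
    then have "mdiff UNIV p f w = 0" by (intro mdiff_degenerate[of j]) auto
    then show ?thesis by (simp add: p_def[abs_def])
  next
    case False
    then have nd: "fst (piece (s j) (k j) (\<kappa> j)) \<noteq> snd (piece (s j) (k j) (\<kappa> j))" for j by (simp add: p_def)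
    define X where "X = {j. fst (snd (\<kappa> j)) = KX}"
    define H where "H = {j. fst (snd (\<kappa> j)) = KH}"
    define Z where "Z = {j. fst (snd (\<kappa> j)) = KZ}"
    define z :: "real ^ 'n::{finite,linorder}" where "z = (\<chi> i. 2 powi label_of (s i) (snd (\<kappa> i)) (k i))"
    have z: "0 < z $ i" "z $ i \<le> \<bar>fst (p i)\<bar>" "z $ i \<le> \<bar>snd (p i)\<bar>" for i
      using piece_props(1,2)[OF nd[of i]] by (auto simp: z_def p_def)
    have part: "X \<union> H \<union> Z = UNIV" "X \<inter> H = {}" "X \<inter> Z = {}" "H \<inter> Z = {}"
    proof -
      have "fst (snd (\<kappa> j)) \<in> {KX, KH, KZ}" for j using UNIV_kind by blast
      then show "X \<union> H \<union> Z = UNIV" by (auto simp: X_def H_def Z_def)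
    qed (auto simp: X_def H_def Z_def)
    have pp: "0 < fst (p i) * snd (p i)" if "i \<in> H \<union> Z" for i
      using piece_props(3)[OF nd[of i]] that by (auto simp: p_def H_def Z_def)
    define P where "P S = (\<Prod>i\<in>S. \<bar>snd (p i) - fst (p i)\<bar>)" for S
    have P0: "P S \<ge> 0" for S unfolding P_def by (intro prod_nonneg) auto
    let ?N = "ennreal (norm (mdiff UNIV p f w))"
    have b1: "?N \<le> 2 ^ card (X \<union> H) * ennreal (P Z) * majorant f (X \<union> H) Z z"
      unfolding P_def
    proof (rule mdiff_le_majorant[OF dex lac])
      show "(X \<union> H) \<inter> Z = {}" using part(3,4) by blast
      show "(X \<union> H) \<union> Z = UNIV" by (rule part(1))
    qed (rule z pp UnI2 | assumption)+
    have b2: "?N \<le> 2 ^ card X * ennreal (P (H \<union> Z)) * majorant f X (H \<union> Z) z"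
      unfolding P_def
    proof (rule mdiff_le_majorant[OF dex lac])
      show "X \<inter> (H \<union> Z) = {}" using part(2,3) by blast
      show "X \<union> (H \<union> Z) = UNIV" using part(1) by blast
    qed (rule z pp | assumption)+
    have card2: "(2::ennreal) ^ card S \<le> 2 ^ CARD('n)" for S :: "'n set"
      by (intro power_increasing card_mono) auto
    have "?N\<^sup>2 \<le> (2 ^ card (X \<union> H) * ennreal (P Z) * majorant f (X \<union> H) Z z) * (2 ^ card X * ennreal (P (H \<union> Z)) * majorant f X (H \<union> Z) z)"
      unfolding power2_eq_square by (intro mult_mono b1 b2) auto
    also have "\<dots> = (2 ^ card (X \<union> H) * 2 ^ card X) * ((ennreal (P Z) * ennreal (P (H \<union> Z))) * (majorant f (X \<union> H) Z z * majorant f X (H \<union> Z) z))"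
      by (simp add: mult_ac)
    also have "\<dots> \<le> (2 ^ CARD('n) * 2 ^ CARD('n)) * ((\<Prod>j\<in>UNIV. ennreal (piece_weight (s j) (\<kappa> j) (k j))) * (majorant f (X \<union> H) Z z * majorant f X (H \<union> Z) z))"
    proof (intro mult_mono card2 order_refl)
      have "P Z * P (H \<union> Z) = P Z * (P H * P Z)"
        unfolding P_def using part by (subst prod.union_disjoint) auto
      also have "\<dots> = (\<Prod>i\<in>Z. (snd (p i) - fst (p i))\<^sup>2) * (\<Prod>i\<in>H. \<bar>snd (p i) - fst (p i)\<bar>)"
        unfolding P_def by (simp add: prod.distrib[symmetric] power2_eq_square mult_ac)
      also have "\<dots> \<le> (\<Prod>i\<in>Z. (snd (p i) - fst (p i))\<^sup>2) * (\<Prod>i\<in>H. 2 powi s i)"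
        using piece_props(4)[OF nd] by (intro mult_left_mono prod_mono prod_nonneg) (auto simp: p_def H_def)
      also have "\<dots> = (\<Prod>i\<in>Z. piece_weight (s i) (\<kappa> i) (k i)) * ((\<Prod>i\<in>H. piece_weight (s i) (\<kappa> i) (k i)) * (\<Prod>i\<in>X. piece_weight (s i) (\<kappa> i) (k i)))"
      proof -
        have "(\<Prod>i\<in>Z. (snd (p i) - fst (p i))\<^sup>2) = (\<Prod>i\<in>Z. piece_weight (s i) (\<kappa> i) (k i))"
          using nd by (intro prod.cong) (auto simp: Z_def piece_weight_def Let_def p_def)
        moreover have "(\<Prod>i\<in>H. 2 powi s i) = (\<Prod>i\<in>H. piece_weight (s i) (\<kappa> i) (k i))"
          using nd by (intro prod.cong) (auto simp: H_def piece_weight_def Let_def)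
        moreover have "(\<Prod>i\<in>X. piece_weight (s i) (\<kappa> i) (k i)) = 1"
          using nd by (intro prod.neutral) (auto simp: X_def piece_weight_def Let_def)
        ultimately show ?thesis by simp
      qed
      also have "\<dots> = (\<Prod>i\<in>UNIV. piece_weight (s i) (\<kappa> i) (k i))"
        unfolding part(1)[symmetric] using part(2-4)
        by (subst prod.union_disjoint, simp, simp, blast, subst prod.union_disjoint) (auto simp: mult_ac)
      finally have "ennreal (P Z * P (H \<union> Z)) \<le> ennreal (\<Prod>i\<in>UNIV. piece_weight (s i) (\<kappa> i) (k i))" by (rule ennreal_leI)
      then show "ennreal (P Z) * ennreal (P (H \<union> Z)) \<le> (\<Prod>j\<in>UNIV. ennreal (piece_weight (s j) (\<kappa> j) (k j)))"
        using P0 by (simp add: ennreal_mult prod_ennreal piece_weight_nonneg)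
    qed auto
    also have "(2 ^ CARD('n) * 2 ^ CARD('n) :: ennreal) = 4 ^ CARD('n)" by (simp flip: power_mult_distrib)
    finally show ?thesis by (simp add: p_def[abs_def] far_product_def X_def H_def Z_def z_def)
  qed
qed

text \<open>
  \<open>piece_norm\<close> is, up to a factor, the \<open>\<ell>\<^sup>2\<close> norm over \<open>k\<close> of the square roots of \<open>piece_weight\<close>. For
  \<open>KH\<close> the weight stays inside the sum over \<open>r\<close>, where it plays the role of \<open>dx\<^sub>\<eta>\<close>.
\<close>

definition label_mask :: "kind \<Rightarrow> int \<Rightarrow> int \<Rightarrow> ennreal" where
  "label_mask kd m r = (if kd = KH then (if r > m then ennreal (2 powi r) else 0) else (if r = m then 1 else 0))"

text \<open>Two contributions. In the cell around 0 an increment is at most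
  \<open>2 powi (m + 3)\<close>. Of the other cells, about \<open>2 powi (t - s)\<close> lie within
  the distance \<open>2 powi t\<close>, each with an increment of at most \<open>2 powi s\<close>,
  so their l2 norm has the order \<open>sqrt (2 powi (t + s))\<close>. Here \<open>t = m\<close>
  below the cap, while at \<open>m = 0\<close> all cells up to \<open>t = tau s\<close> are lumped
  together.\<close>

definition piece_norm_Z :: "int \<Rightarrow> int \<Rightarrow> real" where
  "piece_norm_Z s m = (if s < 4 \<and> m \<le> 0 then (if m \<le> s - 3 then 2 powi (m + 3) else 0) +
     (if m < 0 then (if m \<ge> s - 2 then 4 * sqrt (2 powi (m + s)) else 0) else 4 * sqrt (2 powi (tau s + s))) else 0)"

definition piece_norm :: "int \<Rightarrow> int \<times> kind \<times> int \<Rightarrow> real" where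
  "piece_norm s \<kappa> = (case \<kappa> of (i, kd, m) \<Rightarrow> if i \<notin> {-1, 0, 1} then 0 else
     (case kd of KX \<Rightarrow> if s \<ge> 4 \<and> m = s - 2 then 1 else 0
        | KH \<Rightarrow> if (s \<ge> 4 \<and> m = s - 3) \<or> (s < 4 \<and> m = tau s) then 4 else 0
        | KZ \<Rightarrow> piece_norm_Z s m))"

lemma card_octave_le:
  "finite {k. k \<noteq> -1 \<and> octave k \<le> P}" "card {k. k \<noteq> -1 \<and> octave k \<le> P} \<le> 4 * 2 ^ P"
proof -
  have sub: "{k. k \<noteq> -1 \<and> octave k \<le> P} \<subseteq> {- (2 ^ (P + 1))..<2 ^ (P + 1)}"
  proof
    fix k assume k: "k \<in> {k. k \<noteq> -1 \<and> octave k \<le> P}"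
    define n where "n = nat (if k \<ge> 0 then k + 1 else - k - 1)"
    have n: "n > 0" "int n = (if k \<ge> 0 then k + 1 else - k - 1)" using k by (auto simp: n_def)
    have "octave k = floor_log n" using k by (simp add: octave_def n_def)
    then have "n < 2 * 2 ^ octave k" using floor_log_exp2_gt[of n] by simp
    also have "\<dots> \<le> 2 * 2 ^ P" using k by simp
    finally have "int n < 2 ^ (P + 1)" by (simp add: of_nat_less_iff[symmetric, where 'a=int] del: of_nat_less_iff)
    then show "k \<in> {- (2 ^ (P + 1))..<2 ^ (P + 1)}" using n(2) by (auto split: if_splits)
  qed
  show fin: "finite {k. k \<noteq> -1 \<and> octave k \<le> P}" by (rule finite_subset[OF sub]) simp
  have "card {k. k \<noteq> -1 \<and> octave k \<le> P} \<le> card {- (2 ^ (P + 1))..<2 ^ (P + 1) :: int}" by (rule card_mono[OF _ sub]) simp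
  also have "\<dots> = nat (2 * 2 ^ (P + 1))" by (simp add: nat_diff_distrib)
  also have "\<dots> = 4 * 2 ^ P" by (simp add: nat_mult_distrib nat_power_eq)
  finally show "card {k. k \<noteq> -1 \<and> octave k \<le> P} \<le> 4 * 2 ^ P" .
qed

lemma nn_integral_octave_le:
  assumes "c \<ge> 0" and u: "\<And>k. u k \<le> c * indicator {k. k \<noteq> -1 \<and> octave k \<le> P} k"
  shows "(\<integral>\<^sup>+k. ennreal (u k) \<partial>count_space UNIV) \<le> ennreal (4 * 2 ^ P * c)"
proof -
  have "(\<integral>\<^sup>+k. ennreal (u k) \<partial>count_space UNIV) \<le> (\<integral>\<^sup>+k. ennreal c * indicator {k. k \<noteq> -1 \<and> octave k \<le> P} k \<partial>count_space UNIV)"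
  proof (rule nn_integral_mono)
    fix k
    show "ennreal (u k) \<le> ennreal c * indicator {k. k \<noteq> -1 \<and> octave k \<le> P} k"
      using u[of k] by (auto simp: indicator_def ennreal_leI ennreal_neg split: if_splits)
  qed
  also have "\<dots> = ennreal c * ennreal (real (card {k. k \<noteq> -1 \<and> octave k \<le> P}))"
    using card_octave_le(1)[of P] by (simp add: nn_integral_cmult_indicator ennreal_of_nat_eq_real_of_nat)
  also have "\<dots> \<le> ennreal c * ennreal (4 * 2 ^ P)"
  proof (intro mult_left_mono ennreal_leI)
    have "real (card {k. k \<noteq> -1 \<and> octave k \<le> P}) \<le> real (4 * 2 ^ P)" using card_octave_le(2) by (rule of_nat_mono)
    then show "real (card {k. k \<noteq> -1 \<and> octave k \<le> P}) \<le> 4 * 2 ^ P" by simp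
  qed simp
  also have "\<dots> = ennreal (4 * 2 ^ P * c)" using assms(1) by (simp add: ennreal_mult[symmetric] mult.commute)
  finally show ?thesis .
qed

section \<open>Dyadic lower bound for the integrals\<close>

definition dyad :: "int \<Rightarrow> real set" where "dyad k = {2 powi (k - 1)<..<2 powi k}"

lemma emeasure_dyad: "emeasure lborel (dyad k) = ennreal (2 powi (k - 1))"
proof -
  have "(2::real) powi k - 2 powi (k - 1) = 2 powi (k - 1)" by (simp add: power_int_diff)
  moreover have "(2::real) powi (k - 1) \<le> 2 powi k" by (simp add: power_int_increasing)
  ultimately show ?thesis by (simp add: dyad_def)
qed

lemma dyad_sets [measurable]: "dyad k \<in> sets borel" by (simp add: dyad_def)

lemma dyad_disjoint:
  assumes "x \<in> dyad k" "x \<in> dyad l" shows "k = l"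
proof (rule ccontr)
  assume "k \<noteq> l"
  then consider "k \<le> l - 1" | "l \<le> k - 1" by linarith
  then show False
  proof cases
    case 1
    then have "(2::real) powi k \<le> 2 powi (l - 1)" by (intro power_int_increasing) auto
    then show False using assms by (auto simp: dyad_def)
  next
    case 2
    then have "(2::real) powi l \<le> 2 powi (k - 1)" by (intro power_int_increasing) auto
    then show False using assms by (auto simp: dyad_def)
  qed
qed

text \<open>The sum is the integral of a step function that lies below \<open>F\<close>. Only the
  step function is integrated explicitly, so the estimate applies to integrands built from
  majorants, which are suprema over uncountable families.\<close>

lemma nn_integral_ge_dyadic_sum:
  fixes I :: "'n::finite set" and F :: "('n \<Rightarrow> real) \<Rightarrow> ennreal" and G :: "('n \<Rightarrow> int) \<Rightarrow> ennreal"
  assumes GF: "\<And>m x. m \<in> PiE I C \<Longrightarrow> x \<in> PiE I (\<lambda>i. dyad (m i)) \<Longrightarrow> G m \<le> F x"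
  shows "(\<integral>\<^sup>+m. G m * (\<Prod>i\<in>I. ennreal (2 powi (m i - 1))) * indicator (PiE I C) m \<partial>count_space UNIV)
    \<le> (\<integral>\<^sup>+x. F x \<partial>PiM I (\<lambda>_. lborel))"
proof -
  interpret product_sigma_finite "\<lambda>_::'n. lborel :: real measure" ..
  define X where "X m = PiE I (\<lambda>i. dyad (m i))" for m
  have Xs: "X m \<in> sets (PiM I (\<lambda>_. lborel))" for m unfolding X_def by (intro sets_PiM_I_finite) auto
  have [measurable]: "indicator (X m) \<in> borel_measurable (PiM I (\<lambda>_. lborel))" for m
    by (rule borel_measurable_indicator[OF Xs])
  have cnt: "countable (UNIV :: ('n \<Rightarrow> int) set)" by simp
  have "G m * (\<Prod>i\<in>I. ennreal (2 powi (m i - 1))) * indicator (PiE I C) m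
      = (\<integral>\<^sup>+x. G m * indicator (PiE I C) m * indicator (X m) x \<partial>PiM I (\<lambda>_. lborel))" for m
  proof -
    have "emeasure (PiM I (\<lambda>_. lborel)) (X m) = (\<Prod>i\<in>I. ennreal (2 powi (m i - 1)))"
      unfolding X_def by (subst emeasure_PiM) (auto simp: emeasure_dyad)
    then show ?thesis by (subst nn_integral_cmult_indicator[OF Xs]) (simp add: mult_ac)
  qed
  then have "(\<integral>\<^sup>+m. G m * (\<Prod>i\<in>I. ennreal (2 powi (m i - 1))) * indicator (PiE I C) m \<partial>count_space UNIV)
      = (\<integral>\<^sup>+m. \<integral>\<^sup>+x. G m * indicator (PiE I C) m * indicator (X m) x \<partial>PiM I (\<lambda>_. lborel) \<partial>count_space UNIV)" by simp
  also have "\<dots> = (\<integral>\<^sup>+x. \<integral>\<^sup>+m. G m * indicator (PiE I C) m * indicator (X m) x \<partial>count_space UNIV \<partial>PiM I (\<lambda>_. lborel))"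
    by (rule nn_integral_count_space_nn_integral[symmetric, OF cnt]) measurable
  also have "\<dots> \<le> (\<integral>\<^sup>+x. F x \<partial>PiM I (\<lambda>_. lborel))"
  proof (rule nn_integral_mono)
    fix x :: "'n \<Rightarrow> real"
    show "(\<integral>\<^sup>+m. G m * indicator (PiE I C) m * indicator (X m) x \<partial>count_space UNIV) \<le> F x"
    proof (cases "\<exists>m0. m0 \<in> PiE I C \<and> x \<in> X m0")
      case True
      then obtain m0 where m0: "m0 \<in> PiE I C" "x \<in> X m0" by blast
      have uniq: "m = m0" if "m \<in> PiE I C" "x \<in> X m" for m
      proof (rule PiE_ext[OF that(1) m0(1)])
        fix i assume "i \<in> I"
        then have "x i \<in> dyad (m i)" "x i \<in> dyad (m0 i)" using that(2) m0(2) by (auto simp: X_def PiE_iff)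
        then show "m i = m0 i" by (rule dyad_disjoint)
      qed
      have "(\<integral>\<^sup>+m. G m * indicator (PiE I C) m * indicator (X m) x \<partial>count_space UNIV)
         \<le> (\<integral>\<^sup>+m. G m0 * indicator {m0} m \<partial>count_space UNIV)"
      proof (rule nn_integral_mono)
        fix m
        show "G m * indicator (PiE I C) m * indicator (X m) x \<le> G m0 * indicator {m0} m"
        proof (cases "m \<in> PiE I C \<and> x \<in> X m")
          case True
          then have "m = m0" using uniq by blast
          then show ?thesis using m0 by simp
        next
          case False
          then have z0: "indicator (PiE I C) m * indicator (X m) x = (0::ennreal)" by (metis indicator_simps(2) mult_zero_left mult_zero_right)
          show ?thesis unfolding mult.assoc z0 by simp
        qed
      qed
      also have "\<dots> = G m0" by (subst nn_integral_count_space_indicator[symmetric]) (auto simp: nn_integral_count_space_finite)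
      also have "\<dots> \<le> F x" by (rule GF[OF m0(1)]) (use m0(2) in \<open>simp add: X_def\<close>)
      finally show ?thesis .
    next
      case False
      then have "(\<integral>\<^sup>+m. G m * indicator (PiE I C) m * indicator (X m) x \<partial>count_space UNIV) = (\<integral>\<^sup>+m. 0 \<partial>count_space (UNIV :: ('n \<Rightarrow> int) set))"
        by (intro nn_integral_cong) (auto simp: indicator_def)
      then show ?thesis by simp
    qed
  qed
  finally show ?thesis .
qed

text \<open>Moving away from 0 shrinks both the set of \<open>w\<close> and the region of the
  essential supremum. Measurability on the larger region passes to the smaller one; where it fails,
  the essential supremum over the larger region is \<open>top\<close>.\<close>

lemma majorant_antimono:
  fixes f :: "real ^ 'n::{finite,linorder} \<Rightarrow> complex"
  assumes "\<And>i. i \<in> A \<union> \<zeta> \<Longrightarrow> \<bar>x $ i\<bar> \<le> \<bar>y $ i\<bar>" "\<And>i. i \<in> \<zeta> \<Longrightarrow> x $ i \<noteq> 0"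
  shows "majorant f A \<zeta> y \<le> majorant f A \<zeta> x"
proof -
  define M where "M = PiM \<zeta> (\<lambda>_. lborel :: real measure)"
  define R where "R z = {v. \<forall>j\<in>\<zeta>. \<bar>v j\<bar> \<ge> \<bar>z $ j\<bar> \<and> \<bar>z $ j\<bar> > 0}" for z :: "real ^ 'n::{finite,linorder}"
  have R: "R z \<inter> space M \<in> sets M" for z
  proof -
    have "R z \<inter> space M = {v \<in> space M. \<forall>j\<in>\<zeta>. \<bar>v j\<bar> \<ge> \<bar>z $ j\<bar> \<and> \<bar>z $ j\<bar> > 0}" by (auto simp: R_def)
    also have "\<dots> \<in> sets M" unfolding M_def by measurable
    finally show ?thesis .
  qed
  have sub: "R y \<subseteq> R x" using assms by (auto simp: R_def intro: order_trans)
  have es: "esssup (restrict_space M (R y)) g \<le> esssup (restrict_space M (R x)) g" for g :: "('n \<Rightarrow> real) \<Rightarrow> ennreal"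
  proof (cases "g \<in> borel_measurable (restrict_space M (R x))")
    case True
    have "restrict_space M (R y) = restrict_space (restrict_space M (R x)) (R y)"
      using sub by (simp add: restrict_restrict_space[OF R R] Int_absorb1)
    then have gy: "g \<in> borel_measurable (restrict_space M (R y))"
      using measurable_restrict_space1[OF True, of "R y"] by simp
    have "AE v in restrict_space M (R x). g v \<le> esssup (restrict_space M (R x)) g" by (rule esssup_AE)
    then have "AE v in restrict_space M (R y). g v \<le> esssup (restrict_space M (R x)) g"
      unfolding AE_restrict_space_iff[OF R] using sub by (auto elim!: eventually_mono)
    then show ?thesis by (rule esssup_I[OF gy])
  next
    case False
    then show ?thesis by (simp add: esssup_non_measurable)
  qed
  show ?thesis
    unfolding majorant_def M_def[symmetric] R_def[symmetric]
  proof (rule SUP_mono)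
    fix w assume "w \<in> {w. \<forall>i\<in>A. \<bar>y $ i\<bar> \<le> \<bar>w $ i\<bar>}"
    then have "w \<in> {w. \<forall>i\<in>A. \<bar>x $ i\<bar> \<le> \<bar>w $ i\<bar>}" using assms(1) by (auto intro: order_trans)
    then show "\<exists>m\<in>{w. \<forall>i\<in>A. \<bar>x $ i\<bar> \<le> \<bar>w $ i\<bar>}.
      esssup (restrict_space M (R y)) (\<lambda>v. ennreal (norm (D \<zeta> f (\<chi> i. if i \<in> \<zeta> then v i else w $ i))))
      \<le> esssup (restrict_space M (R x)) (\<lambda>v. ennreal (norm (D \<zeta> f (\<chi> i. if i \<in> \<zeta> then v i else m $ i))))"
      using es by blast
  qed
qed

definition dyadic_product ::
    "(real ^ 'n::{finite,linorder} \<Rightarrow> complex) \<Rightarrow> 'n set \<Rightarrow> 'n set \<Rightarrow> 'n set \<Rightarrow> ('n \<Rightarrow> int) \<Rightarrow> ennreal" where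
  "dyadic_product f \<xi> \<eta> \<zeta> r =
     majorant f (\<xi> \<union> \<eta>) \<zeta> (\<chi> i. 2 powi r i) * majorant f \<xi> (\<eta> \<union> \<zeta>) (\<chi> i. 2 powi r i)"

text \<open>The dyadic form of the inner integral. The condition \<open>k j > n j\<close> puts the
  whole interval of \<open>k j\<close> above that of \<open>n j\<close>, hence above every
  \<open>u j\<close> in it.\<close>

definition inner_sum ::
    "(real ^ 'n::{finite,linorder} \<Rightarrow> complex) \<Rightarrow> 'n set \<Rightarrow> 'n set \<Rightarrow> 'n set \<Rightarrow> ('n \<Rightarrow> int) \<Rightarrow> ('n \<Rightarrow> int) \<Rightarrow> ennreal" where
  "inner_sum f \<xi> \<eta> \<zeta> m n = (\<integral>\<^sup>+k. dyadic_product f \<xi> \<eta> \<zeta> (\<lambda>i. if i \<in> \<zeta> then m i else if i \<in> \<eta> then k i else n i) *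
      (\<Prod>j\<in>\<eta>. ennreal (2 powi (k j - 1))) * indicator (PiE \<eta> (\<lambda>j. {n j<..})) k \<partial>count_space UNIV)"

text \<open>Three nested step-function estimates, one for each of the iterated integrals. On a block
  of dyadic intervals the majorants, the logarithms and the factors \<open>1 / u i\<close> all
  decrease, so each is at least its value at the upper ends.\<close>

lemma A_integral_ge:
  fixes f :: "real ^ 'n::{finite,linorder} \<Rightarrow> complex"
  assumes U: "\<xi> \<union> \<eta> \<union> \<zeta> = UNIV" and dj: "\<xi> \<inter> \<eta> = {}" "\<xi> \<inter> \<zeta> = {}" "\<eta> \<inter> \<zeta> = {}"
  shows "(\<integral>\<^sup>+m. (ennreal (\<Prod>k\<in>\<zeta>. (1 - real_of_int (m k)) * ln 2) *
      (\<integral>\<^sup>+n. (ennsqrt (inner_sum f \<xi> \<eta> \<zeta> m n) * ennreal (\<Prod>i\<in>\<xi> \<union> \<eta>. 2 powi (- n i))) * (\<Prod>i\<in>\<xi> \<union> \<eta>. ennreal (2 powi (n i - 1)))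
         * indicator (PiE (\<xi> \<union> \<eta>) (\<lambda>_. {1..})) n \<partial>count_space UNIV)) *
      (\<Prod>k\<in>\<zeta>. ennreal (2 powi (m k - 1))) * indicator (PiE \<zeta> (\<lambda>_. {..0})) m \<partial>count_space UNIV) \<le> A_integral f \<xi> \<eta> \<zeta>"
  unfolding A_integral_def
proof (rule nn_integral_ge_dyadic_sum)
  fix m :: "'n \<Rightarrow> int" and x :: "'n \<Rightarrow> real"
  assume m: "m \<in> PiE \<zeta> (\<lambda>_. {..0})" and x: "x \<in> PiE \<zeta> (\<lambda>i. dyad (m i))"
  have xm: "0 < x k \<and> x k < 2 powi (m k) \<and> x k < 1" if "k \<in> \<zeta>" for k
  proof -
    have "x k \<in> dyad (m k)" using x that by auto
    then have 1: "2 powi (m k - 1) < x k" "x k < 2 powi (m k)" by (auto simp: dyad_def)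
    have "(0::real) < 2 powi (m k - 1)" by simp
    moreover have "(2::real) powi (m k) \<le> 2 powi 0" using m that by (intro power_int_increasing) auto
    ultimately show ?thesis using 1 order.strict_trans[of 0 "2 powi (m k - 1)" "x k"] by auto
  qed
  have xin: "x \<in> PiE \<zeta> (\<lambda>_. {0<..<1})" using xm x by (auto simp: PiE_iff)
  have lnprod: "ennreal (\<Prod>k\<in>\<zeta>. (1 - real_of_int (m k)) * ln 2) \<le> ennreal (\<Prod>k\<in>\<zeta>. ln (2 / x k))"
  proof (intro ennreal_leI prod_mono conjI)
    fix k assume k: "k \<in> \<zeta>"
    then have "m k \<le> 0" using m by auto
    then show "0 \<le> (1 - real_of_int (m k)) * ln 2" by simp
    have "ln (2 / 2 powi (m k)) \<le> ln (2 / x k)" using xm[OF k] by (intro ln_mono) (auto intro!: divide_left_mono)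
    moreover have "ln (2 / 2 powi (m k)) = (1 - real_of_int (m k)) * ln (2::real)"
    proof -
      have "(2::real) powi (m k) = 2 powr real_of_int (m k)" by (simp add: powr_real_of_int')
      then have "ln (2 powi (m k)) = real_of_int (m k) * ln (2::real)" by (simp add: ln_powr)
      then show ?thesis by (subst ln_div) (auto simp: algebra_simps)
    qed
    ultimately show "(1 - real_of_int (m k)) * ln 2 \<le> ln (2 / x k)" by simp
  qed
  define V where "V u = ennsqrt (\<integral>\<^sup>+ y \<in> (PiE \<eta> (\<lambda>j. {u j..})).
                (let z = (\<chi> i. if i \<in> \<zeta> then x i else if i \<in> \<eta> then y i else u i)
                 in majorant f (\<xi> \<union> \<eta>) \<zeta> z * majorant f \<xi> (\<eta> \<union> \<zeta>) z)
              \<partial>PiM \<eta> (\<lambda>_. lborel)) * ennreal (\<Prod>i\<in>\<xi> \<union> \<eta>. 1 / u i)" for u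
  have "(\<integral>\<^sup>+n. (ennsqrt (inner_sum f \<xi> \<eta> \<zeta> m n) * ennreal (\<Prod>i\<in>\<xi> \<union> \<eta>. 2 powi (- n i))) * (\<Prod>i\<in>\<xi> \<union> \<eta>. ennreal (2 powi (n i - 1)))
         * indicator (PiE (\<xi> \<union> \<eta>) (\<lambda>_. {1..})) n \<partial>count_space UNIV) \<le>
      (\<integral>\<^sup>+u. V u * indicator (PiE (\<xi> \<union> \<eta>) (\<lambda>_. {1<..})) u \<partial>PiM (\<xi> \<union> \<eta>) (\<lambda>_. lborel))"
  proof (rule nn_integral_ge_dyadic_sum)
    fix n :: "'n \<Rightarrow> int" and u :: "'n \<Rightarrow> real"
    assume n: "n \<in> PiE (\<xi> \<union> \<eta>) (\<lambda>_. {1..})" and u: "u \<in> PiE (\<xi> \<union> \<eta>) (\<lambda>i. dyad (n i))"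
    have un: "1 < u i \<and> u i < 2 powi (n i)" if "i \<in> \<xi> \<union> \<eta>" for i
    proof -
      have "u i \<in> dyad (n i)" using u that by auto
      then have 1: "2 powi (n i - 1) < u i" "u i < 2 powi (n i)" by (auto simp: dyad_def)
      have "(2::real) powi 0 \<le> 2 powi (n i - 1)" using PiE_mem[OF n that] by (intro power_int_increasing) auto
      then show ?thesis using 1 by auto
    qed
    have uin: "u \<in> PiE (\<xi> \<union> \<eta>) (\<lambda>_. {1<..})" using un u by (auto simp: PiE_iff)
    have pr: "ennreal (\<Prod>i\<in>\<xi> \<union> \<eta>. 2 powi (- n i)) \<le> ennreal (\<Prod>i\<in>\<xi> \<union> \<eta>. 1 / u i)"
    proof (intro ennreal_leI prod_mono conjI)
      fix i assume i: "i \<in> \<xi> \<union> \<eta>"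
      show "2 powi (- n i) \<le> 1 / u i" using un[OF i] by (simp add: power_int_minus divide_inverse le_imp_inverse_le)
    qed simp
    have inn: "inner_sum f \<xi> \<eta> \<zeta> m n \<le> (\<integral>\<^sup>+ y. (let z = (\<chi> i. if i \<in> \<zeta> then x i else if i \<in> \<eta> then y i else u i)
                 in majorant f (\<xi> \<union> \<eta>) \<zeta> z * majorant f \<xi> (\<eta> \<union> \<zeta>) z) * indicator (PiE \<eta> (\<lambda>j. {u j..})) y
              \<partial>PiM \<eta> (\<lambda>_. lborel))"
      unfolding inner_sum_def
    proof (rule nn_integral_ge_dyadic_sum)
      fix k :: "'n \<Rightarrow> int" and y :: "'n \<Rightarrow> real"
      assume k: "k \<in> PiE \<eta> (\<lambda>j. {n j<..})" and y: "y \<in> PiE \<eta> (\<lambda>i. dyad (k i))"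
      have yk: "u j \<le> y j \<and> 0 < y j \<and> y j < 2 powi (k j)" if "j \<in> \<eta>" for j
      proof -
        have "y j \<in> dyad (k j)" using y that by auto
        then have 1: "2 powi (k j - 1) < y j" "y j < 2 powi (k j)" by (auto simp: dyad_def)
        have "(2::real) powi (n j) \<le> 2 powi (k j - 1)" using k that by (intro power_int_increasing) (auto simp: PiE_iff)
        then show ?thesis using 1 un[of j] that by auto
      qed
      have yin: "y \<in> PiE \<eta> (\<lambda>j. {u j..})" using yk y by (auto simp: PiE_iff)
      define z where "z = (\<chi> i. if i \<in> \<zeta> then x i else if i \<in> \<eta> then y i else u i)"
      define w :: "real ^ 'n::{finite,linorder}" where "w = (\<chi> i. 2 powi (if i \<in> \<zeta> then m i else if i \<in> \<eta> then k i else n i))"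
      have zw: "0 < z $ i \<and> z $ i < w $ i" for i
      proof -
        consider "i \<in> \<zeta>" | "i \<in> \<eta>" "i \<notin> \<zeta>" | "i \<in> \<xi>" "i \<notin> \<eta>" "i \<notin> \<zeta>" using U by blast
        then show ?thesis
        proof cases
          case 1
          then show ?thesis using xm[of i] by (simp add: z_def w_def)
        next
          case 2
          then show ?thesis using yk[of i] by (simp add: z_def w_def)
        next
          case 3
          then show ?thesis using un[of i] by (simp add: z_def w_def)
        qed
      qed
      have zw': "\<bar>z $ i\<bar> \<le> \<bar>w $ i\<bar>" "z $ i \<noteq> 0" for i using zw[of i] by auto
      have mono: "majorant f A B w \<le> majorant f A B z" for A B
        by (rule majorant_antimono) (rule zw')+
      show "dyadic_product f \<xi> \<eta> \<zeta> (\<lambda>i. if i \<in> \<zeta> then m i else if i \<in> \<eta> then k i else n i) \<le>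
        (let z = (\<chi> i. if i \<in> \<zeta> then x i else if i \<in> \<eta> then y i else u i)
                 in majorant f (\<xi> \<union> \<eta>) \<zeta> z * majorant f \<xi> (\<eta> \<union> \<zeta>) z) * indicator (PiE \<eta> (\<lambda>j. {u j..})) y"
        unfolding dyadic_product_def Let_def z_def[symmetric] w_def[symmetric]
        using yin by (simp add: mult_mono mono)
    qed
    show "ennsqrt (inner_sum f \<xi> \<eta> \<zeta> m n) * ennreal (\<Prod>i\<in>\<xi> \<union> \<eta>. 2 powi (- n i)) \<le> V u * indicator (PiE (\<xi> \<union> \<eta>) (\<lambda>_. {1<..})) u"
      using uin unfolding V_def by (simp add: mult_mono ennsqrt_mono[OF inn] pr)
  qed
  from mult_mono[OF lnprod this]
  show "ennreal (\<Prod>k\<in>\<zeta>. (1 - real_of_int (m k)) * ln 2) *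
      (\<integral>\<^sup>+n. (ennsqrt (inner_sum f \<xi> \<eta> \<zeta> m n) * ennreal (\<Prod>i\<in>\<xi> \<union> \<eta>. 2 powi (- n i))) * (\<Prod>i\<in>\<xi> \<union> \<eta>. ennreal (2 powi (n i - 1)))
         * indicator (PiE (\<xi> \<union> \<eta>) (\<lambda>_. {1..})) n \<partial>count_space UNIV)
    \<le> ennreal (\<Prod>k\<in>\<zeta>. ln (2 / x k)) *
        (\<integral>\<^sup>+ u \<in> (PiE (\<xi> \<union> \<eta>) (\<lambda>_. {1<..})).
           ennsqrt
             (\<integral>\<^sup>+ y \<in> (PiE \<eta> (\<lambda>j. {u j..})).
                (let z = (\<chi> i. if i \<in> \<zeta> then x i else if i \<in> \<eta> then y i else u i)
                 in majorant f (\<xi> \<union> \<eta>) \<zeta> z * majorant f \<xi> (\<eta> \<union> \<zeta>) z)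
              \<partial>PiM \<eta> (\<lambda>_. lborel)) *
           ennreal (\<Prod>i\<in>\<xi> \<union> \<eta>. 1 / u i)
         \<partial>PiM (\<xi> \<union> \<eta>) (\<lambda>_. lborel)) * indicator (PiE \<zeta> (\<lambda>_. {0<..<1})) x"
    using xin unfolding V_def by simp
qed

section \<open>Summation over the levels\<close>

text \<open>Kind \<open>KX\<close> occurs only in the cell around 0, so a single \<open>k\<close>
  contributes.\<close>

lemma piece_weight_sum_KX:
  "(\<integral>\<^sup>+k. ennreal (piece_weight s (i, KX, m) k) * indicator {r} (label_of s (KX, m) k) \<partial>count_space UNIV)
    \<le> ennreal ((piece_norm s (i, KX, m))\<^sup>2) * label_mask KX m r"
proof -
  have u: "ennreal (piece_weight s (i, KX, m) k) \<le> ennreal ((piece_norm s (i, KX, m))\<^sup>2) * indicator {-1::int} k" for k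
  proof (cases "fst (piece s k (i, KX, m)) = snd (piece s k (i, KX, m))")
    case True
    then show ?thesis by (simp add: piece_weight_def)
  next
    case False
    then show ?thesis
    proof (cases rule: piece_cases)
      case (generic i')
      then have kd: "kindof s k = (KX, m)" and i: "i \<in> {-1, 0, 1}" by auto
      have v: "piece_weight s (i, KX, m) k = 1" using False by (simp add: piece_weight_def Let_def)
      from kindof_cases[OF kd] have "s \<ge> 4" "m = s - 2" "k = -1" by auto
      then have "piece_norm s (i, KX, m) = 1" using i by (auto simp: piece_norm_def)
      then show ?thesis using v \<open>k = -1\<close> by simp
    qed auto
  qed
  have "(\<integral>\<^sup>+k. ennreal (piece_weight s (i, KX, m) k) * indicator {r} (label_of s (KX, m) k) \<partial>count_space UNIV)
    \<le> (\<integral>\<^sup>+k. (ennreal ((piece_norm s (i, KX, m))\<^sup>2) * label_mask KX m r) * indicator {-1::int} k \<partial>count_space UNIV)"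
  proof (rule nn_integral_mono)
    fix k
    show "ennreal (piece_weight s (i, KX, m) k) * indicator {r} (label_of s (KX, m) k) \<le> (ennreal ((piece_norm s (i, KX, m))\<^sup>2) * label_mask KX m r) * indicator {-1::int} k"
      using u[of k] by (cases "r = m") (simp_all add: label_of_def label_mask_def)
  qed
  also have "\<dots> = ennreal ((piece_norm s (i, KX, m))\<^sup>2) * label_mask KX m r"
    by (subst nn_integral_count_space_indicator[symmetric]) (auto simp: nn_integral_count_space_finite)
  finally show ?thesis .
qed

text \<open>At most \<open>4 * 2 ^ P\<close> cells have octave at most \<open>P = r - s + 2\<close>,
  each of weight \<open>2 powi s\<close>. Together this is \<open>16 * 2 powi r\<close>, free of the
  level, and the square root of 16 is the 4 in \<open>piece_norm\<close>.\<close>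

lemma piece_weight_sum_KH:
  "(\<integral>\<^sup>+k. ennreal (piece_weight s (i, KH, m) k) * indicator {r} (label_of s (KH, m) k) \<partial>count_space UNIV)
    \<le> ennreal ((piece_norm s (i, KH, m))\<^sup>2) * label_mask KH m r"
proof -
  have u: "piece_weight s (i, KH, m) k = 0 \<or> (i \<in> {-1, 0, 1} \<and> ((s \<ge> 4 \<and> m = s - 3) \<or> (s < 4 \<and> m = tau s)) \<and> k \<noteq> -1 \<and>
     m < s - 2 + int (octave k) \<and> piece_weight s (i, KH, m) k = 2 powi s)" for k
  proof (cases "fst (piece s k (i, KH, m)) = snd (piece s k (i, KH, m))")
    case True
    then show ?thesis by (simp add: piece_weight_def)
  next
    case False
    then show ?thesis
    proof (cases rule: piece_cases)
      case (generic i')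
      then have kd: "kindof s k = (KH, m)" and i: "i \<in> {-1, 0, 1}" by auto
      have v: "piece_weight s (i, KH, m) k = 2 powi s" using False by (simp add: piece_weight_def Let_def)
      from kindof_cases[OF kd] have "((s \<ge> 4 \<and> m = s - 3) \<or> (s < 4 \<and> m = tau s)) \<and> k \<noteq> -1 \<and> m < s - 2 + int (octave k)"
        using generic(3) by (auto simp: special_def)
      then show ?thesis using v i by blast
    qed auto
  qed
  show ?thesis
  proof (cases "i \<in> {-1, 0, 1} \<and> ((s \<ge> 4 \<and> m = s - 3) \<or> (s < 4 \<and> m = tau s)) \<and> m < r \<and> s - 2 \<le> r")
    case True
    define P where "P = nat (r - s + 2)"
    have P: "int P = r - s + 2" using True by (simp add: P_def)
    have "(\<integral>\<^sup>+k. ennreal (piece_weight s (i, KH, m) k) * indicator {r} (label_of s (KH, m) k) \<partial>count_space UNIV)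
      = (\<integral>\<^sup>+k. ennreal (piece_weight s (i, KH, m) k * indicator {r} (label_of s (KH, m) k)) \<partial>count_space UNIV)"
      by (intro nn_integral_cong) (auto simp: indicator_def)
    also have "\<dots> \<le> ennreal (4 * 2 ^ P * 2 powi s)"
    proof (rule nn_integral_octave_le)
      fix k
      show "piece_weight s (i, KH, m) k * indicator {r} (label_of s (KH, m) k) \<le> 2 powi s * indicator {k. k \<noteq> -1 \<and> octave k \<le> P} k"
        using u[of k] P by (auto simp: indicator_def label_of_def)
    qed simp
    also have "4 * 2 ^ P * 2 powi s = (4::real)\<^sup>2 * 2 powi r"
    proof -
      have "(2::real) ^ P * 2 powi s = 2 powi (int P) * 2 powi s" by simp
      also have "\<dots> = 2 powi (r + 2)" unfolding P by (simp add: ac_simps flip: power_int_add)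
      also have "\<dots> = 4 * 2 powi r" by (simp add: power_int_add)
      finally have "(2::real) ^ P * 2 powi s = 4 * 2 powi r" .
      then show ?thesis by (simp only: mult.assoc) simp
    qed
    also have "ennreal \<dots> = ennreal ((piece_norm s (i, KH, m))\<^sup>2) * label_mask KH m r"
      using True by (auto simp: piece_norm_def label_mask_def ennreal_mult')
    finally show ?thesis .
  next
    case False
    have z: "ennreal (piece_weight s (i, KH, m) k) * indicator {r} (label_of s (KH, m) k) = 0" for k
      using u[of k] False by (auto simp: indicator_def label_of_def)
    show ?thesis unfolding z by simp
  qed
qed

text \<open>The cell around 0 contributes at most \<open>A\<^sup>2\<close>, the other cells at most
  the square of the second summand \<open>E\<close> of \<open>piece_norm_Z\<close>; then
  \<open>A\<^sup>2 + E\<^sup>2 \<le> (A + E)\<^sup>2\<close>.\<close>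

lemma piece_weight_sum_KZ:
  "(\<integral>\<^sup>+k. ennreal (piece_weight s (i, KZ, m) k) * indicator {r} (label_of s (KZ, m) k) \<partial>count_space UNIV)
    \<le> ennreal ((piece_norm s (i, KZ, m))\<^sup>2) * label_mask KZ m r"
proof -
  define A :: real where "A = (if m \<le> s - 3 then 2 powi (m + 3) else 0)"
  \<comment> \<open>A cell away from 0 has scale at least \<open>s - 2\<close> before the cap, so
    for smaller negative \<open>m\<close> there is none and \<open>c\<close> is 0. In
    \<open>P\<close>, a negative \<open>m\<close> determines the octave, whereas at
    \<open>m = 0\<close> only the bound by \<open>tau s\<close> remains.\<close>
  define c :: real where "c = (if m < 0 \<and> m < s - 2 then 0 else (2 powi s)\<^sup>2)"
  define P where "P = nat (if m < 0 then m - s + 2 else tau s - s + 2)"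
  have u: "piece_weight s (i, KZ, m) k = 0 \<or> (i \<in> {-1, 0, 1} \<and> s < 4 \<and> m \<le> 0 \<and>
     ((k = -1 \<and> m \<le> s - 3 \<and> piece_weight s (i, KZ, m) k \<le> A\<^sup>2) \<or>
      (k \<noteq> -1 \<and> octave k \<le> P \<and> piece_weight s (i, KZ, m) k \<le> c)))" for k
  proof (cases "fst (piece s k (i, KZ, m)) = snd (piece s k (i, KZ, m))")
    case True
    then show ?thesis by (simp add: piece_weight_def)
  next
    case False
    then show ?thesis
    proof (cases rule: piece_cases)
      case (special i' m')
      have i': "i' = i" "m' = m" using special by auto
      have "(2::real) powi (m + 3 - s) = 2 * 2 powi (m + 2 - s)"
        using power_int_add[of "2::real" 1 "m + 2 - s"] by (simp add: algebra_simps)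
      then have d: "node s k i * 2 powi (m + 3 - s) - node s k i * 2 powi (m + 2 - s) = node s k i * 2 powi (m + 2 - s)" by simp
      have "\<bar>node s k i * 2 powi (m + 2 - s)\<bar> \<le> 2 powi (s + 1) * 2 powi (m + 2 - s)"
        using node_special_le[of i s] special unfolding abs_mult i' by (intro mult_mono) auto
      also have "2 powi (s + 1) * 2 powi (m + 2 - s) = (2::real) powi (m + 3)"
        by (simp add: add.commute flip: power_int_add)
      also have "\<dots> = \<bar>A\<bar>" using special by (simp add: A_def i')
      finally have "(node s k i * 2 powi (m + 2 - s))\<^sup>2 \<le> A\<^sup>2" by (simp only: abs_le_square_iff)
      moreover have "piece_weight s (i, KZ, m) k = (node s k i * 2 powi (m + 2 - s))\<^sup>2"
      proof -
        have pc: "piece s k (i, KZ, m) = (node s k i * 2 powi (m + 2 - s), node s k i * 2 powi (m + 3 - s))"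
          using special i' by simp
        have "piece_weight s (i, KZ, m) k = (snd (piece s k (i, KZ, m)) - fst (piece s k (i, KZ, m)))\<^sup>2"
          using False by (simp add: piece_weight_def Let_def)
        then show ?thesis unfolding pc by (simp only: fst_conv snd_conv d)
      qed
      ultimately have "piece_weight s (i, KZ, m) k \<le> A\<^sup>2" by simp
      then show ?thesis using special by auto
    next
      case (generic i')
      have i': "i' = i" and kd: "kindof s k = (KZ, m)" using generic by auto
      have K: "s < 4" "s - 2 + int (octave k) \<le> tau s" "m = min (s - 2 + int (octave k)) 0"
        using kindof_cases[OF kd] by auto
      have k: "k \<noteq> -1" using generic(3) K by (auto simp: special_def)
      have b: "octave k \<le> P" using K by (auto simp: P_def min_def split: if_splits)
      have nc: "\<not> (m < 0 \<and> m < s - 2)" using K by auto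
      have "\<bar>node s k i - mid s k\<bar> \<le> \<bar>2 powi s\<bar>" using generic(2) by (auto simp: node_def i')
      then have "(node s k i - mid s k)\<^sup>2 \<le> (2 powi s)\<^sup>2" by (simp only: abs_le_square_iff)
      moreover have "piece_weight s (i, KZ, m) k = (node s k i - mid s k)\<^sup>2"
      proof -
        have pc: "piece s k (i, KZ, m) = (mid s k, node s k i)" using generic kd i' by simp
        have "piece_weight s (i, KZ, m) k = (snd (piece s k (i, KZ, m)) - fst (piece s k (i, KZ, m)))\<^sup>2"
          using False by (simp add: piece_weight_def Let_def)
        then show ?thesis unfolding pc by simp
      qed
      ultimately have "piece_weight s (i, KZ, m) k \<le> c" unfolding c_def if_not_P[OF nc] by simp
      then show ?thesis using generic(2) K k b by (auto simp: i')
    qed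
  qed
  have c0: "c \<ge> 0" by (simp add: c_def)
  show ?thesis
  proof (cases "i \<in> {-1, 0, 1} \<and> s < 4 \<and> m \<le> 0 \<and> r = m")
    case True
    have "(\<integral>\<^sup>+k. ennreal (piece_weight s (i, KZ, m) k) * indicator {r} (label_of s (KZ, m) k) \<partial>count_space UNIV)
      = (\<integral>\<^sup>+k. ennreal (piece_weight s (i, KZ, m) k) \<partial>count_space UNIV)"
      using True by (simp add: label_of_def)
    also have "\<dots> \<le> (\<integral>\<^sup>+k. ennreal (A\<^sup>2) * indicator {-1::int} k + ennreal (c * indicator {k. k \<noteq> -1 \<and> octave k \<le> P} k) \<partial>count_space UNIV)"
    proof (rule nn_integral_mono)
      fix k
      show "ennreal (piece_weight s (i, KZ, m) k) \<le> ennreal (A\<^sup>2) * indicator {-1::int} k + ennreal (c * indicator {k. k \<noteq> -1 \<and> octave k \<le> P} k)"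
        using u[of k] by (auto simp: ennreal_leI)
    qed
    also have "\<dots> = (\<integral>\<^sup>+k. ennreal (A\<^sup>2) * indicator {-1::int} k \<partial>count_space UNIV) + (\<integral>\<^sup>+k. ennreal (c * indicator {k. k \<noteq> -1 \<and> octave k \<le> P} k) \<partial>count_space UNIV)"
      by (rule nn_integral_add) auto
    also have "(\<integral>\<^sup>+k. ennreal (A\<^sup>2) * indicator {-1::int} k \<partial>count_space UNIV) = ennreal (A\<^sup>2)"
      by (subst nn_integral_count_space_indicator[symmetric]) (auto simp: nn_integral_count_space_finite)
    also have "ennreal (A\<^sup>2) + (\<integral>\<^sup>+k. ennreal (c * indicator {k. k \<noteq> -1 \<and> octave k \<le> P} k) \<partial>count_space UNIV)
      \<le> ennreal (A\<^sup>2) + ennreal (4 * 2 ^ P * c)"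
      by (intro add_mono nn_integral_octave_le c0) auto
    also have "\<dots> = ennreal (A\<^sup>2 + 4 * 2 ^ P * c)" using c0 by simp
    also have "\<dots> \<le> ennreal ((piece_norm_Z s m)\<^sup>2)"
    proof (rule ennreal_leI)
      define E where "E = (if m < 0 then (if m \<ge> s - 2 then 4 * sqrt (2 powi (m + s)) else 0) else 4 * sqrt (2 powi (tau s + s)))"
      have "4 * 2 ^ P * c = E\<^sup>2"
      proof (cases "m < 0 \<and> m < s - 2")
        case True
        then show ?thesis by (simp add: c_def E_def)
      next
        case False
        define t where "t = (if m < 0 then m else tau s)"
        have P: "int P = t - s + 2" using False True by (auto simp: P_def t_def tau_def)
        have "(2::real) ^ P * (2 powi s)\<^sup>2 = 2 powi (int P) * (2 powi s * 2 powi s)" by (simp add: power2_eq_square)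
        also have "\<dots> = 2 powi (t + s + 2)" unfolding P by (simp add: ac_simps flip: power_int_add)
        also have "\<dots> = 4 * 2 powi (t + s)" by (simp add: power_int_add)
        finally have "4 * 2 ^ P * c = 16 * 2 powi (t + s)" using False by (simp add: c_def)
        moreover have "E = 4 * sqrt (2 powi (t + s))" using False by (auto simp: E_def t_def)
        ultimately show ?thesis by (simp add: power_mult_distrib)
      qed
      moreover have "piece_norm_Z s m = A + E" using True by (auto simp: piece_norm_Z_def A_def E_def)
      moreover have "A \<ge> 0" "E \<ge> 0" by (auto simp: A_def E_def)
      ultimately show "A\<^sup>2 + 4 * 2 ^ P * c \<le> (piece_norm_Z s m)\<^sup>2" by (simp add: power2_sum)
    qed
    also have "\<dots> = ennreal ((piece_norm s (i, KZ, m))\<^sup>2) * label_mask KZ m r" using True by (auto simp: piece_norm_def label_mask_def)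
    finally show ?thesis .
  next
    case False
    have z: "ennreal (piece_weight s (i, KZ, m) k) * indicator {r} (label_of s (KZ, m) k) = 0" for k
      using u[of k] False by (auto simp: indicator_def label_of_def)
    show ?thesis unfolding z by simp
  qed
qed

lemma piece_weight_sum_le:
  "(\<integral>\<^sup>+k. ennreal (piece_weight s \<kappa> k) * indicator {r} (label_of s (snd \<kappa>) k) \<partial>count_space UNIV)
    \<le> ennreal ((piece_norm s \<kappa>)\<^sup>2) * label_mask (fst (snd \<kappa>)) (snd (snd \<kappa>)) r"
proof (cases \<kappa>)
  case (fields i kd m)
  then show ?thesis using piece_weight_sum_KX piece_weight_sum_KH piece_weight_sum_KZ by (cases kd) auto
qed

lemma piece_norm_Z_nonneg: "0 \<le> piece_norm_Z s m"
  by (simp add: piece_norm_Z_def)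

lemma piece_norm_nonneg: "0 \<le> piece_norm s \<kappa>"
proof (cases \<kappa>)
  case (fields i kd m)
  then show ?thesis by (cases kd) (simp_all add: piece_norm_def piece_norm_Z_nonneg)
qed

text \<open>The factor \<open>1 - m\<close>, the number of levels that contribute to the scale \<open>2 powi m\<close>, is matched by \<open>ln (2 / x)\<close>.\<close>

definition block_weight :: "kind \<Rightarrow> int \<Rightarrow> real" where
  "block_weight kd m = (if kd = KZ then (if m \<le> 0 then (1 - real_of_int m) * 2 powi m else 0) else if m \<ge> 1 then 1 else 0)"

lemma geometric_int_sum:
  assumes "0 \<le> c" "0 \<le> q" "q < 1"
  shows "(\<integral>\<^sup>+s. ennreal (c * q ^ nat (a - s)) * indicator {..a} s \<partial>count_space UNIV) = ennreal (c / (1 - q))"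
proof -
  have bij: "bij_betw (\<lambda>t. a - int t) UNIV {..a}"
    by (rule bij_betwI[where g="\<lambda>s. nat (a - s)"]) auto
  have sm: "(\<lambda>t. c * q ^ t) sums (c * (1 / (1 - q)))"
    by (intro sums_mult geometric_sums) (use assms in auto)
  have "(\<integral>\<^sup>+s. ennreal (c * q ^ nat (a - s)) * indicator {..a} s \<partial>count_space UNIV) = (\<integral>\<^sup>+s. ennreal (c * q ^ nat (a - s)) \<partial>count_space {..a})"
    by (rule nn_integral_count_space_indicator[symmetric]) simp
  also have "\<dots> = (\<integral>\<^sup>+t. ennreal (c * q ^ t) \<partial>count_space UNIV)"
    by (subst nn_integral_bij_count_space[OF bij, symmetric]) simp
  also have "\<dots> = (\<Sum>t. ennreal (c * q ^ t))" by (simp add: nn_integral_count_space_nat)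
  also have "\<dots> = ennreal (\<Sum>t. c * q ^ t)"
  proof (rule suminf_ennreal2)
    show "0 \<le> c * q ^ t" for t using assms by simp
    show "summable (\<lambda>t. c * q ^ t)" by (rule sums_summable[OF sm])
  qed
  also have "(\<Sum>t. c * q ^ t) = c / (1 - q)"
    using sums_unique[OF sm] by simp
  finally show ?thesis .
qed

text \<open>For \<open>m < 0\<close> the cell around 0 contributes \<open>8 * 2 powi m\<close> on
  each of the \<open>1 - m\<close> levels from \<open>m + 3\<close> to 3, and the other cells give a
  geometric series over \<open>s \<le> m + 2\<close>. For \<open>m = 0\<close> the first part is the
  single level 3, and the second is geometric because \<open>tau s + s\<close> falls like
  \<open>s / 2\<close>. The constant is 120 = 8 + 112, from the case \<open>m = 0\<close>.\<close>

lemma piece_norm_Z_sum_le: "(\<integral>\<^sup>+s. ennreal (piece_norm_Z s m) \<partial>count_space UNIV) \<le> 120 * ennreal (block_weight KZ m)"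
proof -
  consider "m > 0" | "m = 0" | "m < 0" by linarith
  then show ?thesis
  proof cases
    case 1
    then show ?thesis by (simp add: piece_norm_Z_def)
  next
    case 2
    \<comment> \<open>The fourth root appears because \<open>2 * (tau s + s) \<le> s + 5\<close> and
      a square root is taken once more. Since the fourth power of 6/7 exceeds 1/2, the series is at
      most 16 / (1 - 6/7) = 112.\<close>
    define q where "q = sqrt (sqrt (1 / 2))"
    have q: "0 \<le> q" "q \<le> 6 / 7"
    proof -
      have "sqrt (1 / 2) \<le> (6 / 7)\<^sup>2" by (rule real_le_lsqrt) (auto simp: power2_eq_square)
      then show "q \<le> 6 / 7" unfolding q_def by (rule real_le_lsqrt[rotated -1]) auto
    qed (simp add: q_def)
    have e: "sqrt (2 powi (tau s + s)) \<le> 4 * q ^ nat (3 - s)" if "s \<le> 3" for s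
    proof -
      define t where "t = nat (3 - s)"
      have t: "int t = 3 - s" using that by (simp add: t_def)
      have "2 * (tau s + s) \<le> 8 - int t" unfolding t tau_def by presburger
      then have "(2::real) powi (2 * (tau s + s)) \<le> 2 powi (8 - int t)" by (intro power_int_increasing) auto
      also have "(2::real) powi (8 - int t) = 16\<^sup>2 * (1 / 2) ^ t" by (simp add: power_int_diff power_one_over)
      also have "(2::real) powi (2 * (tau s + s)) = (2 powi (tau s + s))\<^sup>2" by (simp add: power2_eq_square flip: power_int_add)
      finally have "2 powi (tau s + s) \<le> sqrt (16\<^sup>2 * (1 / 2) ^ t)" by (intro real_le_rsqrt)
      also have "\<dots> = 16 * sqrt (1 / 2) ^ t" by (simp add: real_sqrt_mult real_sqrt_power)
      finally have "sqrt (2 powi (tau s + s)) \<le> sqrt (16 * sqrt (1 / 2) ^ t)" by (rule real_sqrt_le_mono)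
      also have "\<dots> = 4 * q ^ t" unfolding q_def by (simp add: real_sqrt_mult real_sqrt_power)
      finally show ?thesis by (simp add: t_def)
    qed
    have "(\<integral>\<^sup>+s. ennreal (piece_norm_Z s m) \<partial>count_space UNIV) \<le> (\<integral>\<^sup>+s. 8 * indicator {3} s + ennreal (16 * q ^ nat (3 - s)) * indicator {..3} s \<partial>count_space UNIV)"
    proof (rule nn_integral_mono)
      fix s :: int
      show "ennreal (piece_norm_Z s m) \<le> 8 * indicator {3} s + ennreal (16 * q ^ nat (3 - s)) * indicator {..3} s"
      proof (cases "s \<le> 3")
        case True
        have "piece_norm_Z s m \<le> 8 * indicator {3} s + 16 * q ^ nat (3 - s)" using e[OF True] True 2 by (auto simp: piece_norm_Z_def indicator_def)
        then have "ennreal (piece_norm_Z s m) \<le> ennreal (8 * indicator {3} s + 16 * q ^ nat (3 - s))" by (rule ennreal_leI)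
        also have "\<dots> = 8 * indicator {3} s + ennreal (16 * q ^ nat (3 - s))" using q by (subst ennreal_plus) (auto simp: indicator_def)
        finally show ?thesis using True by simp
      qed (simp add: piece_norm_Z_def)
    qed
    also have "\<dots> = (\<integral>\<^sup>+s. 8 * indicator {3::int} s \<partial>count_space UNIV) + (\<integral>\<^sup>+s. ennreal (16 * q ^ nat (3 - s)) * indicator {..3} s \<partial>count_space UNIV)"
      by (rule nn_integral_add) auto
    also have "(\<integral>\<^sup>+s. 8 * indicator {3::int} s \<partial>count_space UNIV) = (8::ennreal)"
      by (subst nn_integral_count_space_indicator[symmetric]) (auto simp: nn_integral_count_space_finite)
    also have "(\<integral>\<^sup>+s. ennreal (16 * q ^ nat (3 - s)) * indicator {..3} s \<partial>count_space UNIV) = ennreal (16 / (1 - q))"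
      using q by (intro geometric_int_sum) auto
    also have "8 + ennreal (16 / (1 - q)) \<le> ennreal 8 + ennreal 112"
      using q by (intro add_mono ennreal_leI) (auto simp: field_simps)
    also have "\<dots> = ennreal 120" by (subst ennreal_plus[symmetric]) auto
    finally show ?thesis using 2 by (simp add: block_weight_def)
  next
    case 3
    define q where "q = sqrt (1 / 2)"
    have q: "0 \<le> q" "q \<le> 3 / 4"
    proof -
      show "q \<le> 3 / 4" unfolding q_def by (rule real_le_lsqrt) (auto simp: power2_eq_square)
    qed (simp add: q_def)
    define a where "a = (2::real) powi m"
    have a: "a > 0" by (simp add: a_def)
    have a3: "(2::real) powi (m + 3) = 8 * a" by (simp add: a_def power_int_add)
    have e: "sqrt (2 powi (m + s)) = 2 * a * q ^ nat (m + 2 - s)" if "s \<le> m + 2" for s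
    proof -
      define t where "t = nat (m + 2 - s)"
      have t: "m + s = (m + 1) + (m + 1) - int t" using that by (simp add: t_def)
      have "(2::real) powi (m + s) = (2 powi (m + 1))\<^sup>2 * (1 / 2) ^ t"
      proof -
        have "(2::real) powi (m + s) = 2 powi ((m + 1) + (m + 1)) / 2 powi (int t)"
          unfolding t by (rule power_int_diff) auto
        also have "(2::real) powi ((m + 1) + (m + 1)) = (2 powi (m + 1))\<^sup>2"
          unfolding power2_eq_square by (rule power_int_add) auto
        finally show ?thesis by (simp add: power_divide)
      qed
      then have "sqrt (2 powi (m + s)) = 2 powi (m + 1) * q ^ t" by (simp add: real_sqrt_mult real_sqrt_power q_def)
      then show ?thesis by (simp add: t_def a_def power_int_add)
    qed
    have "(\<integral>\<^sup>+s. ennreal (piece_norm_Z s m) \<partial>count_space UNIV) \<le> (\<integral>\<^sup>+s. ennreal (8 * a) * indicator {m + 3..3} s + ennreal (8 * a * q ^ nat (m + 2 - s)) * indicator {..m + 2} s \<partial>count_space UNIV)"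
    proof (rule nn_integral_mono)
      fix s :: int
      show "ennreal (piece_norm_Z s m) \<le> ennreal (8 * a) * indicator {m + 3..3} s + ennreal (8 * a * q ^ nat (m + 2 - s)) * indicator {..m + 2} s"
      proof (cases "s \<le> m + 2")
        case True
        then have "piece_norm_Z s m \<le> 8 * a * q ^ nat (m + 2 - s)" using e[OF True] 3 a q by (auto simp: piece_norm_Z_def)
        then show ?thesis using True by (simp add: ennreal_leI)
      next
        case False
        then have "piece_norm_Z s m \<le> 8 * a * indicator {m + 3..3} s" using 3 a by (auto simp: piece_norm_Z_def a3)
        then have "ennreal (piece_norm_Z s m) \<le> ennreal (8 * a * indicator {m + 3..3} s)" by (rule ennreal_leI)
        also have "\<dots> = ennreal (8 * a) * indicator {m + 3..3} s" by (auto simp: indicator_def)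
        finally show ?thesis using False by simp
      qed
    qed
    also have "\<dots> = (\<integral>\<^sup>+s. ennreal (8 * a) * indicator {m + 3..3} s \<partial>count_space UNIV) + (\<integral>\<^sup>+s. ennreal (8 * a * q ^ nat (m + 2 - s)) * indicator {..m + 2} s \<partial>count_space UNIV)"
      by (rule nn_integral_add) auto
    also have "(\<integral>\<^sup>+s. ennreal (8 * a) * indicator {m + 3..3} s \<partial>count_space UNIV) = ennreal (8 * a) * ennreal (1 - real_of_int m)"
      using 3 by (simp add: nn_integral_cmult_indicator ennreal_of_nat_eq_real_of_nat)
    also have "(\<integral>\<^sup>+s. ennreal (8 * a * q ^ nat (m + 2 - s)) * indicator {..m + 2} s \<partial>count_space UNIV) = ennreal (8 * a / (1 - q))"
      using q a by (intro geometric_int_sum) auto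
    also have "ennreal (8 * a) * ennreal (1 - real_of_int m) + ennreal (8 * a / (1 - q)) \<le> ennreal (120 * ((1 - real_of_int m) * a))"
    proof -
      have "8 * a / (1 - q) \<le> 8 * a / (1 / 4)" using q a by (intro divide_left_mono) auto
      moreover have "a * 1 \<le> a * (1 - real_of_int m)" using 3 a by (intro mult_left_mono) auto
      moreover have "8 * y + z \<le> 120 * y" if "z \<le> 8 * a / (1 / 4)" "a * 1 \<le> y" for y z :: real
        using that a by simp
      ultimately have "8 * (a * (1 - real_of_int m)) + 8 * a / (1 - q) \<le> 120 * (a * (1 - real_of_int m))"
        by blast
      then have "8 * a * (1 - real_of_int m) + 8 * a / (1 - q) \<le> 120 * ((1 - real_of_int m) * a)"
        by (simp only: ac_simps)
      then show ?thesis using a 3 q by (simp add: ennreal_mult[symmetric] ennreal_plus[symmetric] ennreal_leI del: ennreal_plus)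
    qed
    also have "\<dots> = 120 * ennreal (block_weight KZ m)" using 3 by (simp add: block_weight_def a_def ennreal_mult')
    finally show ?thesis .
  qed
qed

text \<open>For \<open>KX\<close> and \<open>KH\<close> a scale is attained on boundedly many
  levels: \<open>s = m + 2\<close> for \<open>KX\<close>, and \<open>m + 3\<close>,
  \<open>5 - 2 * m\<close>, \<open>4 - 2 * m\<close> for \<open>KH\<close>, the last two being the
  solutions of \<open>tau s = m\<close>. The three nodes of a cell give a factor 3, and 400 rounds
  up 3 * 120.\<close>

lemma piece_norm_sum_le: "(\<integral>\<^sup>+s. \<integral>\<^sup>+i. ennreal (piece_norm s (i, kd, m)) \<partial>count_space UNIV \<partial>count_space UNIV) \<le> 400 * ennreal (block_weight kd m)"
proof -
  have inner: "(\<integral>\<^sup>+i. ennreal (piece_norm s (i, kd, m)) \<partial>count_space UNIV) = 3 * ennreal (piece_norm s (0, kd, m))" for s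
  proof -
    have "(\<integral>\<^sup>+i. ennreal (piece_norm s (i, kd, m)) \<partial>count_space UNIV) = (\<integral>\<^sup>+i. ennreal (piece_norm s (0, kd, m)) * indicator {-1, 0, 1::int} i \<partial>count_space UNIV)"
      by (intro nn_integral_cong) (auto simp: piece_norm_def indicator_def)
    also have "\<dots> = ennreal (piece_norm s (0, kd, m)) * 3" by (simp add: nn_integral_cmult_indicator)
    finally show ?thesis by (simp add: mult.commute)
  qed
  have "(\<integral>\<^sup>+s. ennreal (piece_norm s (0, kd, m)) \<partial>count_space UNIV) \<le> 120 * ennreal (block_weight kd m)"
  proof (cases kd)
    case KX
    have "(\<integral>\<^sup>+s. ennreal (piece_norm s (0, kd, m)) \<partial>count_space UNIV) \<le> (\<integral>\<^sup>+s. ennreal (block_weight kd m) * indicator {m + 2} s \<partial>count_space UNIV)"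
      by (intro nn_integral_mono) (auto simp: piece_norm_def block_weight_def KX)
    also have "\<dots> = ennreal (block_weight kd m) * 1" by (simp add: nn_integral_cmult_indicator)
    also have "\<dots> \<le> 120 * ennreal (block_weight kd m)" by (subst mult.commute) (intro mult_right_mono, auto)
    finally show ?thesis .
  next
    case KH
    have "(\<integral>\<^sup>+s. ennreal (piece_norm s (0, kd, m)) \<partial>count_space UNIV) \<le> (\<integral>\<^sup>+s. (4 * ennreal (block_weight kd m)) * indicator {m + 3, 5 - 2 * m, 4 - 2 * m} s \<partial>count_space UNIV)"
    proof (rule nn_integral_mono)
      fix s
      consider "s \<ge> 4" "m = s - 3" | "s < 4" "m = tau s" | "\<not> ((s \<ge> 4 \<and> m = s - 3) \<or> (s < 4 \<and> m = tau s))" by blast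
      then show "ennreal (piece_norm s (0, kd, m)) \<le> (4 * ennreal (block_weight kd m)) * indicator {m + 3, 5 - 2 * m, 4 - 2 * m} s"
      proof cases
        case 1
        then show ?thesis by (simp add: piece_norm_def block_weight_def KH)
      next
        case 2
        then have "m \<ge> 1" "s = 5 - 2 * m \<or> s = 4 - 2 * m" by (auto simp: tau_def)
        then show ?thesis using 2 by (auto simp: piece_norm_def block_weight_def KH)
      next
        case 3
        then have "piece_norm s (0, kd, m) = 0" by (auto simp: piece_norm_def KH)
        then show ?thesis by simp
      qed
    qed
    also have "\<dots> = (4 * ennreal (block_weight kd m)) * of_nat (card {m + 3, 5 - 2 * m, 4 - 2 * m})" by (simp add: nn_integral_cmult_indicator)
    also have "\<dots> \<le> (4 * ennreal (block_weight kd m)) * of_nat 3" by (intro mult_left_mono of_nat_mono) (auto simp: card_insert_if)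
    also have "\<dots> = 12 * ennreal (block_weight kd m)" by (simp add: mult.commute[of _ 3] mult.assoc[symmetric])
    also have "\<dots> \<le> 120 * ennreal (block_weight kd m)" by (intro mult_right_mono) auto
    finally show ?thesis .
  next
    case KZ
    then show ?thesis using piece_norm_Z_sum_le[of m] by (simp add: piece_norm_def)
  qed
  then have "3 * (\<integral>\<^sup>+s. ennreal (piece_norm s (0, kd, m)) \<partial>count_space UNIV) \<le> 3 * (120 * ennreal (block_weight kd m))"
    by (rule mult_left_mono) simp
  also have "\<dots> = 360 * ennreal (block_weight kd m)" by (simp add: mult.assoc[symmetric])
  also have "\<dots> \<le> 400 * ennreal (block_weight kd m)" by (intro mult_right_mono) auto
  finally show ?thesis by (simp add: inner nn_integral_cmult)
qed

section \<open>Comparison of the sum over all levels with the integrals\<close>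

definition block_sum ::
    "(real ^ 'n::{finite,linorder} \<Rightarrow> complex) \<Rightarrow> ('n \<Rightarrow> kind) \<Rightarrow> ('n \<Rightarrow> int) \<Rightarrow> ennreal" where
  "block_sum f \<tau> v = (\<integral>\<^sup>+r. (\<Prod>j\<in>UNIV. label_mask (\<tau> j) (v j) (r j)) * far_product f \<tau> r \<partial>count_space UNIV)"

lemma ennsqrt_four_power: "ennsqrt (4 ^ n) = 2 ^ n"
proof -
  have "(4::ennreal) ^ n = (2 ^ n)\<^sup>2" by (simp add: power2_eq_square flip: power_mult_distrib)
  then show ?thesis by (simp add: ennsqrt_square)
qed

text \<open>Minkowski's inequality takes the sum over pieces out of the l2 norm. For fixed pieces
  the cells are grouped by labels, and the one-dimensional weight sums factor out. What is left,
  \<open>block_sum\<close>, depends on kinds and scales but no longer on the level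
  \<open>s\<close>.\<close>

lemma coef_sum_le_block_sum:
  fixes f :: "real ^ 'n::{finite,linorder} \<Rightarrow> complex"
  assumes cont: "continuous_on UNIV f"
    and dex: "\<And>\<eta>. \<eta> \<subset> UNIV \<Longrightarrow> D_exists \<eta> f off_hyperplanes"
    and lac: "\<And>\<eta>. \<eta> \<subset> UNIV \<Longrightarrow> lac_in_each_variable (D \<eta> f)"
  shows "ennsqrt (\<integral>\<^sup>+k. ennreal ((norm (coef f s k))\<^sup>2) \<partial>count_space UNIV) \<le>
    (\<integral>\<^sup>+\<kappa>. 2 ^ CARD('n) * ((\<Prod>j\<in>UNIV. ennreal (piece_norm (s j) (\<kappa> j))) *
       ennsqrt (block_sum f (\<lambda>j. fst (snd (\<kappa> j))) (\<lambda>j. snd (snd (\<kappa> j))))) \<partial>count_space UNIV)"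
proof -
  define a where "a k \<kappa> = ennreal (norm (mdiff UNIV (\<lambda>j. piece (s j) (k j) (\<kappa> j)) f 0))" for k \<kappa>
  have "ennsqrt (\<integral>\<^sup>+k. ennreal ((norm (coef f s k))\<^sup>2) \<partial>count_space UNIV)
     \<le> ennsqrt (\<integral>\<^sup>+k. (\<integral>\<^sup>+\<kappa>. a k \<kappa> \<partial>count_space UNIV)\<^sup>2 \<partial>count_space UNIV)"
  proof (intro ennsqrt_mono nn_integral_mono)
    fix k
    have "ennreal ((norm (coef f s k))\<^sup>2) = (ennreal (norm (coef f s k)))\<^sup>2" by (simp add: ennreal_power)
    also have "\<dots> \<le> (\<integral>\<^sup>+\<kappa>. a k \<kappa> \<partial>count_space UNIV)\<^sup>2"
      unfolding a_def by (intro power_mono coef_le_pieces[OF cont]) auto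
    finally show "ennreal ((norm (coef f s k))\<^sup>2) \<le> (\<integral>\<^sup>+\<kappa>. a k \<kappa> \<partial>count_space UNIV)\<^sup>2" .
  qed
  also have "\<dots> \<le> (\<integral>\<^sup>+\<kappa>. ennsqrt (\<integral>\<^sup>+k. (a k \<kappa>)\<^sup>2 \<partial>count_space UNIV) \<partial>count_space UNIV)"
    by (rule minkowski_count_space)
  also have "\<dots> \<le> (\<integral>\<^sup>+\<kappa>. 2 ^ CARD('n) * ((\<Prod>j\<in>UNIV. ennreal (piece_norm (s j) (\<kappa> j))) *
       ennsqrt (block_sum f (\<lambda>j. fst (snd (\<kappa> j))) (\<lambda>j. snd (snd (\<kappa> j))))) \<partial>count_space UNIV)"
  proof (rule nn_integral_mono)
    fix \<kappa> :: "'n \<Rightarrow> int \<times> kind \<times> int"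
    define \<tau> where "\<tau> j = fst (snd (\<kappa> j))" for j
    define v where "v j = snd (snd (\<kappa> j))" for j
    define V where "V = (\<Prod>j\<in>UNIV. ennreal (piece_norm (s j) (\<kappa> j)))"
    have "(\<integral>\<^sup>+k. (a k \<kappa>)\<^sup>2 \<partial>count_space UNIV) \<le>
      (\<integral>\<^sup>+k. 4 ^ CARD('n) * ((\<Prod>j\<in>UNIV. ennreal (piece_weight (s j) (\<kappa> j) (k j))) *
         far_product f \<tau> (\<lambda>j. label_of (s j) (snd (\<kappa> j)) (k j))) \<partial>count_space UNIV)"
      unfolding a_def \<tau>_def by (intro nn_integral_mono mdiff_pieces_square_le dex lac)
    also have "\<dots> = 4 ^ CARD('n) * (\<integral>\<^sup>+k. (\<Prod>j\<in>UNIV. ennreal (piece_weight (s j) (\<kappa> j) (k j))) *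
         far_product f \<tau> (\<lambda>j. label_of (s j) (snd (\<kappa> j)) (k j)) \<partial>count_space UNIV)"
      by (rule nn_integral_cmult) simp
    also have "(\<integral>\<^sup>+k. (\<Prod>j\<in>UNIV. ennreal (piece_weight (s j) (\<kappa> j) (k j))) *
         far_product f \<tau> (\<lambda>j. label_of (s j) (snd (\<kappa> j)) (k j)) \<partial>count_space UNIV) =
       (\<integral>\<^sup>+r. (\<Prod>j\<in>UNIV. \<integral>\<^sup>+i. ennreal (piece_weight (s j) (\<kappa> j) i) * indicator {r j} (label_of (s j) (snd (\<kappa> j)) i) \<partial>count_space UNIV) * far_product f \<tau> r \<partial>count_space UNIV)"
      by (rule nn_integral_count_space_fibres[where w="\<lambda>j i. ennreal (piece_weight (s j) (\<kappa> j) i)" and \<rho>="\<lambda>j i. label_of (s j) (snd (\<kappa> j)) i"])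
    also have "\<dots> \<le> (\<integral>\<^sup>+r. (\<Prod>j\<in>UNIV. ennreal ((piece_norm (s j) (\<kappa> j))\<^sup>2) * label_mask (\<tau> j) (v j) (r j)) * far_product f \<tau> r \<partial>count_space UNIV)"
      unfolding \<tau>_def v_def by (intro nn_integral_mono mult_right_mono prod_mono_ennreal piece_weight_sum_le) auto
    also have "\<dots> = (\<integral>\<^sup>+r. V\<^sup>2 * ((\<Prod>j\<in>UNIV. label_mask (\<tau> j) (v j) (r j)) * far_product f \<tau> r) \<partial>count_space UNIV)"
      unfolding V_def by (simp add: prod.distrib prod_power_distrib ennreal_power piece_norm_nonneg mult.assoc)
    also have "\<dots> = V\<^sup>2 * block_sum f \<tau> v"
      unfolding block_sum_def by (rule nn_integral_cmult) simp
    finally have "(\<integral>\<^sup>+k. (a k \<kappa>)\<^sup>2 \<partial>count_space UNIV) \<le> 4 ^ CARD('n) * (V\<^sup>2 * block_sum f \<tau> v)"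
      by (simp add: mult_left_mono)
    from ennsqrt_mono[OF this]
    show "ennsqrt (\<integral>\<^sup>+k. (a k \<kappa>)\<^sup>2 \<partial>count_space UNIV) \<le> 2 ^ CARD('n) * ((\<Prod>j\<in>UNIV. ennreal (piece_norm (s j) (\<kappa> j))) *
       ennsqrt (block_sum f (\<lambda>j. fst (snd (\<kappa> j))) (\<lambda>j. snd (snd (\<kappa> j)))))"
      by (simp add: ennsqrt_mult ennsqrt_square ennsqrt_four_power V_def \<tau>_def[abs_def] v_def[abs_def])
  qed
  finally show ?thesis .
qed

text \<open>As \<open>G\<close> sees only kinds and scales, the sum over the levels meets nothing
  but the \<open>piece_norm\<close> factors and splits into one-dimensional sums.\<close>

lemma piece_norm_total_le:
  fixes G :: "('n::finite \<Rightarrow> kind \<times> int) \<Rightarrow> ennreal"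
  shows "(\<integral>\<^sup>+s. \<integral>\<^sup>+\<kappa>. (\<Prod>j\<in>UNIV. ennreal (piece_norm (s j) (\<kappa> j))) * G (\<lambda>j. snd (\<kappa> j)) \<partial>count_space UNIV \<partial>count_space UNIV)
    \<le> (\<integral>\<^sup>+q. (\<Prod>j\<in>UNIV. 400 * ennreal (block_weight (fst (q j)) (snd (q j)))) * G q \<partial>count_space UNIV)"
proof -
  define W where "W s q = (\<integral>\<^sup>+i. ennreal (piece_norm s (i, q)) \<partial>count_space UNIV)" for s and q :: "kind \<times> int"
  have fib: "(\<integral>\<^sup>+\<kappa>. ennreal (piece_norm s \<kappa>) * indicator {q} (snd \<kappa>) \<partial>count_space UNIV) = W s q" for s q
  proof -
    have "(\<integral>\<^sup>+\<kappa>. ennreal (piece_norm s \<kappa>) * indicator {q} (snd \<kappa>) \<partial>count_space UNIV)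
      = (\<integral>\<^sup>+i. \<integral>\<^sup>+p. ennreal (piece_norm s (i, p)) * indicator {q} p \<partial>count_space UNIV \<partial>count_space UNIV)"
      using nn_integral_fst_count_space[of "\<lambda>\<kappa>. ennreal (piece_norm s \<kappa>) * indicator {q} (snd \<kappa>)"] by simp
    also have "\<dots> = W s q"
      unfolding W_def
    proof (rule nn_integral_cong)
      fix i
      have "(\<integral>\<^sup>+p. ennreal (piece_norm s (i, p)) * indicator {q} p \<partial>count_space UNIV) = (\<integral>\<^sup>+p. ennreal (piece_norm s (i, p)) \<partial>count_space {q})"
        by (rule nn_integral_count_space_indicator[symmetric]) simp
      then show "(\<integral>\<^sup>+p. ennreal (piece_norm s (i, p)) * indicator {q} p \<partial>count_space UNIV) = ennreal (piece_norm s (i, q))"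
        by (simp add: nn_integral_count_space_finite)
    qed
    finally show ?thesis .
  qed
  have "(\<integral>\<^sup>+s. \<integral>\<^sup>+\<kappa>. (\<Prod>j\<in>UNIV. ennreal (piece_norm (s j) (\<kappa> j))) * G (\<lambda>j. snd (\<kappa> j)) \<partial>count_space UNIV \<partial>count_space UNIV)
    = (\<integral>\<^sup>+s. \<integral>\<^sup>+q. (\<Prod>j\<in>UNIV. W (s j) (q j)) * G q \<partial>count_space UNIV \<partial>count_space UNIV)"
    by (subst nn_integral_count_space_fibres[where w="\<lambda>j \<kappa>. ennreal (piece_norm (_ j) \<kappa>)" and \<rho>="\<lambda>j. snd"]) (simp add: fib)
  also have "\<dots> = (\<integral>\<^sup>+q. \<integral>\<^sup>+s. (\<Prod>j\<in>UNIV. W (s j) (q j)) * G q \<partial>count_space UNIV \<partial>count_space UNIV)"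
    by (rule nn_integral_count_space_swap)
  also have "\<dots> = (\<integral>\<^sup>+q. (\<Prod>j\<in>UNIV. \<integral>\<^sup>+s. W s (q j) \<partial>count_space UNIV) * G q \<partial>count_space UNIV)"
    by (simp add: nn_integral_multc nn_integral_count_space_prod[where w="\<lambda>j s. W s (_ j)"])
  also have "\<dots> \<le> (\<integral>\<^sup>+q. (\<Prod>j\<in>UNIV. 400 * ennreal (block_weight (fst (q j)) (snd (q j)))) * G q \<partial>count_space UNIV)"
  proof (intro nn_integral_mono mult_right_mono prod_mono_ennreal)
    fix q :: "'n \<Rightarrow> kind \<times> int" and j
    show "(\<integral>\<^sup>+s. W s (q j) \<partial>count_space UNIV) \<le> 400 * ennreal (block_weight (fst (q j)) (snd (q j)))"
      using piece_norm_sum_le[of "fst (q j)" "snd (q j)"] by (simp add: W_def)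
  qed auto
  finally show ?thesis .
qed

lemma nn_integral_count_space_inj_le:
  assumes inj: "inj_on \<phi> S" and out: "\<And>v. v \<notin> S \<Longrightarrow> g v = 0" and le: "\<And>v. v \<in> S \<Longrightarrow> g v \<le> h (\<phi> v)"
  shows "(\<integral>\<^sup>+v. g v \<partial>count_space UNIV) \<le> (\<integral>\<^sup>+w. h w \<partial>count_space UNIV)"
proof -
  have "(\<integral>\<^sup>+v. g v \<partial>count_space UNIV) = (\<integral>\<^sup>+v. g v * indicator S v \<partial>count_space UNIV)"
    by (rule nn_integral_cong) (use out in \<open>auto simp: indicator_def\<close>)
  also have "\<dots> = (\<integral>\<^sup>+v. g v \<partial>count_space S)" by (rule nn_integral_count_space_indicator[symmetric]) simp
  also have "\<dots> \<le> (\<integral>\<^sup>+v. h (\<phi> v) \<partial>count_space S)" by (rule nn_integral_mono) (use le in simp)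
  also have "\<dots> = (\<integral>\<^sup>+w. h w \<partial>count_space (\<phi> ` S))"
    by (rule nn_integral_bij_count_space[OF inj_on_imp_bij_betw[OF inj]])
  also have "\<dots> = (\<integral>\<^sup>+w. h w * indicator (\<phi> ` S) w \<partial>count_space UNIV)" by (rule nn_integral_count_space_indicator) simp
  also have "\<dots> \<le> (\<integral>\<^sup>+w. h w \<partial>count_space UNIV)" by (rule nn_integral_mono) (auto simp: indicator_def)
  finally show ?thesis .
qed

text \<open>The mask fixes all labels outside \<open>H\<close>, so only \<open>KH\<close> labels
  above \<open>v j\<close> are summed. It carries \<open>2 powi r j\<close>, twice the length of the
  dyadic interval, which costs a factor 2 for each such coordinate.\<close>

lemma block_sum_le_inner_sum:
  fixes f :: "real ^ 'n::{finite,linorder} \<Rightarrow> complex"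
  shows "block_sum f \<tau> v \<le> 2 ^ CARD('n) * inner_sum f {j. \<tau> j = KX} {j. \<tau> j = KH} {j. \<tau> j = KZ} v v"
proof -
  define X where "X = {j. \<tau> j = KX}"
  define H where "H = {j. \<tau> j = KH}"
  define Z where "Z = {j. \<tau> j = KZ}"
  define S where "S = {r. (\<forall>j. j \<notin> H \<longrightarrow> r j = v j) \<and> (\<forall>j. j \<in> H \<longrightarrow> v j < r j)}"
  define h where "h k = 2 ^ CARD('n) * (dyadic_product f X H Z (\<lambda>i. if i \<in> Z then v i else if i \<in> H then k i else v i) *
      (\<Prod>j\<in>H. ennreal (2 powi (k j - 1))) * indicator (PiE H (\<lambda>j. {v j<..})) k)" for k
  have "block_sum f \<tau> v \<le> (\<integral>\<^sup>+k. h k \<partial>count_space UNIV)"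
    unfolding block_sum_def
  proof (rule nn_integral_count_space_inj_le[where S=S and \<phi>="\<lambda>r. restrict r H"])
    show "inj_on (\<lambda>r. restrict r H) S"
    proof (rule inj_onI)
      fix r r' assume r: "r \<in> S" "r' \<in> S" "restrict r H = restrict r' H"
      show "r = r'"
      proof
        fix j show "r j = r' j" using r(1,2) fun_cong[OF r(3), of j] by (cases "j \<in> H") (auto simp: S_def restrict_def simp del: restrict_apply)
      qed
    qed
  next
    fix r assume "r \<notin> S"
    then obtain j where "j \<notin> H \<and> r j \<noteq> v j \<or> j \<in> H \<and> \<not> v j < r j" by (auto simp: S_def)
    then have "label_mask (\<tau> j) (v j) (r j) = 0" by (auto simp: label_mask_def H_def)
    then have "(\<Prod>j\<in>UNIV. label_mask (\<tau> j) (v j) (r j)) = 0" by (intro prod_zero bexI[of _ j]) auto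
    then show "(\<Prod>j\<in>UNIV. label_mask (\<tau> j) (v j) (r j)) * far_product f \<tau> r = 0" by simp
  next
    fix r assume r: "r \<in> S"
    have e: "(\<lambda>i. if i \<in> Z then v i else if i \<in> H then restrict r H i else v i) = r"
      using r by (auto simp: S_def H_def Z_def fun_eq_iff)
    have m: "restrict r H \<in> PiE H (\<lambda>j. {v j<..})" using r by (auto simp: S_def)
    have far: "far_product f \<tau> r = dyadic_product f X H Z r"
      by (simp add: far_product_def dyadic_product_def X_def H_def Z_def)
    have U: "(\<Prod>j\<in>UNIV. label_mask (\<tau> j) (v j) (r j)) \<le> 2 ^ CARD('n) * (\<Prod>j\<in>H. ennreal (2 powi (r j - 1)))"
    proof -
      have "(\<Prod>j\<in>UNIV. label_mask (\<tau> j) (v j) (r j)) = (\<Prod>j\<in>H. ennreal (2 powi (r j)))"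
        using r by (intro prod.mono_neutral_cong_right) (auto simp: S_def H_def label_mask_def)
      also have "\<dots> = (\<Prod>j\<in>H. 2 * ennreal (2 powi (r j - 1)))"
      proof (rule prod.cong[OF refl])
        fix j
        have "(2::real) powi (r j) = 2 * 2 powi (r j - 1)" by (simp add: power_int_diff)
        then show "ennreal (2 powi (r j)) = 2 * ennreal (2 powi (r j - 1))" by (simp add: ennreal_mult')
      qed
      also have "\<dots> = 2 ^ card H * (\<Prod>j\<in>H. ennreal (2 powi (r j - 1)))" by (simp add: prod.distrib)
      also have "\<dots> \<le> 2 ^ CARD('n) * (\<Prod>j\<in>H. ennreal (2 powi (r j - 1)))"
        by (intro mult_right_mono power_increasing card_mono) auto
      finally show ?thesis .
    qed
    have "(\<Prod>j\<in>UNIV. label_mask (\<tau> j) (v j) (r j)) * far_product f \<tau> r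
      \<le> 2 ^ CARD('n) * (\<Prod>j\<in>H. ennreal (2 powi (r j - 1))) * far_product f \<tau> r"
      by (intro mult_right_mono U) simp
    also have "\<dots> = h (restrict r H)" unfolding h_def e far using m by (simp add: mult_ac)
    finally show "(\<Prod>j\<in>UNIV. label_mask (\<tau> j) (v j) (r j)) * far_product f \<tau> r \<le> h (restrict r H)" .
  qed
  also have "\<dots> = 2 ^ CARD('n) * inner_sum f X H Z v v"
    unfolding h_def inner_sum_def by (rule nn_integral_cmult) simp
  finally show ?thesis by (simp add: X_def H_def Z_def)
qed

lemma ln2_ge_half: "1 / 2 \<le> ln (2::real)"
proof -
  have "- ln (2::real) = ln (1 / 2)" by (simp add: ln_div)
  also have "\<dots> \<le> 1 / 2 - 1" by (rule ln_le_minus_one) simp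
  finally show ?thesis by simp
qed

text \<open>The vector \<open>v\<close> is split into its \<open>Z\<close> part and the rest, which
  become the indices \<open>m\<close> and \<open>n\<close> of the dyadic bound. The weights cost a
  factor 4 and the square root of \<open>block_sum\<close> a factor 2, giving 8 per
  coordinate.\<close>

lemma weighted_block_sum_le_A_integral:
  fixes f :: "real ^ 'n::{finite,linorder} \<Rightarrow> complex"
  shows "(\<integral>\<^sup>+v. (\<Prod>j\<in>UNIV. ennreal (block_weight (\<tau> j) (v j))) * ennsqrt (block_sum f \<tau> v) \<partial>count_space UNIV)
    \<le> 8 ^ CARD('n) * A_integral f {j. \<tau> j = KX} {j. \<tau> j = KH} {j. \<tau> j = KZ}"
proof -
  define X where "X = {j. \<tau> j = KX}"
  define H where "H = {j. \<tau> j = KH}"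
  define Z where "Z = {j. \<tau> j = KZ}"
  have kd: "\<tau> j \<in> {KX, KH, KZ}" for j using UNIV_kind by blast
  then have part: "X \<union> H \<union> Z = UNIV" by (auto simp: X_def H_def Z_def)
  have dj: "X \<inter> H = {}" "X \<inter> Z = {}" "H \<inter> Z = {}" by (auto simp: X_def H_def Z_def)
  define h where "h m n = ennreal (\<Prod>k\<in>Z. (1 - real_of_int (m k)) * ln 2) *
      ((ennsqrt (inner_sum f X H Z m n) * ennreal (\<Prod>i\<in>X \<union> H. 2 powi (- n i))) * (\<Prod>i\<in>X \<union> H. ennreal (2 powi (n i - 1)))
         * indicator (PiE (X \<union> H) (\<lambda>_. {1..})) n) *
      (\<Prod>k\<in>Z. ennreal (2 powi (m k - 1))) * indicator (PiE Z (\<lambda>_. {..0})) m" for m n :: "'n \<Rightarrow> int"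
  define S where "S = {v. (\<forall>j\<in>Z. v j \<le> (0::int)) \<and> (\<forall>j\<in>X \<union> H. 1 \<le> v j)}"
  have "(\<integral>\<^sup>+v. (\<Prod>j\<in>UNIV. ennreal (block_weight (\<tau> j) (v j))) * ennsqrt (block_sum f \<tau> v) \<partial>count_space UNIV)
    \<le> (\<integral>\<^sup>+mn. 8 ^ CARD('n) * h (fst mn) (snd mn) \<partial>count_space UNIV)"
  proof (rule nn_integral_count_space_inj_le[where S=S and \<phi>="\<lambda>v. (restrict v Z, restrict v (X \<union> H))"])
    show "inj_on (\<lambda>v. (restrict v Z, restrict v (X \<union> H))) S"
    proof (rule inj_onI)
      fix v v' :: "'n \<Rightarrow> int" assume "(restrict v Z, restrict v (X \<union> H)) = (restrict v' Z, restrict v' (X \<union> H))"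
      then have e: "restrict v Z = restrict v' Z" "restrict v (X \<union> H) = restrict v' (X \<union> H)" by auto
      show "v = v'"
      proof
        fix j
        have "j \<in> Z \<or> j \<in> X \<union> H" using part by blast
        then show "v j = v' j" using fun_cong[OF e(1), of j] fun_cong[OF e(2), of j] by (auto split: if_splits)
      qed
    qed
  next
    fix v assume "v \<notin> S"
    then obtain j where "j \<in> Z \<and> \<not> v j \<le> 0 \<or> j \<in> X \<union> H \<and> \<not> 1 \<le> v j" by (auto simp: S_def)
    then have "block_weight (\<tau> j) (v j) = 0" by (auto simp: block_weight_def X_def H_def Z_def)
    then have "(\<Prod>j\<in>UNIV. ennreal (block_weight (\<tau> j) (v j))) = 0" by (intro prod_zero bexI[of _ j]) auto
    then show "(\<Prod>j\<in>UNIV. ennreal (block_weight (\<tau> j) (v j))) * ennsqrt (block_sum f \<tau> v) = 0" by simp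
  next
    fix v assume v: "v \<in> S"
    let ?I = "inner_sum f X H Z v v"
    have I: "inner_sum f X H Z (restrict v Z) (restrict v (X \<union> H)) = ?I"
    proof -
      have "(\<lambda>i. if i \<in> Z then restrict v Z i else if i \<in> H then k i else restrict v (X \<union> H) i) = (\<lambda>i. if i \<in> Z then v i else if i \<in> H then k i else v i)" for k :: "'n \<Rightarrow> int"
        using part by (auto simp: fun_eq_iff)
      moreover have "PiE H (\<lambda>j. {restrict v (X \<union> H) j<..}) = PiE H (\<lambda>j. {v j<..})"
        by (rule PiE_cong) simp
      ultimately show ?thesis by (simp add: inner_sum_def)
    qed
    \<comment> \<open>The factor that coordinate \<open>j\<close> contributes to the dyadic bound;
      for \<open>X\<close> and \<open>H\<close> it is
      \<open>2 powi (- v j) * 2 powi (v j - 1)\<close>, the lower bound for \<open>du / u\<close>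
      over a dyadic interval. For \<open>Z\<close> the 4 below compensates the half in
      \<open>2 powi (v j - 1)\<close> and \<open>ln 2 \<ge> 1 / 2\<close>.\<close>
    define d where "d j = (if j \<in> Z then (1 - real_of_int (v j)) * ln 2 * 2 powi (v j - 1) else 1 / 2)" for j
    have d0: "d j \<ge> 0" for j using v by (auto simp: d_def S_def)
    have "block_weight (\<tau> j) (v j) \<le> 4 * d j" for j
    proof (cases "j \<in> Z")
      case True
      have "2 powi (v j) = 2 * (2::real) powi (v j - 1)" by (simp add: power_int_diff)
      moreover have "v j \<le> 0" using v True by (auto simp: S_def)
      moreover have "(1 - real_of_int (v j)) * 2 powi (v j - 1) * (1 / 2) \<le> (1 - real_of_int (v j)) * 2 powi (v j - 1) * ln 2"
        using ln2_ge_half \<open>v j \<le> 0\<close> by (intro mult_left_mono) auto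
      ultimately show ?thesis using True by (simp add: block_weight_def d_def Z_def mult_ac)
    next
      case False
      then have "\<tau> j \<noteq> KZ" by (simp add: Z_def)
      then show ?thesis using False by (simp add: block_weight_def d_def)
    qed
    moreover have w0: "0 \<le> block_weight (\<tau> j) (v j)" for j by (auto simp: block_weight_def)
    ultimately have "(\<Prod>j\<in>UNIV. block_weight (\<tau> j) (v j)) \<le> (\<Prod>j\<in>UNIV. 4 * d j)" by (intro prod_mono) auto
    also have "\<dots> = 4 ^ CARD('n) * (\<Prod>j\<in>UNIV. d j)" by (simp add: prod.distrib)
    finally have "ennreal (\<Prod>j\<in>UNIV. block_weight (\<tau> j) (v j)) \<le> ennreal (4 ^ CARD('n) * (\<Prod>j\<in>UNIV. d j))" by (rule ennreal_leI)
    also have "\<dots> = 4 ^ CARD('n) * ennreal (\<Prod>j\<in>UNIV. d j)"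
      using d0 by (simp add: ennreal_mult' prod_nonneg ennreal_power[symmetric])
    finally have w: "(\<Prod>j\<in>UNIV. ennreal (block_weight (\<tau> j) (v j))) \<le> 4 ^ CARD('n) * ennreal (\<Prod>j\<in>UNIV. d j)"
      using w0 by (simp add: prod_ennreal)
    have dprod: "ennreal (\<Prod>j\<in>UNIV. d j) = ennreal (\<Prod>k\<in>Z. (1 - real_of_int (v k)) * ln 2) * (\<Prod>k\<in>Z. ennreal (2 powi (v k - 1)))
       * (ennreal (\<Prod>i\<in>X \<union> H. 2 powi (- v i)) * (\<Prod>i\<in>X \<union> H. ennreal (2 powi (v i - 1))))"
    proof -
      have "(\<Prod>j\<in>UNIV. d j) = (\<Prod>j\<in>Z. d j) * (\<Prod>j\<in>X \<union> H. d j)"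
      proof -
        have U: "UNIV = Z \<union> (X \<union> H)" using part by blast
        show ?thesis unfolding U by (rule prod.union_disjoint) (use dj in auto)
      qed
      moreover have "(\<Prod>j\<in>Z. d j) = (\<Prod>k\<in>Z. (1 - real_of_int (v k)) * ln 2) * (\<Prod>k\<in>Z. 2 powi (v k - 1))"
        by (simp add: d_def prod.distrib)
      moreover have "(\<Prod>j\<in>X \<union> H. d j) = (\<Prod>i\<in>X \<union> H. 2 powi (- v i)) * (\<Prod>i\<in>X \<union> H. 2 powi (v i - 1))"
        unfolding prod.distrib[symmetric]
      proof (rule prod.cong[OF refl])
        fix j assume "j \<in> X \<union> H"
        then have "j \<notin> Z" using dj by blast
        moreover have "(2::real) powi (- v j) * 2 powi (v j - 1) = 1 / 2" by (simp add: power_int_minus power_int_diff)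
        ultimately show "d j = 2 powi (- v j) * 2 powi (v j - 1)" by (simp add: d_def)
      qed
      moreover have "0 \<le> (\<Prod>k\<in>Z. (1 - real_of_int (v k)) * ln 2)" using v by (intro prod_nonneg) (auto simp: S_def)
      ultimately show ?thesis by (simp add: ennreal_mult prod_ennreal prod_nonneg)
    qed
    have sq: "ennsqrt (block_sum f \<tau> v) \<le> 2 ^ CARD('n) * ennsqrt ?I"
    proof -
      have "block_sum f \<tau> v \<le> 2 ^ CARD('n) * ?I" using block_sum_le_inner_sum[of f \<tau> v] by (simp add: X_def H_def Z_def)
      \<comment> \<open>Enlarged to a power of 4 so that the square root is again a power of
        2.\<close>
      also have "\<dots> \<le> 4 ^ CARD('n) * ?I" by (intro mult_right_mono power_mono) auto
      finally show ?thesis using ennsqrt_mono by (fastforce simp: ennsqrt_mult ennsqrt_four_power)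
    qed
    have "(\<Prod>j\<in>UNIV. ennreal (block_weight (\<tau> j) (v j))) * ennsqrt (block_sum f \<tau> v)
      \<le> (4 ^ CARD('n) * ennreal (\<Prod>j\<in>UNIV. d j)) * (2 ^ CARD('n) * ennsqrt ?I)"
      by (intro mult_mono w sq) auto
    also have "\<dots> = (4 ^ CARD('n) * 2 ^ CARD('n)) * (ennreal (\<Prod>j\<in>UNIV. d j) * ennsqrt ?I)" by (simp add: mult_ac)
    also have "(4 ^ CARD('n) * 2 ^ CARD('n) :: ennreal) = 8 ^ CARD('n)" by (simp flip: power_mult_distrib)
    also have "ennreal (\<Prod>j\<in>UNIV. d j) * ennsqrt ?I = h (restrict v Z) (restrict v (X \<union> H))"
      unfolding h_def I dprod using v by (simp add: S_def PiE_iff mult_ac)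
    finally show "(\<Prod>j\<in>UNIV. ennreal (block_weight (\<tau> j) (v j))) * ennsqrt (block_sum f \<tau> v)
      \<le> 8 ^ CARD('n) * h (fst (restrict v Z, restrict v (X \<union> H))) (snd (restrict v Z, restrict v (X \<union> H)))" by simp
  qed
  also have "\<dots> = 8 ^ CARD('n) * (\<integral>\<^sup>+mn. h (fst mn) (snd mn) \<partial>count_space UNIV)"
    by (rule nn_integral_cmult) simp
  also have "(\<integral>\<^sup>+mn. h (fst mn) (snd mn) \<partial>count_space UNIV) = (\<integral>\<^sup>+m. \<integral>\<^sup>+n. h m n \<partial>count_space UNIV \<partial>count_space UNIV)"
    using nn_integral_fst_count_space[of "\<lambda>mn. h (fst mn) (snd mn)"] by simp
  also have "\<dots> \<le> A_integral f X H Z"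
    using A_integral_ge[OF part dj, of f] unfolding h_def
    by (simp add: nn_integral_cmult nn_integral_multc)
  finally show ?thesis by (simp add: X_def H_def Z_def mult_left_mono)
qed

theorem theorem1p3:
  fixes f :: "real ^ 'n::{finite,linorder} \<Rightarrow> complex"
  assumes "CARD('n) \<ge> 2"
    and "f \<in> C0"
    and "\<And>\<eta>. \<eta> \<subset> UNIV \<Longrightarrow> D_exists \<eta> f off_hyperplanes"
    and "\<And>\<eta>. \<eta> \<subset> UNIV \<Longrightarrow> lac_in_each_variable (D \<eta> f)"
    and "\<And>\<eta>. \<eta> \<noteq> {} \<Longrightarrow> ess_bounded_off_hyperplanes (D \<eta> f)"
    and "\<And>\<xi> \<eta> \<zeta>. \<xi> \<union> \<eta> \<union> \<zeta> = UNIV \<Longrightarrow> \<xi> \<inter> \<eta> = {} \<Longrightarrow> \<xi> \<inter> \<zeta> = {} \<Longrightarrow> \<eta> \<inter> \<zeta> = {} \<Longrightarrow>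
           A_integral f \<xi> \<eta> \<zeta> < \<infinity>"
  shows "f \<in> A_space"
proof (rule A_space_if_coef_summable[OF assms(2)])
  have cont: "continuous_on UNIV f" using assms(2) by (simp add: C0_def)
  define G where "G q = ennsqrt (block_sum f (\<lambda>j. fst (q j)) (\<lambda>j. snd (q j)))" for q :: "'n \<Rightarrow> kind \<times> int"
  have fin: "(\<integral>\<^sup>+v. (\<Prod>j\<in>UNIV. ennreal (block_weight (\<tau> j) (v j))) * ennsqrt (block_sum f \<tau> v) \<partial>count_space UNIV) < top" for \<tau>
  proof -
    have kd: "\<tau> j \<in> {KX, KH, KZ}" for j using UNIV_kind by blast
    have "A_integral f {j. \<tau> j = KX} {j. \<tau> j = KH} {j. \<tau> j = KZ} < \<infinity>"
      by (rule assms(6)) (use kd in auto)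
    then have "8 ^ CARD('n) * A_integral f {j. \<tau> j = KX} {j. \<tau> j = KH} {j. \<tau> j = KZ} < top"
      by (simp add: ennreal_mult_less_top power_less_top_ennreal)
    then show ?thesis by (rule le_less_trans[OF weighted_block_sum_le_A_integral])
  qed
  \<comment> \<open>Kinds and scales are separated: there are only finitely many kind vectors, and
    each is controlled by its own integral.\<close>
  have bij: "bij (\<lambda>(\<tau>, v). \<lambda>j::'n. (\<tau> j :: kind, v j :: int))"
    by (rule bij_betwI[where g="\<lambda>q. (\<lambda>j. fst (q j), \<lambda>j. snd (q j))"]) auto
  have "(\<integral>\<^sup>+s. ennsqrt (\<integral>\<^sup>+k. ennreal ((norm (coef f s k))\<^sup>2) \<partial>count_space UNIV) \<partial>count_space UNIV)
    \<le> (\<integral>\<^sup>+s. \<integral>\<^sup>+\<kappa>. 2 ^ CARD('n) * ((\<Prod>j\<in>UNIV. ennreal (piece_norm (s j) (\<kappa> j))) * G (\<lambda>j. snd (\<kappa> j))) \<partial>count_space UNIV \<partial>count_space UNIV)"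
    unfolding G_def by (intro nn_integral_mono coef_sum_le_block_sum[OF cont assms(3,4)])
  also have "\<dots> = 2 ^ CARD('n) * (\<integral>\<^sup>+s. \<integral>\<^sup>+\<kappa>. (\<Prod>j\<in>UNIV. ennreal (piece_norm (s j) (\<kappa> j))) * G (\<lambda>j. snd (\<kappa> j)) \<partial>count_space UNIV \<partial>count_space UNIV)"
    by (simp add: nn_integral_cmult)
  also have "\<dots> \<le> 2 ^ CARD('n) * (\<integral>\<^sup>+q. (\<Prod>j\<in>UNIV. 400 * ennreal (block_weight (fst (q j)) (snd (q j)))) * G q \<partial>count_space UNIV)"
    by (intro mult_left_mono piece_norm_total_le) auto
  also have "(\<integral>\<^sup>+q. (\<Prod>j\<in>UNIV. 400 * ennreal (block_weight (fst (q j)) (snd (q j)))) * G q \<partial>count_space UNIV)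
    = 400 ^ CARD('n) * (\<integral>\<^sup>+q. (\<Prod>j\<in>UNIV. ennreal (block_weight (fst (q j)) (snd (q j)))) * G q \<partial>count_space UNIV)"
    by (simp add: prod.distrib nn_integral_cmult mult.assoc)
  also have "(\<integral>\<^sup>+q. (\<Prod>j\<in>UNIV. ennreal (block_weight (fst (q j)) (snd (q j)))) * G q \<partial>count_space UNIV)
    = (\<integral>\<^sup>+p. (\<Prod>j\<in>UNIV. ennreal (block_weight (fst p j) (snd p j))) * ennsqrt (block_sum f (fst p) (snd p)) \<partial>count_space UNIV)"
    by (subst nn_integral_bij_count_space[OF bij, symmetric]) (simp add: G_def case_prod_beta)
  also have "\<dots> = (\<integral>\<^sup>+\<tau>. \<integral>\<^sup>+v. (\<Prod>j\<in>UNIV. ennreal (block_weight (\<tau> j) (v j))) * ennsqrt (block_sum f \<tau> v) \<partial>count_space UNIV \<partial>count_space UNIV)"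
    using nn_integral_fst_count_space[of "\<lambda>p. (\<Prod>j\<in>UNIV. ennreal (block_weight (fst p j) (snd p j))) * ennsqrt (block_sum f (fst p) (snd p))"] by simp
  also have "\<dots> = (\<Sum>\<tau>\<in>UNIV. \<integral>\<^sup>+v. (\<Prod>j\<in>UNIV. ennreal (block_weight (\<tau> j) (v j))) * ennsqrt (block_sum f \<tau> v) \<partial>count_space UNIV)"
    by (rule nn_integral_count_space_finite) simp
  also have "2 ^ CARD('n) * (400 ^ CARD('n) * \<dots>) < \<infinity>"
    using fin by (simp add: ennreal_mult_less_top power_less_top_ennreal)
  finally show "(\<integral>\<^sup>+s. ennsqrt (\<integral>\<^sup>+k. ennreal ((norm (coef f s k))\<^sup>2) \<partial>count_space UNIV) \<partial>count_space UNIV) < \<infinity>" .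
qed

end
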